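(* $\textsc{AchievementPos}(3,2)$ is {\sf NP}-hard.
   Context: A hypergraph is a pair $(V,E)$ with $V$ finite and $E\subseteq 2^V\setminus\{\varnothing\}$. An achievement positional game is a triple $\mathcal{G}=(V,E_L,E_R)$ where $(V,E_L)$ and $(V,E_R)$ are hypergraphs; elements of $E_L$ are blue edges, elements of $E_R$ are red edges. Two players, Left and Right, alternately pick a previously unpicked vertex of $V$ (either player may be designated to start). A player fills an edge when they have picked all its vertices. If Left fills a blue edge before Right fills a red edge, Left wins; if Right fills a red edge before Left fills a blue edge, Right wins; if neither happens before all vertices are picked, the game is a draw. For integers $p,q\ge 0$, $\textsc{AchievementPos}(p,q)$ is the decision problem: given an achievement positional game $\mathcal{G}=(V,E_L,E_R)$ in which every element of $E_L$ has size at most $p$ and every element of $E_R$ has size at most $q$, decide whether Left has a winning strategy on $\mathcal{G}$ as first player. *)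

theory Defs
  imports Main
begin

text \<open>An instance is given by a number n of vertices (vertex set V = {0..<n}),
  a set EL of blue edges and a set ER of red edges.  Every hypergraph on a
  finite vertex set is isomorphic to one on {0..<n}, and the winner is invariant
  under renaming of vertices.\<close>

definition hypergraph_on :: "nat \<Rightarrow> nat set set \<Rightarrow> bool" where
  "hypergraph_on n E \<longleftrightarrow> (\<forall>e\<in>E. e \<noteq> {} \<and> e \<subseteq> {..<n})"

definition filled :: "nat set set \<Rightarrow> nat set \<Rightarrow> bool" where
  "filled E S \<longleftrightarrow> (\<exists>e\<in>E. e \<subseteq> S)"

text \<open>left_wins k turnL V EL ER A B: Left has a winning strategy from the
  position where Left has picked A, Right has picked B, no edge has been filled
  yet (by the player concerned), it is Left's turn iff turnL, and k is the number
  of unpicked vertices (fuel).  When no vertex is left the game is a draw,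
  hence not a win for Left.\<close>

fun left_wins :: "nat \<Rightarrow> bool \<Rightarrow> nat set \<Rightarrow> nat set set \<Rightarrow> nat set set \<Rightarrow> nat set \<Rightarrow> nat set \<Rightarrow> bool" where
  "left_wins 0 turnL V EL ER A B = False"
| "left_wins (Suc k) True V EL ER A B =
     (\<exists>v \<in> V - (A \<union> B). filled EL (insert v A) \<or> left_wins k False V EL ER (insert v A) B)"
| "left_wins (Suc k) False V EL ER A B =
     (V - (A \<union> B) \<noteq> {} \<and>
      (\<forall>v \<in> V - (A \<union> B). \<not> filled ER (insert v B) \<and> left_wins k True V EL ER A (insert v B)))"

definition left_wins_first :: "nat \<Rightarrow> nat set set \<Rightarrow> nat set set \<Rightarrow> bool" where
  "left_wins_first n EL ER = left_wins n True {..<n} EL ER {} {}"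

definition valid_instance :: "nat \<Rightarrow> nat \<Rightarrow> nat \<Rightarrow> nat set set \<Rightarrow> nat set set \<Rightarrow> bool" where
  "valid_instance p q n EL ER \<longleftrightarrow>
     hypergraph_on n EL \<and> hypergraph_on n ER \<and>
     (\<forall>e\<in>EL. card e \<le> p) \<and> (\<forall>e\<in>ER. card e \<le> q)"

text \<open>Tokens are 2-bit blocks: [T,T] is a unary digit, [T,F] ends a vertex,
  [F,T] ends an edge (or the vertex count), [F,F] separates blue from red edges.\<close>

definition tok_one :: "bool list" where "tok_one = [True, True]"
definition tok_vend :: "bool list" where "tok_vend = [True, False]"
definition tok_eend :: "bool list" where "tok_eend = [False, True]"
definition tok_sep :: "bool list" where "tok_sep = [False, False]"

definition enc_unary :: "nat \<Rightarrow> bool list" where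
  "enc_unary m = concat (replicate m tok_one)"

definition enc_edge :: "nat set \<Rightarrow> bool list" where
  "enc_edge e = concat (map (\<lambda>v. enc_unary v @ tok_vend) (sorted_list_of_set e)) @ tok_eend"

definition encodes_instance :: "bool list \<Rightarrow> nat \<Rightarrow> nat set set \<Rightarrow> nat set set \<Rightarrow> bool" where
  "encodes_instance s n EL ER \<longleftrightarrow>
     (\<exists>ls rs. distinct ls \<and> set ls = EL \<and> distinct rs \<and> set rs = ER \<and>
        s = enc_unary n @ tok_eend @ concat (map enc_edge ls) @ tok_sep @ concat (map enc_edge rs))"

definition achievement_pos_lang :: "nat \<Rightarrow> nat \<Rightarrow> bool list set" where
  "achievement_pos_lang p q =
     {s. \<exists>n EL ER. valid_instance p q n EL ER \<and> encodes_instance s n EL ER \<and> left_wins_first n EL ER}"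

text \<open>Deterministic single-tape Turing machine with two-way infinite tape.
  A machine is (Q, G, delta): states 0..<Q (0 initial, 1 accepting, 2 rejecting;
  1 and 2 are halting), tape symbols 0..<G with 0 = blank, 1 = bit False,
  2 = bit True.  delta q a = (q', a', d) with head move d in {-1,0,1}.\<close>

type_synonym tm = "nat \<times> nat \<times> (nat \<Rightarrow> nat \<Rightarrow> nat \<times> nat \<times> int)"
type_synonym config = "nat \<times> (int \<Rightarrow> nat) \<times> int"

definition wf_tm :: "tm \<Rightarrow> bool" where
  "wf_tm M = (case M of (Q, G, \<delta>) \<Rightarrow> 3 \<le> Q \<and> 3 \<le> G \<and>
     (\<forall>q<Q. \<forall>a<G. case \<delta> q a of (q', a', d) \<Rightarrow> q' < Q \<and> a' < G \<and> d \<in> {-1, 0, 1}))"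

definition bit_sym :: "bool \<Rightarrow> nat" where
  "bit_sym b = (if b then 2 else 1)"

definition tm_step :: "tm \<Rightarrow> config \<Rightarrow> config" where
  "tm_step M c = (case M of (Q, G, \<delta>) \<Rightarrow> case c of (q, tp, h) \<Rightarrow>
     if q = 1 \<or> q = 2 then c
     else (case \<delta> q (tp h) of (q', a', d) \<Rightarrow> (q', tp(h := a'), h + d)))"

definition init_config :: "bool list \<Rightarrow> config" where
  "init_config x = (0, \<lambda>i. if 0 \<le> i \<and> i < int (length x) then bit_sym (x ! nat i) else 0, 0)"

definition tm_run :: "tm \<Rightarrow> nat \<Rightarrow> bool list \<Rightarrow> config" where
  "tm_run M t x = (tm_step M ^^ t) (init_config x)"

definition halted :: "config \<Rightarrow> bool" where
  "halted c \<longleftrightarrow> fst c = 1 \<or> fst c = 2"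

definition accepting :: "config \<Rightarrow> bool" where
  "accepting c \<longleftrightarrow> fst c = 1"

definition tape_output :: "config \<Rightarrow> bool list \<Rightarrow> bool" where
  "tape_output c y \<longleftrightarrow> (case c of (q, tp, h) \<Rightarrow>
     (\<forall>i<length y. tp (int i) = bit_sym (y ! i)) \<and> tp (int (length y)) = 0)"

definition poly_time_tm :: "tm \<Rightarrow> bool" where
  "poly_time_tm M \<longleftrightarrow> wf_tm M \<and>
     (\<exists>c k. \<forall>x. halted (tm_run M (c * length x ^ k + c) x))"

definition pair_enc :: "bool list \<Rightarrow> bool list \<Rightarrow> bool list" where
  "pair_enc x w = concat (map (\<lambda>b. [False, b]) x) @ [True, True] @ w"

definition in_NP :: "bool list set \<Rightarrow> bool" where
  "in_NP L \<longleftrightarrow> (\<exists>M c k. poly_time_tm M \<and>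
     (\<forall>x. x \<in> L \<longleftrightarrow> (\<exists>w. length w \<le> c * length x ^ k + c \<and>
           (\<exists>t. accepting (tm_run M t (pair_enc x w))))))"

definition poly_reducible :: "bool list set \<Rightarrow> bool list set \<Rightarrow> bool" where
  "poly_reducible L L' \<longleftrightarrow> (\<exists>M c k f. wf_tm M \<and>
     (\<forall>x. halted (tm_run M (c * length x ^ k + c) x) \<and>
          tape_output (tm_run M (c * length x ^ k + c) x) (f x)) \<and>
     (\<forall>x. x \<in> L \<longleftrightarrow> f x \<in> L'))"

definition NP_hard :: "bool list set \<Rightarrow> bool" where
  "NP_hard L' \<longleftrightarrow> (\<forall>L. in_NP L \<longrightarrow> poly_reducible L L')"

end

theory Submission
  imports Defs
begin

text \<open>
  A polynomial-time verifier with a given input is turned into a system of clauses whose variables say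
  which symbol stands in which cell of the computation tableau. Only implications from one row to the next and the absence of
  a non-accepting final state are required, so additional true variables never help.

  Clauses become a game as follows. Every variable is a pair of vertices forming a blue edge: when Left picks
  one of them, Right must pick the other. Every clause \<open>c\<close> is a pair \<open>b\<^sub>c, d\<^sub>c\<close> with a blue edge
  \<open>{b\<^sub>c, d\<^sub>c, l}\<close> for each literal \<open>l\<close>, so picking \<open>b\<^sub>c\<close> is a threat exactly when \<open>c\<close> has been made true.
  A red cycle on four otherwise unused vertices wins for Right as soon as Left makes a move without
  a threat. The red edges \<open>{d\<^sub>c, b\<^sub>c\<^sub>+\<^sub>1}\<close> force Left, once the first pair (itself a blue edge) is opened, to go through all clauses
  in turn, and after that Left wins by a double threat that involves the first pair.

  The reduction is computed by a program with nested counting loops over registers; a single-tape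
  machine stores the registers as marks on its tape, and each step of the program costs it one sweep.
\<close>

subsection \<open>From clauses to games\<close>

text \<open>A clause may have any number of literals although blue edges have at most three
  vertices: every literal gets an edge of its own through the common pair of the clause. The double
  threat \<open>{0, 1, 7}\<close>, \<open>{0, 2, 7}\<close> has to come last. It needs 7 =
  \<open>b 0\<close>, and taking 7 gives 8 = \<open>d 0\<close> to Right, which starts the chain of
  red threats; until that chain is used up, a move at 0 leaves a red threat unanswered. The machine
  that prints the instance holds only counters. Hence every tableau cell gets the same number of
  variables and, by padding with tautologies, the same number of clauses, so that vertex numbers are
  affine in the cell number and the row width. Clauses refer only to their own cell and to later
  ones, and within a cell the variables precede the clauses; so the vertices of an edge can be
  printed in the increasing order that the encoding prescribes without comparing numbers.\<close>

lemma filledI: "\<lbrakk>e \<in> E; e \<subseteq> S\<rbrakk> \<Longrightarrow> filled E S"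
  unfolding filled_def by blast

lemma left_wins_TrueI:
  "\<lbrakk>v \<in> V - (A \<union> B); filled EL (insert v A) \<or> left_wins k False V EL ER (insert v A) B\<rbrakk>
    \<Longrightarrow> left_wins (Suc k) True V EL ER A B"
  unfolding left_wins.simps by (rule bexI)

lemma left_wins_FalseI:
  "\<lbrakk>v \<in> V - (A \<union> B); \<And>u. u \<in> V - (A \<union> B) \<Longrightarrow> \<not> filled ER (insert u B);
    \<And>u. u \<in> V - (A \<union> B) \<Longrightarrow> left_wins k True V EL ER A (insert u B)\<rbrakk>
    \<Longrightarrow> left_wins (Suc k) False V EL ER A B"
  unfolding left_wins.simps by blast

lemma left_wins_True_Suc:
  "left_wins k True V EL ER A B \<longleftrightarrow>
     (\<exists>j. k = Suc j \<and> (\<exists>v \<in> V - (A \<union> B). filled EL (insert v A) \<or> left_wins j False V EL ER (insert v A) B))"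
  by (cases k) auto

lemma left_wins_False_Suc:
  "left_wins k False V EL ER A B \<longleftrightarrow>
     (\<exists>j. k = Suc j \<and> V - (A \<union> B) \<noteq> {} \<and>
      (\<forall>v \<in> V - (A \<union> B). \<not> filled ER (insert v B) \<and> left_wins j True V EL ER A (insert v B)))"
  by (cases k) auto

text \<open>Right takes the common vertex \<open>p\<close> of two red edges. Every blue edge is
  blocked or lacks two vertices, so Left cannot win with the next move, and that move stops at most
  one of \<open>q\<close> and \<open>r\<close>.\<close>

lemma two_red_threats:
  assumes blue: "\<And>e. e \<in> EL \<Longrightarrow> e \<inter> B \<noteq> {} \<or> (\<exists>u\<in>e. \<exists>w\<in>e. u \<noteq> w \<and> u \<notin> A \<and> w \<notin> A)"
    and AB: "A \<inter> B = {}"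
    and p: "p \<in> V - (A \<union> B)" and q: "q \<in> V - (A \<union> B)" and r: "r \<in> V - (A \<union> B)"
    and d: "p \<noteq> q" "p \<noteq> r" "q \<noteq> r"
    and red: "{p, q} \<in> ER" "{p, r} \<in> ER"
  shows "\<not> left_wins k False V EL ER A B"
proof
  assume "left_wins k False V EL ER A B"
  then obtain j where "left_wins j True V EL ER A (insert p B)"
    using p by (subst (asm) left_wins_False_Suc) blast
  then obtain i v where v: "v \<in> V - (A \<union> insert p B)"
      "filled EL (insert v A) \<or> left_wins i False V EL ER (insert v A) (insert p B)"
    by (subst (asm) left_wins_True_Suc) blast
  have "\<not> filled EL (insert v A)"
    unfolding filled_def using blue v(1) AB by blast
  with v have lw: "left_wins i False V EL ER (insert v A) (insert p B)" by blast
  define t where "t = (if v = q then r else q)"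
  have t: "t \<in> V - (insert v A \<union> insert p B)" "{p, t} \<in> ER"
    using q r d red by (auto simp: t_def)
  have "\<not> filled ER (insert t (insert p B))"
    using lw t(1) by (subst (asm) left_wins_False_Suc) blast
  then show False
    using filledI[OF t(2)] by simp
qed

text \<open>After \<open>v\<close> some blue edge lacks only \<open>w\<close>. Any other reply loses
  at once, so a single continuation has to be examined.\<close>

lemma forcing_move:
  assumes v: "v \<in> V - (A \<union> B)" and w: "w \<in> V - (A \<union> B)" "v \<noteq> w"
    and e: "e \<in> EL" "e \<subseteq> insert w (insert v A)"
    and red: "\<And>u. u \<in> V - (insert v A \<union> B) \<Longrightarrow> \<not> filled ER (insert u B)"
    and cont: "left_wins k True V EL ER (insert v A) (insert w B)"
  shows "left_wins (Suc (Suc k)) True V EL ER A B"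
proof -
  obtain j where k: "k = Suc j" using cont by (cases k) auto
  have "left_wins k True V EL ER (insert v A) (insert u B)" if u: "u \<in> V - (insert v A \<union> B)" for u
  proof (cases "u = w")
    case False
    have "filled EL (insert w (insert v A))" using e unfolding filled_def by blast
    moreover have "w \<in> V - (insert v A \<union> insert u B)" using w False by blast
    ultimately show ?thesis unfolding k by auto
  qed (use cont in simp)
  then have "left_wins (Suc k) False V EL ER (insert v A) B"
    using red w by auto
  then show ?thesis using v by (subst left_wins_True_Suc) blast
qed

text \<open>The map \<open>\<beta>\<close> leaves open where the clause pairs lie among the variable
  pairs, because the reduction numbers the pairs cell by cell. Only the opening pair 7, 8 is fixed,
  by \<open>\<beta> 0 = 0\<close>.\<close>

locale clause_game =
  fixes h m :: nat and \<beta> :: "nat \<Rightarrow> nat" and Cl :: "nat \<Rightarrow> nat set"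
  assumes \<beta>_0: "\<beta> 0 = 0" and inj: "inj_on \<beta> {..m}" and \<beta>_less: "c \<le> m \<Longrightarrow> \<beta> c < h"
    and Cl: "\<lbrakk>1 \<le> c; c \<le> m; l \<in> Cl c\<rbrakk> \<Longrightarrow> \<exists>i\<in>{..<h} - \<beta> ` {..m}. l = 7 + 2 * i \<or> l = 8 + 2 * i"
begin

definition Vars :: "nat set" where "Vars = {..<h} - \<beta> ` {..m}"
definition b :: "nat \<Rightarrow> nat" where "b c = 7 + 2 * \<beta> c"
definition d :: "nat \<Rightarrow> nat" where "d c = 8 + 2 * \<beta> c"

definition EL :: "nat set set" where
  "EL = {{7 + 2 * i, 8 + 2 * i} | i. i \<in> Vars} \<union> {{7, 8}, {0, 1, 7}, {0, 2, 7}}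
     \<union> {{b c, d c, l} | c l. 1 \<le> c \<and> c \<le> m \<and> l \<in> Cl c}"

definition ER :: "nat set set" where
  "ER = {{d c, b (Suc c)} | c. c < m} \<union> {{3, 4}, {4, 5}, {5, 6}, {3, 6}}"

definition lit :: "(nat \<Rightarrow> bool) \<Rightarrow> nat \<Rightarrow> nat" where
  "lit \<tau> i = (if \<tau> i then 7 + 2 * i else 8 + 2 * i)"

definition sat :: bool where
  "sat \<longleftrightarrow> (\<exists>\<tau>. \<forall>c. 1 \<le> c \<longrightarrow> c \<le> m \<longrightarrow> (\<exists>i\<in>Vars. lit \<tau> i \<in> Cl c))"

section \<open>Right's strategy when the clauses are unsatisfiable\<close>

abbreviation "V \<equiv> {..<7 + 2 * h}"

text \<open>These are the positions that Right can maintain while Left makes threats only. A split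
  pair blocks every blue edge through both of its vertices. By the last conjunct, the literals held
  by Left satisfy every clause that Left has opened at \<open>b c\<close>.\<close>

definition Inv :: "nat set \<Rightarrow> nat set \<Rightarrow> bool" where
  "Inv A B \<longleftrightarrow> A \<subseteq> {7..<7 + 2 * h} \<and> B \<subseteq> {7..<7 + 2 * h} \<and>
    (\<forall>i<h. (7 + 2 * i \<notin> A \<and> 7 + 2 * i \<notin> B \<and> 8 + 2 * i \<notin> A \<and> 8 + 2 * i \<notin> B) \<or>
           (7 + 2 * i \<in> A \<and> 7 + 2 * i \<notin> B \<and> 8 + 2 * i \<notin> A \<and> 8 + 2 * i \<in> B) \<or>
           (7 + 2 * i \<notin> A \<and> 7 + 2 * i \<in> B \<and> 8 + 2 * i \<in> A \<and> 8 + 2 * i \<notin> B)) \<and>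
    (\<forall>c. 1 \<le> c \<longrightarrow> c \<le> m \<longrightarrow> b c \<in> A \<longrightarrow> Cl c \<inter> A \<noteq> {})"

lemma vertex_cases:
  assumes "v \<in> V"
  obtains "v < 7" | i where "i < h" "v = 7 + 2 * i" | i where "i < h" "v = 8 + 2 * i"
proof (cases "v < 7")
  case False
  define i where "i = (v - 7) div 2"
  have "v = 7 + 2 * i \<or> v = 8 + 2 * i" "i < h" using False assms by (auto simp: i_def)
  then show ?thesis using that by blast
qed (use that in blast)

lemma Inv_disjoint:
  assumes "Inv A B" shows "A \<inter> B = {}"
proof -
  have False if v: "v \<in> A" "v \<in> B" for v
  proof -
    have "v \<in> V" "\<not> v < 7" using v assms unfolding Inv_def by auto
    then show False
      using v assms unfolding Inv_def by (elim vertex_cases) auto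
  qed
  then show ?thesis by blast
qed

lemma Inv_pair:
  assumes "Inv A B" "i < h"
  shows "(7 + 2 * i \<notin> A \<and> 7 + 2 * i \<notin> B \<and> 8 + 2 * i \<notin> A \<and> 8 + 2 * i \<notin> B) \<or>
           (7 + 2 * i \<in> A \<and> 7 + 2 * i \<notin> B \<and> 8 + 2 * i \<notin> A \<and> 8 + 2 * i \<in> B) \<or>
           (7 + 2 * i \<notin> A \<and> 7 + 2 * i \<in> B \<and> 8 + 2 * i \<in> A \<and> 8 + 2 * i \<notin> B)"
  using assms unfolding Inv_def by (elim conjE) (erule allE, erule mp)

lemma Inv_reply_pos:
  assumes I: "Inv A B" and i: "i < h" "7 + 2 * i \<notin> A" "7 + 2 * i \<notin> B"
    and c: "\<And>c. \<lbrakk>1 \<le> c; c \<le> m; \<beta> c = i\<rbrakk> \<Longrightarrow> Cl c \<inter> A \<noteq> {}"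
  shows "Inv (insert (7 + 2 * i) A) (insert (8 + 2 * i) B)"
proof -
  have "8 + 2 * i \<notin> A" "8 + 2 * i \<notin> B" using Inv_pair[OF I i(1)] i by auto
  moreover have "7 + 2 * j \<noteq> 8 + 2 * i" "8 + 2 * j \<noteq> 7 + 2 * i" for j i :: nat by presburger+
  ultimately show ?thesis
    using I i c unfolding Inv_def b_def by (auto simp del: One_nat_def)
qed

lemma Inv_reply_neg:
  assumes I: "Inv A B" and i: "i < h" "8 + 2 * i \<notin> A" "8 + 2 * i \<notin> B"
  shows "Inv (insert (8 + 2 * i) A) (insert (7 + 2 * i) B)"
proof -
  have "7 + 2 * i \<notin> A" "7 + 2 * i \<notin> B" using Inv_pair[OF I i(1)] i by auto
  moreover have "7 + 2 * j \<noteq> 8 + 2 * i" "8 + 2 * j \<noteq> 7 + 2 * i" for j i :: nat by presburger+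
  ultimately show ?thesis
    using I i unfolding Inv_def b_def by (auto simp del: One_nat_def)
qed

lemma blue_edge_cases:
  assumes "e \<in> EL"
  obtains i where "i \<in> Vars" "e = {7 + 2 * i, 8 + 2 * i}" | "e = {7, 8}" | j where "j \<in> {1, 2}" "e = {0, j, 7}"
    | c l i where "1 \<le> c" "c \<le> m" "i \<in> Vars" "l \<in> Cl c" "l = 7 + 2 * i \<or> l = 8 + 2 * i" "e = {b c, d c, l}"
proof -
  consider "\<exists>i\<in>Vars. e = {7 + 2 * i, 8 + 2 * i}" | "e = {7, 8}" | "e = {0, 1, 7}" | "e = {0, 2, 7}"
    | "\<exists>c l. 1 \<le> c \<and> c \<le> m \<and> l \<in> Cl c \<and> e = {b c, d c, l}"
    using assms unfolding EL_def Un_iff mem_Collect_eq insert_iff empty_iff Bex_def by metis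
  then show thesis
  proof cases
    case 5
    then obtain c l where c: "1 \<le> c" "c \<le> m" "l \<in> Cl c" "e = {b c, d c, l}" by auto
    then show thesis using Cl[OF c(1-3)] that(4) unfolding Vars_def by metis
  qed (use that(1-3) in auto)
qed

lemma zero_lt_h: "0 < h" using \<beta>_less[of 0] by simp

text \<open>If Left held all \<open>b c\<close>, the literals in \<open>A\<close> would define a
  satisfying assignment. So there is a first \<open>c\<close> with \<open>b c\<close> outside
  \<open>A\<close>; it is not 0 because 7 is in \<open>A\<close>, and the pair before it has given
  its \<open>d\<close> to Right. Then \<open>b c\<close> completes a red edge, which a move below 7
  does not prevent.\<close>

lemma pending_red_threat:
  assumes I: "Inv A B" and ns: "\<not> sat" and seven: "7 \<in> A" and v: "v < 7"
  shows "\<not> left_wins k False V EL ER (insert v A) B"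
proof -
  have ex: "\<exists>c. c \<le> m \<and> b c \<notin> A"
  proof (rule ccontr)
    assume "\<not> ?thesis"
    then have all: "\<forall>c\<le>m. b c \<in> A" by blast
    define \<tau> where "\<tau> i \<longleftrightarrow> 7 + 2 * i \<in> A" for i
    have "\<exists>i\<in>Vars. lit \<tau> i \<in> Cl c" if c: "1 \<le> c" "c \<le> m" for c
    proof -
      obtain l where l: "l \<in> Cl c" "l \<in> A" using all c I unfolding Inv_def by blast
      then obtain i where i: "i \<in> Vars" "l = 7 + 2 * i \<or> l = 8 + 2 * i"
        using Cl c unfolding Vars_def by blast
      have "lit \<tau> i = l"
        using i l Inv_pair[OF I, of i] unfolding lit_def \<tau>_def Vars_def by auto
      then show ?thesis using i l by blast
    qed
    then show False using ns unfolding sat_def by blast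
  qed
  define c where "c = (LEAST c. c \<le> m \<and> b c \<notin> A)"
  have c: "b c \<notin> A" "c \<le> m"
    using LeastI_ex[OF ex] unfolding c_def by blast+
  have "c \<noteq> 0"
  proof
    assume "c = 0"
    with c seven show False by (simp add: b_def \<beta>_0)
  qed
  then obtain j where j: "c = Suc j" by (cases c) auto
  have "b j \<in> A" using not_less_Least[of j "\<lambda>c. c \<le> m \<and> b c \<notin> A"] j c(2) unfolding c_def by auto
  then have dj: "d j \<in> B"
    using Inv_pair[OF I \<beta>_less[of j]] j c unfolding b_def d_def by auto
  have "j < m" using j c(2) by simp
  then have "{d j, b c} \<in> ER" unfolding ER_def j by blast
  then have *: "filled ER (insert (b c) B)" by (rule filledI) (use dj in simp)
  have bc: "b c \<in> V - insert v A" using \<beta>_less[OF c(2)] v c by (auto simp: b_def)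
  show ?thesis
  proof (cases "b c \<in> B")
    \<comment> \<open>\<open>Inv\<close> does not exclude that a red edge is already filled; in that
      case every move of Right passes the test for a filled edge.\<close>
    case True
    then have "filled ER (insert u B)" for u
      using * unfolding filled_def by (metis insert_absorb subset_insertI2)
    then show ?thesis by (subst left_wins_False_Suc) blast
  next
    case False
    then show ?thesis using * bc by (subst left_wins_False_Suc) (metis DiffI UnE DiffE)
  qed
qed

text \<open>Every blue edge contains a whole pair or two vertices below 7. Of a pair Left can never
  own both vertices, and below 7 Left owns nothing before this move.\<close>

lemma Inv_no_fill:
  assumes I: "Inv A B" and v: "v \<notin> A" "v \<notin> B"
  shows "\<not> filled EL (insert v A)"
proof
  assume "filled EL (insert v A)"
  then obtain e where e: "e \<in> EL" "e \<subseteq> insert v A" unfolding filled_def by blast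
  have low: "x \<notin> A" if "x < 7" for x using I that unfolding Inv_def by auto
  have p: "\<not> {7 + 2 * i, 8 + 2 * i} \<subseteq> insert v A" if "i < h" for i
    using Inv_pair[OF I that] v by auto
  from e(1) show False
  proof (cases rule: blue_edge_cases)
    case (1 i)
    then show ?thesis using p[of i] e(2) unfolding Vars_def by auto
  next
    case 2
    then show ?thesis using p[of 0] e(2) zero_lt_h by auto
  next
    case (3 j)
    then show ?thesis using e(2) low[of 0] low[of j] by auto
  next
    case (4 c l i)
    then show ?thesis using p[OF \<beta>_less[of c]] e(2) unfolding b_def d_def by auto
  qed
qed

text \<open>Such a move creates no threat: every blue edge stays blocked or two vertices short.
  Right therefore has time for the two threats on the red cycle.\<close>

lemma Inv_quiet_move:
  assumes I: "Inv A B" and v: "v \<in> V - (A \<union> B)"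
    and quiet: "v < 7 \<or> (\<exists>c. 1 \<le> c \<and> c \<le> m \<and> v = b c \<and> Cl c \<inter> A = {})"
    and z: "v < 3 \<Longrightarrow> 7 \<notin> A"
  shows "\<not> left_wins k False V EL ER (insert v A) B"
proof -
  have low: "x \<notin> A" "x \<notin> B" if "x < 7" for x using I that unfolding Inv_def by auto
  have p: "{7 + 2 * i, 8 + 2 * i} \<inter> B \<noteq> {} \<or> 7 + 2 * i \<notin> A \<and> 8 + 2 * i \<notin> A" if "i < h" for i
    using Inv_pair[OF I that] by auto
  have nv: "v \<noteq> 7 + 2 * i" "v \<noteq> 8 + 2 * i" if "i \<in> Vars" for i
    using quiet that unfolding Vars_def b_def by auto presburger+
  have "b c \<noteq> 7" "b c \<noteq> 8" if "1 \<le> c" "c \<le> m" for c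
    using inj_onD[OF inj, of c 0] \<beta>_0 that unfolding b_def by simp_all presburger+
  then have v7: "v \<noteq> 7" "v \<noteq> 8"
    using quiet by force+
  have blue: "e \<inter> B \<noteq> {} \<or> (\<exists>u\<in>e. \<exists>w\<in>e. u \<noteq> w \<and> u \<notin> insert v A \<and> w \<notin> insert v A)"
    if "e \<in> EL" for e
    using that
  proof (cases rule: blue_edge_cases)
    case (1 i)
    then show ?thesis using p[of i] nv[of i] unfolding Vars_def by auto
  next
    case 2
    then show ?thesis using p[of 0] v7 zero_lt_h by auto
  next
    case (3 j)
    \<comment> \<open>If \<open>v\<close> is one of 0, 1, 2, then 7 and one of 0 and
      \<open>j\<close> are still missing; otherwise both 0 and \<open>j\<close> are.\<close>
    show ?thesis
    proof (cases "v < 3")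
      case True
      then have "7 \<notin> insert v A" using z v7 by simp
      moreover have "0 \<notin> insert v A \<or> j \<notin> insert v A" using 3(1) low[of 0] low[of j] by auto
      ultimately show ?thesis using 3 by auto
    next
      case False
      then have "0 \<notin> insert v A" "j \<notin> insert v A" "j \<noteq> 0" using 3(1) low[of 0] low[of j] by auto
      then show ?thesis using 3(2) by blast
    qed
  next
    case (4 c l i)
    have bd: "b c \<noteq> l" "d c \<noteq> l" "b c \<noteq> d c"
      using 4(2,3,5) unfolding b_def d_def Vars_def by auto presburger+
    have "v \<noteq> d c" using quiet unfolding d_def b_def by auto presburger+
    show ?thesis
    proof (cases "v = b c")
      case True
      then obtain c' where c': "1 \<le> c'" "c' \<le> m" "b c' = b c" "Cl c' \<inter> A = {}"
        using quiet 4(2) by (auto simp: b_def)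
      then have "c' = c" using inj_onD[OF inj, of c' c] 4(2) by (auto simp: b_def)
      then have "l \<notin> insert v A" using c' 4 True bd by auto
      moreover have "{b c, d c} \<inter> B \<noteq> {} \<or> d c \<notin> A"
        using p[OF \<beta>_less[OF 4(2)]] unfolding b_def d_def by auto
      ultimately show ?thesis using 4(6) bd \<open>v \<noteq> d c\<close> by auto
    next
      case False
      have "{b c, d c} \<inter> B \<noteq> {} \<or> b c \<notin> A \<and> d c \<notin> A"
        using p[OF \<beta>_less[OF 4(2)]] unfolding b_def d_def by auto
      then show ?thesis using 4(6) bd False \<open>v \<noteq> d c\<close> by auto
    qed
  qed
  have dis: "insert v A \<inter> B = {}" using v Inv_disjoint[OF I] by auto
  have free: "x \<in> V - (insert v A \<union> B)" if "x < 7" "x \<noteq> v" for x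
    using low[OF that(1)] that by auto
  have red: "{3, 4} \<in> ER" "{4, 5} \<in> ER" "{5, 6} \<in> ER" "{3, 6} \<in> ER"
    "{4, 3} \<in> ER" "{5, 4} \<in> ER" "{6, 5} \<in> ER" "{6, 3} \<in> ER"
    unfolding ER_def by (auto simp: insert_commute)
  \<comment> \<open>The centre of the double threat and both its neighbours on the cycle must differ
    from \<open>v\<close>.\<close>
  consider "v \<noteq> 3" "v \<noteq> 4" "v \<noteq> 5" | "v = 3" | "v = 4" | "v = 5" by blast
  then show ?thesis
  proof cases
    case 1
    show ?thesis
      by (rule two_red_threats[of _ _ _ 4 _ 3 5]) (use blue dis free red 1 in auto)
  next
    case 2
    show ?thesis
      by (rule two_red_threats[of _ _ _ 5 _ 4 6]) (use blue dis free red 2 in auto)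
  next
    case 3
    show ?thesis
      by (rule two_red_threats[of _ _ _ 6 _ 3 5]) (use blue dis free red 3 in auto)
  next
    case 4
    show ?thesis
      by (rule two_red_threats[of _ _ _ 3 _ 4 6]) (use blue dis free red 4 in auto)
  qed
qed

text \<open>Right answers a vertex below 7 by the pending red threat if 7 has been taken, another
  quiet move by the red cycle, and everything else by the partner vertex, which restores
  \<open>Inv\<close>.\<close>

lemma Inv_not_winning:
  assumes "\<not> sat" "Inv A B"
  shows "\<not> left_wins k True V EL ER A B"
  using assms(2)
proof (induction k arbitrary: A B rule: less_induct)
  case (less k A B)
  note I = less.prems
  have "\<not> left_wins j False V EL ER (insert v A) B"
    if k: "k = Suc j" and v: "v \<in> V - (A \<union> B)" for j v
  proof -
    have reply: ?thesis if "Inv (insert v A) (insert w B)" "w \<in> V - (insert v A \<union> B)" for w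
    proof -
      have "\<not> left_wins i True V EL ER (insert v A) (insert w B)" if "j = Suc i" for i
        using less.IH[OF _ \<open>Inv (insert v A) (insert w B)\<close>, of i] k that by simp
      then show ?thesis using that(2) by (subst left_wins_False_Suc) blast
    qed
    have "v \<in> V" using v by blast
    then show ?thesis
    proof (cases rule: vertex_cases)
      case 1
      show ?thesis
      proof (cases "7 \<in> A")
        case True
        then show ?thesis using pending_red_threat[OF I assms(1) _ 1] by simp
      next
        case False
        then show ?thesis using Inv_quiet_move[OF I v] 1 by simp
      qed
    next
      case (2 i)
      show ?thesis
      proof (cases "\<exists>c. 1 \<le> c \<and> c \<le> m \<and> \<beta> c = i \<and> Cl c \<inter> A = {}")
        case True
        then have "v < 7 \<or> (\<exists>c. 1 \<le> c \<and> c \<le> m \<and> v = b c \<and> Cl c \<inter> A = {})"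
          using 2 unfolding b_def by blast
        then show ?thesis using 2 by (intro Inv_quiet_move[OF I v]) simp_all
      next
        case False
        then have "Inv (insert v A) (insert (8 + 2 * i) B)"
          using Inv_reply_pos[OF I 2(1)] v 2(2) by blast
        moreover have "8 + 2 * i \<in> V - (insert v A \<union> B)"
          using Inv_pair[OF I 2(1)] v 2 by auto
        ultimately show ?thesis using reply by blast
      qed
    next
      case (3 i)
      have "Inv (insert v A) (insert (7 + 2 * i) B)"
        using Inv_reply_neg[OF I 3(1)] v 3(2) by blast
      moreover have "7 + 2 * i \<in> V - (insert v A \<union> B)"
        using Inv_pair[OF I 3(1)] v 3 by auto
      ultimately show ?thesis using reply by blast
    qed
  qed
  moreover have "\<not> filled EL (insert v A)" if "v \<in> V - (A \<union> B)" for v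
    using Inv_no_fill[OF I] that by blast
  ultimately show ?case
    by (subst left_wins_True_Suc) blast
qed

section \<open>Left's strategy under a satisfying assignment\<close>

lemma no_red_fill:
  assumes "\<And>x. x \<in> B \<Longrightarrow> 7 \<le> x" and "\<And>c. c \<le> m \<Longrightarrow> b c \<notin> B"
    and "\<And>c. \<lbrakk>c < m; d c \<in> B\<rbrakk> \<Longrightarrow> b (Suc c) \<in> A" and u: "u \<notin> A"
  shows "\<not> filled ER (insert u B)"
proof
  assume "filled ER (insert u B)"
  then obtain e where e: "e \<in> ER" "e \<subseteq> insert u B" unfolding filled_def by blast
  have "e \<noteq> {x, y}" if "x < 7" "y < 7" "x \<noteq> y" for x y
  proof
    assume "e = {x, y}"
    moreover have "x \<notin> B" "y \<notin> B" using assms(1)[of x] assms(1)[of y] that by linarith+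
    ultimately show False using e(2) that(3) by simp
  qed
  then have "e \<noteq> {3, 4}" "e \<noteq> {4, 5}" "e \<noteq> {5, 6}" "e \<noteq> {3, 6}"
    by simp_all
  then obtain c where c: "c < m" "e = {d c, b (Suc c)}"
    using e(1) unfolding ER_def Un_iff mem_Collect_eq insert_iff empty_iff by metis
  \<comment> \<open>Right holds no \<open>b\<close>, so a chain edge could be completed only at
    \<open>b (Suc c)\<close>; but since \<open>d c\<close> is Right's, that vertex already belongs
    to Left.\<close>
  have "b (Suc c) = u" using e(2) c assms(2)[of "Suc c"] by auto
  moreover have "d c \<noteq> b (Suc c)" unfolding b_def d_def by presburger
  ultimately show False using e(2) c assms(3)[OF c(1)] u by auto
qed

lemma lit_cases:
  obtains "lit \<tau> i = 7 + 2 * i" "lit (\<lambda>i. \<not> \<tau> i) i = 8 + 2 * i"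
  | "lit \<tau> i = 8 + 2 * i" "lit (\<lambda>i. \<not> \<tau> i) i = 7 + 2 * i"
  unfolding lit_def by (cases "\<tau> i") auto

lemma lit_ge: "7 \<le> lit \<tau> i" unfolding lit_def by simp

lemma lit_div: "(lit \<tau> i - 7) div 2 = i" unfolding lit_def by simp

lemma b_div: "(b c - 7) div 2 = \<beta> c" and d_div: "(d c - 7) div 2 = \<beta> c"
  unfolding b_def d_def by simp_all

lemma lit_less: "i \<in> Vars \<Longrightarrow> lit \<tau> i < 7 + 2 * h" unfolding lit_def Vars_def by simp

lemma lit_neq:
  assumes "i \<in> Vars" "c \<le> m"
  shows "lit \<tau> i \<noteq> b c" "lit \<tau> i \<noteq> d c"
proof -
  have "i \<noteq> \<beta> c" using assms unfolding Vars_def by auto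
  then show "lit \<tau> i \<noteq> b c" "lit \<tau> i \<noteq> d c" using lit_div[of \<tau> i] b_div[of c] d_div[of c] by metis+
qed

lemma lit_eq_iff: "lit \<tau> i = lit \<tau> j \<longleftrightarrow> i = j"
  using lit_div by metis

lemma lit_neg_neq: "lit \<tau> i \<noteq> lit (\<lambda>i. \<not> \<tau> i) j"
proof
  assume eq: "lit \<tau> i = lit (\<lambda>i. \<not> \<tau> i) j"
  then have "i = j" using lit_div by metis
  with eq show False unfolding lit_def by (auto split: if_splits)
qed

lemma b_eq_iff: "\<lbrakk>c \<le> m; c' \<le> m\<rbrakk> \<Longrightarrow> b c = b c' \<longleftrightarrow> c = c'"
  using inj_onD[OF inj, of c c'] unfolding b_def by auto

lemma d_eq_iff: "\<lbrakk>c \<le> m; c' \<le> m\<rbrakk> \<Longrightarrow> d c = d c' \<longleftrightarrow> c = c'"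
  using inj_onD[OF inj, of c c'] unfolding d_def by auto

lemma b_neq_d: "b c \<noteq> d c'" unfolding b_def d_def by presburger

lemma b_ge: "7 \<le> b c" and d_ge: "7 \<le> d c" unfolding b_def d_def by auto

lemma bd_less: "c \<le> m \<Longrightarrow> b c < 7 + 2 * h" "c \<le> m \<Longrightarrow> d c < 7 + 2 * h"
  using \<beta>_less[of c] unfolding b_def d_def by auto

text \<open>The fuel counts the seven vertices below 7 and the \<open>j\<close> pairs that remain to
  be opened. Opening pair \<open>c\<close> answers the red threat from pair \<open>c - 1\<close> and
  is itself a threat.\<close>

lemma Left_wins_clause_phase:
  assumes \<tau>: "\<And>c. \<lbrakk>1 \<le> c; c \<le> m\<rbrakk> \<Longrightarrow> \<exists>i\<in>Vars. lit \<tau> i \<in> Cl c"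
  shows "c + j = Suc m \<Longrightarrow> left_wins (7 + 2 * j) True V EL ER
    (lit \<tau> ` Vars \<union> b ` {..<c}) (lit (\<lambda>i. \<not> \<tau> i) ` Vars \<union> d ` {..<c})"
proof (induction j arbitrary: c)
  case 0
  define A where "A = lit \<tau> ` Vars \<union> b ` {..<c}"
  define B where "B = lit (\<lambda>i. \<not> \<tau> i) ` Vars \<union> d ` {..<c}"
  have ge: "7 \<le> x" if "x \<in> A \<union> B" for x
    using that lit_ge b_ge d_ge unfolding A_def B_def by auto
  have A7: "7 \<in> A" using 0 \<beta>_0 unfolding A_def b_def by (intro UnI2 image_eqI[of _ _ 0]) auto
  have free: "x \<in> V - (A \<union> B)" if "x < 7" for x using ge[of x] that by force
  have EL: "{0, 1, 7} \<in> EL" "{0, 2, 7} \<in> EL" unfolding EL_def by simp_all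
  have red: "\<not> filled ER (insert u B)" if "u \<notin> insert 0 A" for u
  proof (rule no_red_fill)
    show "b (Suc c') \<in> insert 0 A" if "c' < m" "d c' \<in> B" for c'
      using 0 that unfolding A_def by auto
    show "b c' \<notin> B" if "c' \<le> m" for c'
      using lit_neq[of _ c'] b_neq_d[of c'] that unfolding B_def by force
  qed (use ge that in auto)
  have "left_wins (Suc 5) False V EL ER (insert 0 A) B"
  proof -
    have "left_wins (Suc 4) True V EL ER (insert 0 A) (insert u B)" if u: "u \<in> V - (insert 0 A \<union> B)" for u
    proof -
      \<comment> \<open>Right can block only one of \<open>{0, 1, 7}\<close> and
        \<open>{0, 2, 7}\<close>; \<open>w\<close> is the vertex left over.\<close>
      define w where "w = (if u = 1 then 2 else 1 :: nat)"
      have w: "{0, w, 7} \<in> EL" "w \<noteq> u" "w < 7" "w \<noteq> 0" unfolding w_def using EL by auto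
      have "filled EL (insert w (insert 0 A))" by (rule filledI[OF w(1)]) (use A7 in auto)
      moreover have "w \<in> V - (insert 0 A \<union> insert u B)" using free[OF w(3)] w by auto
      ultimately show ?thesis by (intro left_wins_TrueI disjI1)
    qed
    note reply = this
    show ?thesis
    proof (rule left_wins_FalseI)
      show "1 \<in> V - (insert 0 A \<union> B)" using free[of 1] by simp
      show "\<not> filled ER (insert u B)" if "u \<in> V - (insert 0 A \<union> B)" for u
        using red[of u] that by simp
      show "left_wins 5 True V EL ER (insert 0 A) (insert u B)" if "u \<in> V - (insert 0 A \<union> B)" for u
        using reply[OF that] by simp
    qed
  qed
  moreover have "0 \<in> V - (A \<union> B)" using free[of 0] by simp
  ultimately have "left_wins (Suc (Suc 5)) True V EL ER A B"
    by (intro left_wins_TrueI disjI2)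
  then show ?case unfolding A_def B_def by simp
next
  case (Suc j)
  define A where "A = lit \<tau> ` Vars \<union> b ` {..<c}"
  define B where "B = lit (\<lambda>i. \<not> \<tau> i) ` Vars \<union> d ` {..<c}"
  have c: "c \<le> m" using Suc.prems by simp
  have AB: "insert (b c) A = lit \<tau> ` Vars \<union> b ` {..<Suc c}"
    "insert (d c) B = lit (\<lambda>i. \<not> \<tau> i) ` Vars \<union> d ` {..<Suc c}"
    unfolding A_def B_def by (simp_all add: lessThan_Suc)
  have bB: "b c' \<notin> B" if "c' \<le> m" for c'
    using lit_neq[of _ c'] b_neq_d[of c'] that unfolding B_def by force
  have dA: "d c' \<notin> A" if "c' \<le> m" for c'
    using lit_neq[of _ c'] b_neq_d[of _ c'] that unfolding A_def by force
  have bA: "b c \<notin> A"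
  proof -
    have "b c \<notin> lit \<tau> ` Vars" using lit_neq(1)[OF _ c] by force
    moreover have "b c \<noteq> b c'" if "c' < c" for c' using b_eq_iff[of c c'] c that by simp
    ultimately show ?thesis unfolding A_def by auto
  qed
  have dB: "d c \<notin> B"
  proof -
    have "d c \<notin> lit (\<lambda>i. \<not> \<tau> i) ` Vars" using lit_neq(2)[OF _ c] by force
    moreover have "d c \<noteq> d c'" if "c' < c" for c' using d_eq_iff[of c c'] c that by simp
    ultimately show ?thesis unfolding B_def by auto
  qed
  have ge: "7 \<le> x" if "x \<in> B" for x
    using that lit_ge d_ge unfolding B_def by auto
  have "\<exists>e\<in>EL. e \<subseteq> insert (d c) (insert (b c) A)"
  proof (cases "c = 0")
    case True
    then have "{7, 8} = {b c, d c}" by (simp add: b_def d_def \<beta>_0)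
    moreover have "{7, 8} \<in> EL" unfolding EL_def by simp
    ultimately show ?thesis by (intro bexI[of _ "{7, 8}"]) simp_all
  next
    case False
    then obtain i where i: "i \<in> Vars" "lit \<tau> i \<in> Cl c" using \<tau>[of c] c by auto
    have "{b c, d c, lit \<tau> i} \<in> EL"
      unfolding EL_def using i False c by (intro UnI2 CollectI exI conjI) auto
    moreover have "lit \<tau> i \<in> A" using i unfolding A_def by blast
    ultimately show ?thesis by (intro bexI[of _ "{b c, d c, lit \<tau> i}"]) simp_all
  qed
  then obtain e where e: "e \<in> EL" "e \<subseteq> insert (d c) (insert (b c) A)" by blast
  have "left_wins (Suc (Suc (7 + 2 * j))) True V EL ER A B"
  proof (rule forcing_move[OF _ _ _ e])
    show "b c \<in> V - (A \<union> B)" using bd_less[OF c] bA bB[OF c] by simp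
    show "d c \<in> V - (A \<union> B)" using bd_less[OF c] dB dA[OF c] by simp
    show "b c \<noteq> d c" by (rule b_neq_d)
    show "left_wins (7 + 2 * j) True V EL ER (insert (b c) A) (insert (d c) B)"
      unfolding AB using Suc by simp
    show "\<not> filled ER (insert u B)" if u: "u \<in> V - (insert (b c) A \<union> B)" for u
    proof (rule no_red_fill[of B "insert (b c) A", OF ge bB])
      \<comment> \<open>\<open>d c'\<close> belongs to Right only for \<open>c' < c\<close>, and
        then \<open>b (Suc c')\<close> was opened earlier or is the vertex \<open>b c\<close> opened
        just now.\<close>
      show "b (Suc c') \<in> insert (b c) A" if "c' < m" "d c' \<in> B" for c'
      proof -
        have "d c' \<notin> lit (\<lambda>i. \<not> \<tau> i) ` Vars" using lit_neq(2)[OF _ less_imp_le[OF that(1)]] by force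
        then have "d c' \<in> d ` {..<c}" using that(2) unfolding B_def by blast
        then obtain c'' where "c'' < c" "d c' = d c''" by auto
        then have "c' < c" using d_eq_iff[of c' c''] that c by simp
        then show ?thesis unfolding A_def by (cases "Suc c' = c") auto
      qed
    qed (use u in auto)
  qed
  then show ?case unfolding A_def B_def by simp
qed

text \<open>Left sets the variables in increasing order. The fuel is made up of the seven low
  vertices, the \<open>Suc m\<close> clause pairs and the variable pairs not yet set.\<close>

lemma Left_wins_variable_phase:
  assumes \<tau>: "\<And>c. \<lbrakk>1 \<le> c; c \<le> m\<rbrakk> \<Longrightarrow> \<exists>i\<in>Vars. lit \<tau> i \<in> Cl c"
  shows "i + j = h \<Longrightarrow> left_wins (7 + 2 * Suc m + 2 * card (Vars \<inter> {i..<h})) True V EL ER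
    (lit \<tau> ` (Vars \<inter> {..<i})) (lit (\<lambda>i. \<not> \<tau> i) ` (Vars \<inter> {..<i}))"
proof (induction j arbitrary: i)
  case 0
  then have "Vars \<inter> {..<i} = Vars" unfolding Vars_def by auto
  then show ?case using Left_wins_clause_phase[OF \<tau>, of 0 "Suc m"] 0 by simp
next
  case (Suc j)
  show ?case
  proof (cases "i \<in> Vars")
    case False
    then have "Vars \<inter> {..<Suc i} = Vars \<inter> {..<i}" "Vars \<inter> {Suc i..<h} = Vars \<inter> {i..<h}"
      by (auto simp: less_Suc_eq Suc_le_eq le_less)
    then show ?thesis using Suc.IH[of "Suc i"] Suc.prems by simp
  next
    case True
    define A where "A = lit \<tau> ` (Vars \<inter> {..<i})"
    define B where "B = lit (\<lambda>i. \<not> \<tau> i) ` (Vars \<inter> {..<i})"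
    have eq: "Vars \<inter> {..<Suc i} = insert i (Vars \<inter> {..<i})" "Vars \<inter> {i..<h} = insert i (Vars \<inter> {Suc i..<h})"
      using True Suc.prems by (auto simp: less_Suc_eq Suc_le_eq le_less)
    have card: "card (Vars \<inter> {i..<h}) = Suc (card (Vars \<inter> {Suc i..<h}))"
      unfolding eq by (subst card_insert_disjoint) auto
    let ?k = "7 + 2 * Suc m + 2 * card (Vars \<inter> {Suc i..<h})"
    have fresh: "lit \<tau> i \<notin> A" "lit \<tau> i \<notin> B" "lit (\<lambda>i. \<not> \<tau> i) i \<notin> A" "lit (\<lambda>i. \<not> \<tau> i) i \<notin> B"
      using lit_eq_iff lit_neg_neq[of \<tau>] unfolding A_def B_def by (auto simp: eq_commute)
    have "left_wins (Suc (Suc ?k)) True V EL ER A B"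
    proof (rule forcing_move)
      show "lit \<tau> i \<in> V - (A \<union> B)" "lit (\<lambda>i. \<not> \<tau> i) i \<in> V - (A \<union> B)"
        using lit_less[OF True] fresh by auto
      show "lit \<tau> i \<noteq> lit (\<lambda>i. \<not> \<tau> i) i" by (rule lit_neg_neq)
      show "{7 + 2 * i, 8 + 2 * i} \<in> EL" unfolding EL_def using True by blast
      show "{7 + 2 * i, 8 + 2 * i} \<subseteq> insert (lit (\<lambda>i. \<not> \<tau> i) i) (insert (lit \<tau> i) A)"
        by (rule lit_cases[of \<tau> i]) auto
      show "left_wins ?k True V EL ER (insert (lit \<tau> i) A) (insert (lit (\<lambda>i. \<not> \<tau> i) i) B)"
        using Suc.IH[of "Suc i"] Suc.prems unfolding eq A_def B_def by simp
      show "\<not> filled ER (insert u B)" if u: "u \<in> V - (insert (lit \<tau> i) A \<union> B)" for u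
      proof (rule no_red_fill[of _ "insert (lit \<tau> i) A"])
        show "b c \<notin> B" if "c \<le> m" for c using lit_neq[of _ c] that unfolding B_def by force
        show "b (Suc c) \<in> insert (lit \<tau> i) A" if "c < m" "d c \<in> B" for c
          using lit_neq[of _ c] that unfolding B_def by force
      qed (use u lit_ge in \<open>auto simp: B_def\<close>)
    qed
    then show ?thesis unfolding card A_def B_def by simp
  qed
qed

theorem left_wins_first_iff_sat: "left_wins_first (7 + 2 * h) EL ER \<longleftrightarrow> sat"
proof
  assume "left_wins_first (7 + 2 * h) EL ER"
  moreover have "Inv {} {}" unfolding Inv_def by simp
  ultimately show sat using Inv_not_winning unfolding left_wins_first_def by blast
next
  assume sat
  then obtain \<tau> where \<tau>: "\<And>c. \<lbrakk>1 \<le> c; c \<le> m\<rbrakk> \<Longrightarrow> \<exists>i\<in>Vars. lit \<tau> i \<in> Cl c"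
    unfolding sat_def by blast
  \<comment> \<open>Clause pairs and variable pairs partition all \<open>h\<close> pairs, so the
    fuel of the variable phase is the number of vertices of the game.\<close>
  have "\<beta> ` {..m} \<subseteq> {..<h}" using \<beta>_less by auto
  then have "card Vars = h - Suc m" "Suc m \<le> h"
    unfolding Vars_def using card_image[OF inj] card_mono[of "{..<h}" "\<beta> ` {..m}"]
    by (auto simp: card_Diff_subset)
  moreover have "Vars \<inter> {0..<h} = Vars" unfolding Vars_def by auto
  ultimately have *: "7 + 2 * Suc m + 2 * card (Vars \<inter> {0..<h}) = 7 + 2 * h" by simp
  then show "left_wins_first (7 + 2 * h) EL ER"
    using Left_wins_variable_phase[OF \<tau>, of 0 h] unfolding left_wins_first_def * by simp
qed

end

subsection \<open>Turing machines over arbitrary finite alphabets\<close>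

type_synonym ('q, 'a) conf = "'q \<times> (int \<Rightarrow> 'a) \<times> int"

definition astep :: "('q \<Rightarrow> 'a \<Rightarrow> 'q \<times> 'a \<times> int) \<Rightarrow> 'q \<Rightarrow> ('q, 'a) conf \<Rightarrow> ('q, 'a) conf" where
  "astep \<delta> acc c = (case c of (q, tp, h) \<Rightarrow> if q = acc then c
     else (case \<delta> q (tp h) of (q', a', d) \<Rightarrow> (q', tp(h := a'), h + d)))"

lemma number_finite_set:
  assumes "finite S"
  obtains e :: "'a \<Rightarrow> nat" where "inj_on e S" "\<And>s. s \<in> S \<Longrightarrow> e s < card S"
proof -
  obtain e where "bij_betw e S {0..<card S}"
    using ex_bij_betw_finite_nat[OF assms] by blast
  then have "inj_on e S" "\<And>s. s \<in> S \<Longrightarrow> e s < card S"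
    by (auto simp: bij_betw_def)
  then show thesis by (rule that)
qed

text \<open>States and symbols are numbered so that \<open>ini\<close>, \<open>acc\<close> and the
  three tape symbols of the input get the prescribed codes. No state receives code 2, hence the
  numbered machine halts exactly when the abstract one reaches \<open>acc\<close>.\<close>

lemma tm_of_abstract_machine:
  fixes \<delta> :: "'q \<Rightarrow> 'a \<Rightarrow> 'q \<times> 'a \<times> int"
  assumes fin: "finite St" "finite Sy" and ini: "ini \<in> St" and acc: "acc \<in> St" "ini \<noteq> acc"
    and sym: "s0 \<in> Sy" "s1 \<in> Sy" "s2 \<in> Sy" "s0 \<noteq> s1" "s0 \<noteq> s2" "s1 \<noteq> s2"
    and cl: "\<forall>q\<in>St - {acc}. \<forall>a\<in>Sy. case \<delta> q a of (q', a', d) \<Rightarrow> q' \<in> St \<and> a' \<in> Sy \<and> d \<in> {-1, 0, 1}"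
  obtains M g where "wf_tm M" "g s0 = 0" "g s1 = 1" "g s2 = 2"
    "\<And>x t tp h. (astep \<delta> acc ^^ t)
        (ini, \<lambda>i. if 0 \<le> i \<and> i < int (length x) then (if x ! nat i then s2 else s1) else s0, 0) = (acc, tp, h)
      \<Longrightarrow> tm_run M t x = (1, \<lambda>i. g (tp i), h)"
proof -
  obtain e1 :: "'q \<Rightarrow> nat" where e1: "inj_on e1 St" "\<And>s. s \<in> St \<Longrightarrow> e1 s < card St"
    using number_finite_set[OF fin(1)] by blast
  obtain e2 :: "'a \<Rightarrow> nat" where e2: "inj_on e2 Sy" "\<And>s. s \<in> Sy \<Longrightarrow> e2 s < card Sy"
    using number_finite_set[OF fin(2)] by blast
  have closed: "q' \<in> St \<and> a' \<in> Sy \<and> d \<in> {-1, 0, 1}"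
    if "q \<in> St" "q \<noteq> acc" "a \<in> Sy" "\<delta> q a = (q', a', d)" for q a q' a' d
    using bspec[OF bspec[OF cl, of q], of a] that by simp
  define f where "f q = (if q = ini then 0 else if q = acc then 1 else 3 + e1 q)" for q
  define g where "g a = (if a = s0 then 0 else if a = s1 then 1 else if a = s2 then 2 else 3 + e2 a)" for a
  have injf: "inj_on f St" using e1(1) acc(2) by (auto simp: f_def inj_on_def)
  have injg: "inj_on g Sy" using e2(1) sym by (auto simp: g_def inj_on_def)
  have f_less: "f q < card St + 3" if "q \<in> St" for q using e1(2)[OF that] by (auto simp: f_def)
  have g_less: "g a < card Sy + 3" if "a \<in> Sy" for a using e2(2)[OF that] by (auto simp: g_def)
  have g012: "g s0 = 0" "g s1 = 1" "g s2 = 2" using sym by (auto simp: g_def)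
  have f1: "f q = 1 \<longleftrightarrow> q = acc" "f q \<noteq> 2" for q using acc(2) by (auto simp: f_def)
  \<comment> \<open>Numbers that code nothing get the default \<open>(0, 0, 0)\<close>, since
    well-formedness is required of all pairs below the two bounds.\<close>
  define D where "D q a = (if q \<in> f ` (St - {acc}) \<and> a \<in> g ` Sy
      then (case \<delta> (inv_into St f q) (inv_into Sy g a) of (q', a', d) \<Rightarrow> (f q', g a', d)) else (0, 0, 0))" for q a
  define M where "M = (card St + 3, card Sy + 3, D)"
  have D_eq: "D (f q) (g a) = (case \<delta> q a of (q', a', d) \<Rightarrow> (f q', g a', d))"
    if "q \<in> St" "q \<noteq> acc" "a \<in> Sy" for q a
    using that injf injg unfolding D_def by auto
  have "case D q a of (q', a', d) \<Rightarrow> q' < card St + 3 \<and> a' < card Sy + 3 \<and> d \<in> {-1, 0, 1}" for q a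
  proof (cases "q \<in> f ` (St - {acc}) \<and> a \<in> g ` Sy")
    case True
    then obtain q0 a0 where *: "q0 \<in> St" "q0 \<noteq> acc" "q = f q0" "a0 \<in> Sy" "a = g a0" by auto
    obtain q' a' d where "\<delta> q0 a0 = (q', a', d)" by (cases "\<delta> q0 a0") auto
    with closed[OF *(1,2,4) this] show ?thesis using D_eq[OF *(1,2,4)] * f_less g_less by auto
  next
    case False
    then show ?thesis unfolding D_def by auto
  qed
  then have wf: "wf_tm M" unfolding wf_tm_def M_def by auto
  \<comment> \<open>Membership in \<open>St\<close> and \<open>Sy\<close> is carried along because
    the codings are known to be injective only there.\<close>
  have sim: "fst ((astep \<delta> acc ^^ t) c) \<in> St \<and> (\<forall>i. fst (snd ((astep \<delta> acc ^^ t) c)) i \<in> Sy) \<and>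
      (tm_step M ^^ t) (f (fst c), \<lambda>i. g (fst (snd c) i), snd (snd c))
      = (case (astep \<delta> acc ^^ t) c of (q, tp, h) \<Rightarrow> (f q, \<lambda>i. g (tp i), h))"
    if c: "fst c \<in> St" "\<forall>i. fst (snd c) i \<in> Sy" for c t
  proof (induction t)
    case 0
    then show ?case using c by (auto split: prod.split)
  next
    case (Suc t)
    obtain q tp h where qth: "(astep \<delta> acc ^^ t) c = (q, tp, h)" by (cases "(astep \<delta> acc ^^ t) c") auto
    have I: "q \<in> St" "\<And>i. tp i \<in> Sy"
      "(tm_step M ^^ t) (f (fst c), \<lambda>i. g (fst (snd c) i), snd (snd c)) = (f q, \<lambda>i. g (tp i), h)"
      using Suc qth by (auto simp: comp_def)
    show ?case
    proof (cases "q = acc")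
      case True
      then have "astep \<delta> acc (q, tp, h) = (q, tp, h)" "tm_step M (f q, \<lambda>i. g (tp i), h) = (f q, \<lambda>i. g (tp i), h)"
        using f1[of q] by (simp_all add: astep_def tm_step_def M_def)
      then show ?thesis using I qth by simp
    next
      case False
      obtain q' a' d where e: "\<delta> q (tp h) = (q', a', d)" by (cases "\<delta> q (tp h)") auto
      have cl: "q' \<in> St" "a' \<in> Sy" using closed[OF I(1) False I(2) e] by auto
      have "D (f q) (g (tp h)) = (f q', g a', d)" using D_eq[OF I(1) False I(2)] e by simp
      then have "tm_step M (f q, \<lambda>i. g (tp i), h) = (f q', \<lambda>i. g ((tp(h := a')) i), h + d)"
        using f1[of q] False by (simp add: tm_step_def M_def fun_eq_iff)
      moreover have "astep \<delta> acc (q, tp, h) = (q', tp(h := a'), h + d)"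
        using False e by (simp add: astep_def)
      ultimately show ?thesis using I qth cl by simp
    qed
  qed
  show thesis
  proof (rule that[OF wf g012])
    fix x :: "bool list" and t tp h
    let ?tp = "\<lambda>i. if 0 \<le> i \<and> i < int (length x) then (if x ! nat i then s2 else s1) else s0"
    assume *: "(astep \<delta> acc ^^ t) (ini, ?tp, 0) = (acc, tp, h)"
    have "init_config x = (f ini, \<lambda>i. g (?tp i), 0)"
      using g012 unfolding init_config_def bit_sym_def f_def by (auto simp: fun_eq_iff)
    then show "tm_run M t x = (1, \<lambda>i. g (tp i), h)"
      using sim[of "(ini, ?tp, 0)" t] * ini sym f1(1)[of acc] unfolding tm_run_def by simp
  qed
qed

subsection \<open>Register programs\<close>

datatype test = NEq nat | NonBlank | IsTrue

datatype cmd = Inc nat | Out bool | Clr nat | Seq cmd cmd | If nat test cmd cmd | While nat test cmd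

type_synonym rstate = "(nat \<Rightarrow> nat) \<times> bool list"

definition insym :: "bool list \<Rightarrow> nat \<Rightarrow> nat" where
  "insym x i = (if i < length x then bit_sym (x ! i) else 0)"

fun holds :: "bool list \<Rightarrow> (nat \<Rightarrow> nat) \<Rightarrow> nat \<Rightarrow> test \<Rightarrow> bool" where
  "holds x f r (NEq r') \<longleftrightarrow> f r \<noteq> f r'"
| "holds x f r NonBlank \<longleftrightarrow> insym x (f r) \<noteq> 0"
| "holds x f r IsTrue \<longleftrightarrow> insym x (f r) = 2"

text \<open>Register 1 always holds the length of the output, and register 0 is never changed.\<close>

fun rstep :: "bool list \<Rightarrow> cmd list \<times> rstate \<Rightarrow> cmd list \<times> rstate" where
  "rstep x ([], f, w) = ([], f, w)"
| "rstep x (Inc r # K, f, w) = (K, f(r := Suc (f r)), w)"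
| "rstep x (Out b # K, f, w) = (K, f(1 := Suc (f 1)), w @ [b])"
| "rstep x (Clr r # K, f, w) = (K, f(r := 0), w)"
| "rstep x (Seq c d # K, f, w) = (c # d # K, f, w)"
| "rstep x (If r t c d # K, f, w) = ((if holds x f r t then c else d) # K, f, w)"
| "rstep x (While r t c # K, f, w) = (if holds x f r t then c # While r t c # K else K, f, w)"

fun test_ok :: "nat \<Rightarrow> test \<Rightarrow> bool" where
  "test_ok R (NEq r) \<longleftrightarrow> r < R"
| "test_ok R _ \<longleftrightarrow> True"

fun cmd_ok :: "nat \<Rightarrow> cmd \<Rightarrow> bool" where
  "cmd_ok R (Inc r) \<longleftrightarrow> 2 \<le> r \<and> r < R"
| "cmd_ok R (Out b) \<longleftrightarrow> True"
| "cmd_ok R (Clr r) \<longleftrightarrow> 2 \<le> r \<and> r < R"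
| "cmd_ok R (Seq c d) \<longleftrightarrow> cmd_ok R c \<and> cmd_ok R d"
| "cmd_ok R (If r t c d) \<longleftrightarrow> r < R \<and> test_ok R t \<and> cmd_ok R c \<and> cmd_ok R d"
| "cmd_ok R (While r t c) \<longleftrightarrow> r < R \<and> test_ok R t \<and> cmd_ok R c"

text \<open>A cell of the simulating machine stores its input symbol, its output symbol and the set of registers
  whose value is the position of the cell.\<close>

type_synonym cell = "nat \<times> nat \<times> nat set"

fun cell_holds :: "cell \<Rightarrow> test \<Rightarrow> bool" where
  "cell_holds (i, u, m) (NEq r) \<longleftrightarrow> r \<notin> m"
| "cell_holds (i, u, m) NonBlank \<longleftrightarrow> i \<noteq> 0"
| "cell_holds (i, u, m) IsTrue \<longleftrightarrow> i = 2"

text \<open>In \<open>Run K p\<close>, \<open>K\<close> is the stack of commands still to be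
  executed and \<open>p\<close> is the phase of the sweep that executes its head.\<close>

datatype st = Ini | Acc | Run "cmd list" nat

text \<open>In phase 0 the head searches to the right for the register concerned; later phases
  move it back to the mark of register 0.\<close>

fun back_step :: "st \<Rightarrow> st \<Rightarrow> cell \<Rightarrow> st \<times> cell \<times> int" where
  "back_step q q' (i, u, m) = (if 0 \<in> m then (q', (i, u, m), 0) else (q, (i, u, m), -1))"

text \<open>The start state puts the marks of all registers on cell 0. Once the stack is empty, each
  cell is replaced by its output symbol in the input component, because \<open>(0, 0, {})\<close>,
  \<open>(1, 0, {})\<close> and \<open>(2, 0, {})\<close> are the cells coded as blank and bits; the
  mark of register 1 tells where the output ends.\<close>

fun delta :: "nat \<Rightarrow> cmd \<Rightarrow> st \<Rightarrow> cell \<Rightarrow> st \<times> cell \<times> int" where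
  "delta R P Ini (i, u, m) = (Run [P] 0, (i, u, {..<R}), 0)"
| "delta R P Acc (i, u, m) = (Acc, (i, u, m), 0)"
| "delta R P (Run [] p) (i, u, m) =
     (if 1 \<in> m then (Acc, (0, 0, {}), 0) else (Run [] p, (u, 0, {}), 1))"
| "delta R P (Run (Inc r # K) p) (i, u, m) =
     (if p = 0 then if r \<in> m then (Run (Inc r # K) 1, (i, u, m - {r}), 1) else (Run (Inc r # K) p, (i, u, m), 1)
      else if p = 1 then (Run (Inc r # K) 2, (i, u, insert r m), 0)
      else back_step (Run (Inc r # K) p) (Run K 0) (i, u, m))"
| "delta R P (Run (Out b # K) p) (i, u, m) =
     (if p = 0 then if 1 \<in> m then (Run (Out b # K) 1, (i, bit_sym b, m - {1}), 1) else (Run (Out b # K) p, (i, u, m), 1)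
      else if p = 1 then (Run (Out b # K) 2, (i, u, insert 1 m), 0)
      else back_step (Run (Out b # K) p) (Run K 0) (i, u, m))"
| "delta R P (Run (Clr r # K) p) (i, u, m) =
     (if p = 0 then if r \<in> m then (Run (Clr r # K) 1, (i, u, m - {r}), 0) else (Run (Clr r # K) p, (i, u, m), 1)
      else if 0 \<in> m then (Run K 0, (i, u, insert r m), 0) else (Run (Clr r # K) p, (i, u, m), -1))"
| "delta R P (Run (Seq c d # K) p) s = (Run (c # d # K) 0, s, 0)"
| "delta R P (Run (If r t c d # K) p) (i, u, m) =
     (if p = 0 then if r \<in> m then (Run (If r t c d # K) (if cell_holds (i, u, m) t then 1 else 2), (i, u, m), 0)
        else (Run (If r t c d # K) p, (i, u, m), 1)
      else back_step (Run (If r t c d # K) p) (Run ((if p = 1 then c else d) # K) 0) (i, u, m))"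
| "delta R P (Run (While r t c # K) p) (i, u, m) =
     (if p = 0 then if r \<in> m then (Run (While r t c # K) (if cell_holds (i, u, m) t then 1 else 2), (i, u, m), 0)
        else (Run (While r t c # K) p, (i, u, m), 1)
      else back_step (Run (While r t c # K) p) (Run (if p = 1 then c # While r t c # K else K) 0) (i, u, m))"

definition outsym :: "bool list \<Rightarrow> nat \<Rightarrow> nat" where
  "outsym w i = (if i < length w then bit_sym (w ! i) else 0)"

text \<open>The set \<open>D\<close> lists the registers whose mark is present.\<close>

definition tape_of :: "bool list \<Rightarrow> nat set \<Rightarrow> (nat \<Rightarrow> nat) \<Rightarrow> bool list \<Rightarrow> int \<Rightarrow> cell" where
  "tape_of x D f w i = (if i < 0 then (0, 0, {})
     else (insym x (nat i), outsym w (nat i), {r \<in> D. f r = nat i}))"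

lemma tape_of_int: "tape_of x D f w (int p) = (insym x p, outsym w p, {r \<in> D. f r = p})"
  unfolding tape_of_def by simp

lemma tape_remove:
  "(tape_of x D f w)(int (f r) := (insym x (f r), outsym w (f r), {r' \<in> D. f r' = f r} - {r}))
    = tape_of x (D - {r}) f w"
  unfolding tape_of_def by (auto simp: fun_eq_iff)

lemma tape_insert:
  "r \<in> D \<Longrightarrow> (tape_of x (D - {r}) f w)(int p := (insym x p, outsym w p, insert r {r' \<in> D - {r}. f r' = p}))
    = tape_of x D (f(r := p)) w"
  unfolding tape_of_def by (auto simp: fun_eq_iff)

lemma tape_out:
  "f 1 = length w \<Longrightarrow> (tape_of x D f w)(int (f 1) := (insym x (f 1), bit_sym b, {r' \<in> D. f r' = f 1} - {1}))
    = tape_of x (D - {1}) f (w @ [b])"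
  unfolding tape_of_def outsym_def by (auto simp: fun_eq_iff nth_append)

section \<open>The cost of program steps on the simulating machine\<close>

context
  fixes R :: nat and P :: cmd and x :: "bool list"
begin

abbreviation reach :: "nat \<Rightarrow> (st, cell) conf \<Rightarrow> (st, cell) conf \<Rightarrow> bool" where
  "reach t c c' \<equiv> (astep (delta R P) Acc ^^ t) c = c'"

lemma reach_add: "\<lbrakk>reach s c c'; reach t c' c''\<rbrakk> \<Longrightarrow> reach (s + t) c c''"
  by (subst add.commute) (simp add: funpow_add)

lemma reach_1:
  "\<lbrakk>q \<noteq> Acc; delta R P q (tp h) = (q', a', d); tp' = tp(h := a'); h' = h + d\<rbrakk>
    \<Longrightarrow> reach 1 (q, tp, h) (q', tp', h')"
  by (simp add: astep_def)

lemma reach_sweep: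
  assumes "q \<noteq> Acc" and "\<And>j. j < n \<Longrightarrow> delta R P q (tp (h + d * int j)) = (q, tp (h + d * int j), d)"
  shows "reach n (q, tp, h) (q, tp, h + d * int n)"
  using assms(2)
proof (induction n)
  case (Suc n)
  then have "reach n (q, tp, h) (q, tp, h + d * int n)" by simp
  moreover have "reach 1 (q, tp, h + d * int n) (q, tp, h + d * int (Suc n))"
    by (rule reach_1[OF assms(1), where a' = "tp (h + d * int n)" and d = d])
      (use Suc.prems[of n] in \<open>auto simp: algebra_simps\<close>)
  ultimately show ?case using reach_add by fastforce
qed simp

lemma reach_seek:
  assumes "q \<noteq> Acc" "r \<in> D" and "\<And>i u m. r \<notin> m \<Longrightarrow> delta R P q (i, u, m) = (q, (i, u, m), 1)"
  shows "reach (f r) (q, tape_of x D f w, 0) (q, tape_of x D f w, int (f r))"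
  using reach_sweep[OF assms(1), of "f r" "tape_of x D f w" 0 1] assms(2,3)
  by (simp add: tape_of_int)

lemma reach_back:
  assumes "q \<noteq> Acc" "f 0 = 0" and "\<And>i u m. 0 \<notin> m \<Longrightarrow> delta R P q (i, u, m) = (q, (i, u, m), -1)"
  shows "reach p (q, tape_of x D f w, int p) (q, tape_of x D f w, 0)"
proof -
  have "delta R P q (tape_of x D f w (int p + -1 * int j)) = (q, tape_of x D f w (int p + -1 * int j), -1)"
    if "j < p" for j
  proof -
    have "int p + -1 * int j = int (p - j)" using that by simp
    then show ?thesis using assms(2,3) that by (simp add: tape_of_int del: of_nat_diff)
  qed
  from reach_sweep[OF assms(1), of p "tape_of x D f w" "int p" "-1", OF this] show ?thesis by simp
qed

text \<open>\<open>Out b\<close> is an increment of register 1 that also writes a symbol, so both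
  commands are treated together. The mark is lifted, set down one cell further to the right, and the
  head returns.\<close>

lemma reach_inc_like:
  assumes c: "c = Inc r \<and> r \<noteq> 0 \<and> w' = w \<or> (\<exists>b. c = Out b \<and> r = 1 \<and> w' = w @ [b])"
    and inv: "f 0 = 0" "f 1 = length w" and r: "r < R" and R: "0 < R"
  shows "reach (2 * f r + 4) (Run (c # K) 0, tape_of x {..<R} f w, 0)
    (Run K 0, tape_of x {..<R} (f(r := Suc (f r))) w', 0)"
proof -
  let ?p = "f r" and ?D = "{..<R}" and ?g = "f(r := Suc (f r))"
  have r0: "r \<noteq> 0" using c by auto
  have "reach ?p (Run (c # K) 0, tape_of x ?D f w, 0) (Run (c # K) 0, tape_of x ?D f w, int ?p)"
    by (rule reach_seek) (use c r in auto)
  moreover have "reach 1 (Run (c # K) 0, tape_of x ?D f w, int ?p)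
      (Run (c # K) 1, tape_of x (?D - {r}) f w', int (Suc ?p))"
    using c
  proof
    assume "c = Inc r \<and> r \<noteq> 0 \<and> w' = w"
    then show ?thesis
      by (intro reach_1[where a' = "(insym x ?p, outsym w ?p, {r' \<in> ?D. f r' = ?p} - {r})" and d = 1])
        (use r tape_remove[of x ?D f w r, symmetric] in \<open>auto simp: tape_of_int simp del: fun_upd_apply\<close>)
  next
    assume "\<exists>b. c = Out b \<and> r = 1 \<and> w' = w @ [b]"
    then obtain b where b: "c = Out b" "r = 1" "w' = w @ [b]" by auto
    show ?thesis unfolding b
      by (rule reach_1[where a' = "(insym x (f 1), bit_sym b, {r' \<in> ?D. f r' = f 1} - {1})" and d = 1])
        (use r b in \<open>auto simp: tape_of_int tape_out[of f w x ?D b, OF inv(2), symmetric] simp del: fun_upd_apply One_nat_def\<close>)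
  qed
  moreover have "reach 1 (Run (c # K) 1, tape_of x (?D - {r}) f w', int (Suc ?p))
      (Run (c # K) 2, tape_of x ?D ?g w', int (Suc ?p))"
    by (rule reach_1[where a' = "(insym x (Suc ?p), outsym w' (Suc ?p), insert r {r' \<in> ?D - {r}. f r' = Suc ?p})" and d = 0])
      (use r c tape_insert[of r ?D x f w' "Suc ?p", symmetric]
        in \<open>auto simp: tape_of_int simp del: fun_upd_apply of_nat_Suc\<close>)
  moreover have "reach (Suc ?p) (Run (c # K) 2, tape_of x ?D ?g w', int (Suc ?p))
      (Run (c # K) 2, tape_of x ?D ?g w', 0)"
    by (rule reach_back) (use c r0 inv in auto)
  moreover have "reach 1 (Run (c # K) 2, tape_of x ?D ?g w', 0) (Run K 0, tape_of x ?D ?g w', 0)"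
    by (rule reach_1[where a' = "tape_of x ?D ?g w' 0" and d = 0])
      (use tape_of_int[of x ?D ?g w' 0] c r0 inv R in auto)
  ultimately have "reach (?p + (1 + (1 + (Suc ?p + 1)))) (Run (c # K) 0, tape_of x ?D f w, 0) (Run K 0, tape_of x ?D ?g w', 0)"
    by (intro reach_add)
  moreover have "?p + (1 + (1 + (Suc ?p + 1))) = 2 * ?p + 4" by simp
  ultimately show ?thesis by (simp only:)
qed

lemma reach_clr:
  assumes inv: "f 0 = 0" and r: "r < R" "r \<noteq> 0"
  shows "reach (2 * f r + 2) (Run (Clr r # K) 0, tape_of x {..<R} f w, 0)
    (Run K 0, tape_of x {..<R} (f(r := 0)) w, 0)"
proof -
  let ?p = "f r" and ?D = "{..<R}"
  have "reach ?p (Run (Clr r # K) 0, tape_of x ?D f w, 0) (Run (Clr r # K) 0, tape_of x ?D f w, int ?p)"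
    by (rule reach_seek) (use r in auto)
  moreover have "reach 1 (Run (Clr r # K) 0, tape_of x ?D f w, int ?p)
      (Run (Clr r # K) 1, tape_of x (?D - {r}) f w, int ?p)"
    by (rule reach_1[where a' = "(insym x ?p, outsym w ?p, {r' \<in> ?D. f r' = ?p} - {r})" and d = 0])
      (use r tape_remove[of x ?D f w r, symmetric] in \<open>auto simp: tape_of_int simp del: fun_upd_apply\<close>)
  moreover have "reach ?p (Run (Clr r # K) 1, tape_of x (?D - {r}) f w, int ?p)
      (Run (Clr r # K) 1, tape_of x (?D - {r}) f w, 0)"
    by (rule reach_back) (use inv in auto)
  moreover have "reach 1 (Run (Clr r # K) 1, tape_of x (?D - {r}) f w, 0)
      (Run K 0, tape_of x ?D (f(r := 0)) w, 0)"
    by (rule reach_1[where a' = "(insym x 0, outsym w 0, insert r {r' \<in> ?D - {r}. f r' = 0})" and d = 0])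
      (use r inv tape_of_int[of x "?D - {r}" f w 0] tape_insert[of r ?D x f w 0]
        in \<open>auto simp del: fun_upd_apply\<close>)
  ultimately have "reach (?p + (1 + (?p + 1))) (Run (Clr r # K) 0, tape_of x ?D f w, 0)
      (Run K 0, tape_of x ?D (f(r := 0)) w, 0)"
    by (intro reach_add)
  moreover have "?p + (1 + (?p + 1)) = 2 * ?p + 2" by simp
  ultimately show ?thesis by (simp only:)
qed

lemma cell_holds_tape:
  assumes "test_ok R t"
  shows "cell_holds (tape_of x {..<R} f w (int (f r))) t \<longleftrightarrow> holds x f r t"
  using assms by (cases t) (auto simp: tape_of_int)

text \<open>\<open>If\<close> and \<open>While\<close> differ only in the stack \<open>L\<close>
  chosen after the test. While the head returns, the outcome is remembered as phase 1 or 2.\<close>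

lemma reach_test:
  assumes c: "c = If r t a b \<and> L = (\<lambda>p. (if p = 1 then a else b) # K) \<or>
      c = While r t a \<and> L = (\<lambda>p. if p = 1 then a # c # K else K)"
    and inv: "f 0 = 0" and r: "r < R" and R: "0 < R" and t: "test_ok R t"
  shows "reach (2 * f r + 2) (Run (c # K) 0, tape_of x {..<R} f w, 0)
    (Run (L (if holds x f r t then 1 else 2 :: nat)) 0, tape_of x {..<R} f w, 0)"
proof -
  let ?p = "f r" and ?D = "{..<R}"
  define ph where "ph = (if holds x f r t then 1 else 2 :: nat)"
  have "reach ?p (Run (c # K) 0, tape_of x ?D f w, 0) (Run (c # K) 0, tape_of x ?D f w, int ?p)"
    by (rule reach_seek) (use c r in auto)
  moreover have "reach 1 (Run (c # K) 0, tape_of x ?D f w, int ?p) (Run (c # K) ph, tape_of x ?D f w, int ?p)"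
    by (rule reach_1[where a' = "tape_of x ?D f w (int ?p)" and d = 0])
      (use c r cell_holds_tape[OF t, of f w r] in \<open>auto simp: tape_of_int ph_def simp del: cell_holds.simps\<close>)
  moreover have "reach ?p (Run (c # K) ph, tape_of x ?D f w, int ?p) (Run (c # K) ph, tape_of x ?D f w, 0)"
    by (rule reach_back) (use c inv in \<open>auto simp: ph_def\<close>)
  moreover have "reach 1 (Run (c # K) ph, tape_of x ?D f w, 0) (Run (L ph) 0, tape_of x ?D f w, 0)"
    by (rule reach_1[where a' = "tape_of x ?D f w 0" and d = 0])
      (use tape_of_int[of x ?D f w 0] c inv R in \<open>auto simp: ph_def\<close>)
  ultimately have "reach (?p + (1 + (?p + 1))) (Run (c # K) 0, tape_of x ?D f w, 0)
      (Run (L ph) 0, tape_of x ?D f w, 0)"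
    by (intro reach_add)
  moreover have "?p + (1 + (?p + 1)) = 2 * ?p + 2" by simp
  ultimately show ?thesis unfolding ph_def by (simp only:)
qed

lemma reach_rstep:
  assumes inv: "f 0 = 0" "f 1 = length w" and R: "2 \<le> R" and ok: "cmd_ok R c"
    and B: "\<And>r. f r \<le> B" and step: "rstep x (c # K, f, w) = (K', f', w')"
  shows "\<exists>t \<le> 2 * B + 4. reach t (Run (c # K) 0, tape_of x {..<R} f w, 0) (Run K' 0, tape_of x {..<R} f' w', 0)"
proof (cases c)
  case (Inc r)
  show ?thesis
    by (rule exI[of _ "2 * f r + 4"], rule conjI)
      (use reach_inc_like[of c r w w f K] Inc step inv R ok B[of r] in auto)
next
  case (Out b)
  show ?thesis
    by (rule exI[of _ "2 * f 1 + 4"], rule conjI)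
      (use reach_inc_like[of c 1 "w @ [b]" w f K] Out step inv R B[of 1] in auto)
next
  case (Clr r)
  show ?thesis
    by (rule exI[of _ "2 * f r + 2"], rule conjI)
      (use reach_clr[of f r K w] Clr step inv R ok B[of r] in auto)
next
  case (Seq a b)
  have "reach 1 (Run (c # K) 0, tape_of x {..<R} f w, 0) (Run (a # b # K) 0, tape_of x {..<R} f w, 0)"
    by (rule reach_1[where a' = "tape_of x {..<R} f w 0" and d = 0]) (auto simp: Seq)
  then show ?thesis using step Seq by (intro exI[of _ 1]) auto
next
  case (If r t a b)
  have "reach (2 * f r + 2) (Run (c # K) 0, tape_of x {..<R} f w, 0)
      (Run ((if (if holds x f r t then 1 else 2 :: nat) = 1 then a else b) # K) 0, tape_of x {..<R} f w, 0)"
    by (rule reach_test[of c r t a b "\<lambda>p. (if p = 1 then a else b) # K"]) (use If inv R ok in simp_all)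
  moreover have "(K', f', w') = ((if (if holds x f r t then 1 else 2 :: nat) = 1 then a else b) # K, f, w)"
    using step If by auto
  ultimately show ?thesis using B[of r] by (intro exI[of _ "2 * f r + 2"] conjI) simp_all
next
  case (While r t a)
  have "reach (2 * f r + 2) (Run (c # K) 0, tape_of x {..<R} f w, 0)
      (Run (if (if holds x f r t then 1 else 2 :: nat) = 1 then a # c # K else K) 0, tape_of x {..<R} f w, 0)"
    by (rule reach_test[of c r t a a "\<lambda>p. if p = 1 then a # c # K else K"]) (use While inv R ok in simp_all)
  moreover have "(K', f', w') = ((if (if holds x f r t then 1 else 2 :: nat) = 1 then a # c # K else K), f, w)"
    using step While by auto
  ultimately show ?thesis using B[of r] by (intro exI[of _ "2 * f r + 2"] conjI) simp_all
qed

text \<open>A step raises a register by at most one, so after \<open>n\<close> steps all marks lie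
  within the first \<open>n + 1\<close> cells and every further step costs a sweep of linear length.
  This makes the simulation quadratic.\<close>

lemma reach_run:
  assumes R: "2 \<le> R" and ok: "cmd_ok R P" and run: "(rstep x ^^ n) ([P], \<lambda>_. 0, []) = (K, f, w)"
  shows "f 0 = 0 \<and> f 1 = length w \<and> (\<forall>r. f r \<le> n) \<and> list_all (cmd_ok R) K \<and>
    (\<exists>t \<le> n * (2 * n + 4). reach t (Run [P] 0, tape_of x {..<R} (\<lambda>_. 0) [], 0) (Run K 0, tape_of x {..<R} f w, 0))"
  using run
proof (induction n arbitrary: K f w)
  case 0
  then show ?case using ok by auto
next
  case (Suc n)
  obtain K0 f0 w0 where s0: "(rstep x ^^ n) ([P], \<lambda>_. 0, []) = (K0, f0, w0)"
    by (cases "(rstep x ^^ n) ([P], \<lambda>_. 0, [])") auto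
  have step: "rstep x (K0, f0, w0) = (K, f, w)" using Suc.prems s0 by simp
  note I = Suc.IH[OF s0]
  then obtain t where t: "t \<le> n * (2 * n + 4)"
    "reach t (Run [P] 0, tape_of x {..<R} (\<lambda>_. 0) [], 0) (Run K0 0, tape_of x {..<R} f0 w0, 0)" by blast
  have "\<exists>t' \<le> 2 * n + 4. reach t' (Run K0 0, tape_of x {..<R} f0 w0, 0) (Run K 0, tape_of x {..<R} f w, 0)"
  proof (cases K0)
    case Nil
    then show ?thesis using step by (intro exI[of _ 0]) auto
  next
    case (Cons c L)
    show ?thesis unfolding Cons
      by (rule reach_rstep) (use I R step Cons in auto)
  qed
  then obtain t' where t': "t' \<le> 2 * n + 4"
    "reach t' (Run K0 0, tape_of x {..<R} f0 w0, 0) (Run K 0, tape_of x {..<R} f w, 0)" by blast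
  have "reach (t + t') (Run [P] 0, tape_of x {..<R} (\<lambda>_. 0) [], 0) (Run K 0, tape_of x {..<R} f w, 0)"
    by (rule reach_add[OF t(2) t'(2)])
  moreover have "t + t' \<le> Suc n * (2 * Suc n + 4)"
    using t(1) t'(1) by (simp add: algebra_simps)
  moreover have "f 0 = 0 \<and> f 1 = length w \<and> (\<forall>r. f r \<le> Suc n) \<and> list_all (cmd_ok R) K"
  proof -
    have le: "f0 r \<le> Suc n" for r using I le_SucI by blast
    have "length w0 \<le> n" using I by metis
    show ?thesis
    proof (cases K0)
      case Nil
      then show ?thesis using step I le by auto
    next
      case (Cons c L)
      then show ?thesis using step I le \<open>length w0 \<le> n\<close> by (cases c) (auto split: if_splits)
    qed
  qed
  ultimately show ?case by blast
qed

lemma reach_output: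
  assumes f1: "f 1 = length w" and R: "2 \<le> R" and n: "n \<le> length w"
  shows "reach n (Run [] 0, tape_of x {..<R} f w, 0)
    (Run [] 0, \<lambda>i. if 0 \<le> i \<and> i < int n then (outsym w (nat i), 0, {}) else tape_of x {..<R} f w i, int n)"
  using n
proof (induction n)
  case 0
  show ?case by (auto simp: fun_eq_iff)
next
  case (Suc n)
  let ?t = "\<lambda>n i. if 0 \<le> i \<and> i < int n then (outsym w (nat i), 0, {}) else tape_of x {..<R} f w i"
  have "reach 1 (Run [] 0, ?t n, int n) (Run [] 0, ?t (Suc n), int (Suc n))"
    by (rule reach_1[where a' = "(outsym w n, 0, {})" and d = 1])
      (use f1 Suc.prems in \<open>auto simp: tape_of_int fun_eq_iff\<close>)
  then have "reach (n + 1) (Run [] 0, tape_of x {..<R} f w, 0) (Run [] 0, ?t (Suc n), int (Suc n))"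
    by (rule reach_add[OF Suc.IH[OF Suc_leD[OF Suc.prems]]])
  then show ?case by simp
qed

lemma reach_complete:
  assumes R: "2 \<le> R" and ok: "cmd_ok R P" and run: "(rstep x ^^ n) ([P], \<lambda>_. 0, []) = ([], f, w)"
  shows "\<exists>t h. t \<le> 1 + n * (2 * n + 4) + n + 1 \<and>
    reach t (Ini, \<lambda>i. if 0 \<le> i \<and> i < int (length x) then (if x ! nat i then (2, 0, {}) else (1, 0, {})) else (0, 0, {}), 0)
      (Acc, \<lambda>i. if 0 \<le> i \<and> i < int (length w) then (outsym w (nat i), 0, {})
        else if i = int (length w) then (0, 0, {}) else tape_of x {..<R} f w i, h)"
proof -
  obtain t where f: "f 1 = length w" "\<And>r. f r \<le> n" and t: "t \<le> n * (2 * n + 4)"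
    "reach t (Run [P] 0, tape_of x {..<R} (\<lambda>_. 0) [], 0) (Run [] 0, tape_of x {..<R} f w, 0)"
    using reach_run[OF R ok run] by blast
  let ?i = "\<lambda>i. if 0 \<le> i \<and> i < int (length x) then (if x ! nat i then (2, 0, {}) else (1, 0, {})) else (0, 0, {})"
  let ?t = "\<lambda>i. if 0 \<le> i \<and> i < int (length w) then (outsym w (nat i), 0, {}) else tape_of x {..<R} f w i"
  let ?e = "\<lambda>i. if 0 \<le> i \<and> i < int (length w) then (outsym w (nat i), 0, {})
        else if i = int (length w) then (0, 0, {}) else tape_of x {..<R} f w i"
  have "?i 0 = (insym x 0, 0, {})" by (auto simp: insym_def bit_sym_def)
  then have "reach 1 (Ini, ?i, 0) (Run [P] 0, tape_of x {..<R} (\<lambda>_. 0) [], 0)"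
    by (intro reach_1[where a' = "(insym x 0, 0, {..<R})" and d = 0])
      (auto simp: tape_of_def insym_def outsym_def bit_sym_def fun_eq_iff)
  moreover note t(2)
  moreover have "reach (length w) (Run [] 0, tape_of x {..<R} f w, 0) (Run [] 0, ?t, int (length w))"
    by (rule reach_output) (use f(1) R in simp_all)
  moreover have "reach 1 (Run [] 0, ?t, int (length w)) (Acc, ?e, int (length w))"
    by (rule reach_1[where a' = "(0, 0, {})" and d = 0])
      (use f(1) R in \<open>auto simp: tape_of_int fun_eq_iff\<close>)
  ultimately have "reach (1 + (t + (length w + 1))) (Ini, ?i, 0) (Acc, ?e, int (length w))"
    by (intro reach_add)
  \<comment> \<open>Register 1 is the length of the output, so the final sweep is bounded by
    \<open>n\<close> as well.\<close>
  moreover have "1 + (t + (length w + 1)) \<le> 1 + n * (2 * n + 4) + n + 1"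
    using t(1) f(2)[of 1] f(1) by simp
  ultimately show ?thesis by blast
qed

end

text \<open>These are the stacks that can occur while \<open>c\<close> runs on top of
  \<open>K\<close>. There are finitely many, because a loop pushes itself back unchanged.\<close>

fun conts :: "cmd \<Rightarrow> cmd list \<Rightarrow> cmd list set" where
  "conts (Seq c d) K = insert (Seq c d # K) (conts c (d # K) \<union> conts d K)"
| "conts (If r t c d) K = insert (If r t c d # K) (conts c K \<union> conts d K)"
| "conts (While r t c) K = insert (While r t c # K) (conts c (While r t c # K))"
| "conts c K = {c # K}"

fun succs :: "cmd list \<Rightarrow> cmd list set" where
  "succs [] = {}"
| "succs (Seq c d # K) = {c # d # K}"
| "succs (If r t c d # K) = {c # K, d # K}"
| "succs (While r t c # K) = {c # While r t c # K, K}"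
| "succs (c # K) = {K}"

lemma Cons_in_conts: "c # K \<in> conts c K"
  by (cases c) auto

lemma finite_conts: "finite (conts c K)"
  by (induction c arbitrary: K) auto

text \<open>Closure under both outcomes of every test turns the stacks of a program, together with
  the empty one, into a finite set of control states.\<close>

lemma succs_conts: "L \<in> conts c K \<Longrightarrow> succs L \<subseteq> insert K (conts c K)"
proof (induction c arbitrary: K L)
  case (Seq c d)
  consider "L = Seq c d # K" | "L \<in> conts c (d # K)" | "L \<in> conts d K" using Seq.prems by auto
  then show ?case
  proof cases
    case 1
    then show ?thesis using Cons_in_conts[of c "d # K"] by simp
  next
    case 2
    show ?thesis using Seq.IH(1)[OF 2] Cons_in_conts[of d K] by auto
  next
    case 3
    show ?thesis using Seq.IH(2)[OF 3] by auto
  qed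
next
  case (If r t c d)
  consider "L = If r t c d # K" | "L \<in> conts c K" | "L \<in> conts d K" using If.prems by auto
  then show ?case
  proof cases
    case 1
    then show ?thesis using Cons_in_conts[of c K] Cons_in_conts[of d K] by simp
  next
    case 2
    show ?thesis using If.IH(1)[OF 2] by auto
  next
    case 3
    show ?thesis using If.IH(2)[OF 3] by auto
  qed
next
  case (While r t c)
  consider "L = While r t c # K" | "L \<in> conts c (While r t c # K)" using While.prems by auto
  then show ?case
  proof cases
    case 1
    then show ?thesis using Cons_in_conts[of c "While r t c # K"] by simp
  next
    case 2
    show ?thesis using While.IH[OF 2] by auto
  qed
qed auto

lemma cmd_ok_conts: "\<lbrakk>L \<in> conts c K; cmd_ok R c; list_all (cmd_ok R) K\<rbrakk> \<Longrightarrow> list_all (cmd_ok R) L"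
proof (induction c arbitrary: K L)
  case (Seq c d)
  then show ?case using Seq.IH(1)[of L "d # K"] Seq.IH(2)[of L K] by auto
next
  case (If r t c d)
  then show ?case using If.IH(1)[of L K] If.IH(2)[of L K] by auto
next
  case (While r t c)
  then show ?case using While.IH[of L "While r t c # K"] by auto
qed auto

theorem tm_of_program:
  assumes R: "2 \<le> R" and ok: "cmd_ok R P"
  obtains M where "wf_tm M"
    "\<And>x n f w. (rstep x ^^ n) ([P], \<lambda>_. 0, []) = ([], f, w) \<Longrightarrow>
      \<exists>t \<le> 2 * n * n + 5 * n + 2. halted (tm_run M t x) \<and> tape_output (tm_run M t x) w"
proof -
  define C where "C = insert [] (conts P [])"
  define St where "St = {Ini, Acc} \<union> (\<lambda>(K, p). Run K p) ` (C \<times> {..2})"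
  define Sy where "Sy = {..2::nat} \<times> {..2::nat} \<times> Pow {..<R}"
  have C_succs: "succs L \<subseteq> C" if "L \<in> C" for L
    using that succs_conts[of L P "[]"] unfolding C_def by auto
  have C_ok: "list_all (cmd_ok R) L" if "L \<in> C" for L
    using that cmd_ok_conts[of L P "[]" R] ok unfolding C_def by auto
  have Run_in: "Run K p \<in> St \<longleftrightarrow> K \<in> C \<and> p \<le> 2" for K p unfolding St_def by auto
  have bit: "bit_sym b \<le> 2" for b by (simp add: bit_sym_def)
  have closed: "q' \<in> St \<and> a' \<in> Sy \<and> d \<in> {-1, 0, 1}"
    if q: "q \<in> St" "q \<noteq> Acc" and a: "a \<in> Sy" and step: "delta R P q a = (q', a', d)" for q a q' a' d
  proof -
    obtain i u m where a_eq: "a = (i, u, m)" by (cases a) auto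
    have a': "i \<le> 2" "u \<le> 2" "m \<subseteq> {..<R}" using a unfolding a_eq Sy_def by auto
    show ?thesis
    proof (cases q)
      case Ini
      then show ?thesis using step a' Cons_in_conts[of P "[]"] unfolding a_eq Sy_def St_def C_def by auto
    next
      case Acc
      then show ?thesis using q by simp
    next
      case (Run L p)
      have L: "L \<in> C" "p \<le> 2" using q Run Run_in by auto
      show ?thesis
      proof (cases L)
        case Nil
        then show ?thesis using step Run L a' unfolding a_eq Sy_def
          by (auto simp: Run_in split: if_splits) (auto simp: St_def)
      next
        case (Cons c K)
        have "succs (c # K) \<subseteq> C" "cmd_ok R c" using C_succs[OF L(1)] C_ok[OF L(1)] Cons by auto
        then show ?thesis using step Run L a' bit R unfolding a_eq Cons Sy_def
          by (cases c) (auto simp: Run_in split: if_splits)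
      qed
    qed
  qed
  have cl: "\<forall>q\<in>St - {Acc}. \<forall>a\<in>Sy. case delta R P q a of (q', a', d) \<Rightarrow> q' \<in> St \<and> a' \<in> Sy \<and> d \<in> {-1, 0, 1}"
  proof (intro ballI)
    fix q a assume "q \<in> St - {Acc}" "a \<in> Sy"
    then show "case delta R P q a of (q', a', d) \<Rightarrow> q' \<in> St \<and> a' \<in> Sy \<and> d \<in> {-1, 0, 1}"
      using closed[of q a "fst (delta R P q a)" "fst (snd (delta R P q a))" "snd (snd (delta R P q a))"]
      by (simp add: case_prod_beta)
  qed
  have fin: "finite St" "finite Sy" unfolding St_def Sy_def C_def using finite_conts by auto
  have init: "Ini \<in> St" "Acc \<in> St" "Ini \<noteq> Acc" "(0, 0, {}) \<in> Sy" "(1, 0, {}) \<in> Sy" "(2, 0, {}) \<in> Sy"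
    "(0, 0, {}) \<noteq> ((1, 0, {}) :: cell)" "(0, 0, {}) \<noteq> ((2, 0, {}) :: cell)" "(1, 0, {}) \<noteq> ((2, 0, {}) :: cell)"
    unfolding St_def Sy_def by auto
  obtain M g where M: "wf_tm M" and g: "g (0, 0, {}) = 0" "g (1, 0, {}) = 1" "g (2, 0, {}) = 2"
    and sim: "\<And>x t tp h. (astep (delta R P) Acc ^^ t)
        (Ini, \<lambda>i. if 0 \<le> i \<and> i < int (length x) then (if x ! nat i then (2, 0, {}) else (1, 0, {})) else (0, 0, {}), 0)
          = (Acc, tp, h) \<Longrightarrow> tm_run M t x = (1, \<lambda>i. g (tp i), h)"
    using tm_of_abstract_machine[OF fin init cl] by blast
  show thesis
  proof (rule that[OF M])
    fix x n f w
    assume run: "(rstep x ^^ n) ([P], \<lambda>_. 0, []) = ([], f, w)"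
    let ?e = "\<lambda>i. if 0 \<le> i \<and> i < int (length w) then (outsym w (nat i), 0, {})
        else if i = int (length w) then (0, 0, {}) else tape_of x {..<R} f w i"
    obtain t h where t: "t \<le> 1 + n * (2 * n + 4) + n + 1" "tm_run M t x = (1, \<lambda>i. g (?e i), h)"
      using reach_complete[OF R ok run] sim by blast
    have "g (outsym w i, 0, {}) = bit_sym (w ! i)" if "i < length w" for i
      using that g by (simp add: outsym_def bit_sym_def)
    then have "halted (tm_run M t x) \<and> tape_output (tm_run M t x) w"
      unfolding t(2) halted_def tape_output_def using g by simp
    moreover have "t \<le> 2 * n * n + 5 * n + 2" using t(1) by (simp add: algebra_simps)
    ultimately show "\<exists>t \<le> 2 * n * n + 5 * n + 2. halted (tm_run M t x) \<and> tape_output (tm_run M t x) w"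
      by blast
  qed
qed

subsection \<open>Reasoning about register programs\<close>

text \<open>The number of steps is bounded syntactically, in terms of a bound \<open>X\<close> on the number of
  iterations of each single execution of a loop.\<close>

fun tb :: "nat \<Rightarrow> cmd \<Rightarrow> nat" where
  "tb X (Seq c d) = 1 + tb X c + tb X d"
| "tb X (If r t c d) = 1 + tb X c + tb X d"
| "tb X (While r t c) = X * (tb X c + 1) + 1"
| "tb X _ = 1"

text \<open>One number of steps serves all remaining stacks \<open>K\<close>, so that runs can be
  composed below any continuation.\<close>

definition runs :: "nat \<Rightarrow> bool list \<Rightarrow> cmd \<Rightarrow> rstate \<Rightarrow> rstate \<Rightarrow> bool" where
  "runs X x c s s' \<longleftrightarrow> (\<exists>t \<le> tb X c. \<forall>K. (rstep x ^^ t) (c # K, s) = (K, s'))"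

lemma funpow_trans: "\<lbrakk>(g ^^ s) a = b; (g ^^ t) b = c\<rbrakk> \<Longrightarrow> (g ^^ (s + t)) a = c"
  by (subst add.commute) (simp add: funpow_add)

lemma funpow_1: "g a = b \<Longrightarrow> (g ^^ 1) a = b" for g :: "'a \<Rightarrow> 'a"
  by simp

lemma concat_map_Nil: "concat (map (\<lambda>_. []) xs) = []"
  by (induction xs) auto

lemma runs_Inc: "runs X x (Inc r) (f, w) (f(r := Suc (f r)), w)"
  unfolding runs_def by (rule exI[of _ 1]) simp

lemma runs_Out: "runs X x (Out b) (f, w) (f(1 := Suc (f 1)), w @ [b])"
  unfolding runs_def by (rule exI[of _ 1]) simp

lemma runs_Clr: "runs X x (Clr r) (f, w) (f(r := 0), w)"
  unfolding runs_def by (rule exI[of _ 1]) simp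

lemma runs_Seq:
  assumes "runs X x c s s'" "runs X x d s' s''"
  shows "runs X x (Seq c d) s s''"
proof -
  obtain t t' where t: "t \<le> tb X c" "\<And>K. (rstep x ^^ t) (c # K, s) = (K, s')"
    and t': "t' \<le> tb X d" "\<And>K. (rstep x ^^ t') (d # K, s') = (K, s'')"
    using assms unfolding runs_def by blast
  have "(rstep x ^^ (1 + (t + t'))) (Seq c d # K, s) = (K, s'')" for K
    by (rule funpow_trans[OF funpow_1 funpow_trans[OF t(2) t'(2)]]) (cases s; simp)
  then show ?thesis unfolding runs_def using t(1) t'(1) by (intro exI[of _ "1 + (t + t')"]) auto
qed

lemma runs_If:
  assumes "holds x f r t \<Longrightarrow> runs X x c (f, w) s'" "\<not> holds x f r t \<Longrightarrow> runs X x d (f, w) s'"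
  shows "runs X x (If r t c d) (f, w) s'"
proof -
  obtain u where u: "u \<le> tb X c + tb X d"
    "\<And>K. (rstep x ^^ u) ((if holds x f r t then c else d) # K, f, w) = (K, s')"
    using assms unfolding runs_def by (cases "holds x f r t") (auto intro: trans_le_add1 trans_le_add2)
  have "(rstep x ^^ (1 + u)) (If r t c d # K, f, w) = (K, s')" for K
    by (rule funpow_trans[OF funpow_1 u(2)]) simp
  then show ?thesis unfolding runs_def using u(1) by (intro exI[of _ "1 + u"]) auto
qed

text \<open>\<open>sq j\<close> is the state before iteration \<open>j\<close>. Each iteration costs
  one test and one body, and the failing test costs one more step.\<close>

lemma runs_While:
  assumes m: "m \<le> X"
    and body: "\<And>j. j < m \<Longrightarrow> holds x (fst (sq j)) r t \<and> runs X x c (sq j) (sq (Suc j))"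
    and exit: "\<not> holds x (fst (sq m)) r t"
  shows "runs X x (While r t c) (sq 0) (sq m)"
proof -
  have "\<exists>u \<le> d * (tb X c + 1) + 1. \<forall>K. (rstep x ^^ u) (While r t c # K, sq j) = (K, sq m)" if "j + d = m" for j d
    using that
  proof (induction d arbitrary: j)
    case 0
    then show ?case using exit by (intro exI[of _ 1]) (cases "sq m"; auto)
  next
    case (Suc d)
    then obtain u where u: "u \<le> d * (tb X c + 1) + 1"
      "\<And>K. (rstep x ^^ u) (While r t c # K, sq (Suc j)) = (K, sq m)" by (metis add_Suc_shift)
    obtain v where v: "v \<le> tb X c" "\<And>K. (rstep x ^^ v) (c # K, sq j) = (K, sq (Suc j))"
      using body[of j] Suc.prems unfolding runs_def by auto
    have "(rstep x ^^ (1 + (v + u))) (While r t c # K, sq j) = (K, sq m)" for K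
      by (rule funpow_trans[OF funpow_1 funpow_trans[OF v(2) u(2)]])
        (use body[of j] Suc.prems in \<open>cases "sq j"; simp\<close>)
    moreover have "1 + (v + u) \<le> Suc d * (tb X c + 1) + 1" using u(1) v(1) by simp
    ultimately show ?case by blast
  qed
  from this[of 0 m] obtain u where "u \<le> m * (tb X c + 1) + 1"
    "\<forall>K. (rstep x ^^ u) (While r t c # K, sq 0) = (K, sq m)" by auto
  moreover have "m * (tb X c + 1) + 1 \<le> tb X (While r t c)"
    using mult_le_mono1[OF m, of "tb X c + 1"] by simp
  ultimately show ?thesis unfolding runs_def using le_trans by blast
qed

text \<open>\<open>does X x c S f w g u\<close>: the program appends \<open>u\<close> to the output and ends with the register
  contents \<open>g\<close>, except that nothing is claimed about the scratch registers \<open>S\<close>.\<close>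

definition does :: "nat \<Rightarrow> bool list \<Rightarrow> cmd \<Rightarrow> nat set \<Rightarrow> (nat \<Rightarrow> nat) \<Rightarrow> bool list \<Rightarrow> (nat \<Rightarrow> nat) \<Rightarrow> bool list \<Rightarrow> bool" where
  "does X x c S f w g u \<longleftrightarrow> (\<exists>f'. runs X x c (f, w) (f', w @ u) \<and> (\<forall>r. r \<notin> S \<longrightarrow> f' r = g r))"

lemma does_mono:
  "\<lbrakk>does X x c S f w g u; S \<subseteq> S'; \<And>r. r \<notin> S' \<Longrightarrow> g r = g' r\<rbrakk> \<Longrightarrow> does X x c S' f w g' u"
  unfolding does_def by (metis subsetD)

lemma does_Inc: "does X x (Inc r) {} f w (f(r := Suc (f r))) []"
  unfolding does_def using runs_Inc by fastforce

lemma does_Clr: "does X x (Clr r) {} f w (f(r := 0)) []"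
  unfolding does_def using runs_Clr by fastforce

lemma does_Out: "does X x (Out b) {1} f w f [b]"
  unfolding does_def using runs_Out by fastforce

lemma does_Seq:
  assumes "does X x c S f w g u" and "\<And>f'. (\<And>r. r \<notin> S \<Longrightarrow> f' r = g r) \<Longrightarrow> does X x d S f' (w @ u) g' u'"
  shows "does X x (Seq c d) S f w g' (u @ u')"
proof -
  obtain f' where f': "runs X x c (f, w) (f', w @ u)" "\<And>r. r \<notin> S \<Longrightarrow> f' r = g r"
    using assms(1) unfolding does_def by blast
  obtain f'' where "runs X x d (f', w @ u) (f'', (w @ u) @ u')" "\<forall>r. r \<notin> S \<longrightarrow> f'' r = g' r"
    using assms(2)[OF f'(2)] unfolding does_def by blast
  then show ?thesis unfolding does_def using runs_Seq[OF f'(1)]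
    by (metis append.assoc)
qed

lemma does_If:
  assumes "holds x f r t \<Longrightarrow> does X x c S f w g u" "\<not> holds x f r t \<Longrightarrow> does X x d S f w g u"
  shows "does X x (If r t c d) S f w g u"
  using assms unfolding does_def by (cases "holds x f r t") (blast intro: runs_If)+

definition For :: "nat \<Rightarrow> nat \<Rightarrow> cmd \<Rightarrow> cmd" where
  "For i r c = Seq (Clr i) (While i (NEq r) (Seq c (Inc i)))"

text \<open>\<open>G j\<close> predicts the registers outside \<open>S\<close> before iteration
  \<open>j\<close>, and \<open>U j\<close> is the output of that iteration. The body has to preserve
  the counter, which is therefore taken out of its scratch set.\<close>

lemma does_For:
  assumes i: "i \<in> S" "r \<notin> S" and m: "f r = m" "m \<le> X"
    and G0: "\<And>q. q \<notin> S \<Longrightarrow> f q = G 0 q" and Gr: "\<And>j. j \<le> m \<Longrightarrow> G j r = m"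
    and body: "\<And>j f' w'. \<lbrakk>j < m; f' i = j; \<And>q. q \<notin> S \<Longrightarrow> f' q = G j q\<rbrakk>
      \<Longrightarrow> does X x c (S - {i}) f' w' ((G (Suc j))(i := j)) (U j)"
  shows "does X x (For i r c) S f w (G m) (concat (map U [0..<m]))"
proof -
  define good where "good j s \<longleftrightarrow> fst s i = j \<and> (\<forall>q. q \<notin> S \<longrightarrow> fst s q = G j q) \<and>
    snd s = w @ concat (map U [0..<j])" for j s
  have step: "\<exists>s'. runs X x (Seq c (Inc i)) s s' \<and> good (Suc j) s'" if j: "j < m" and s: "good j s" for j s
  proof -
    obtain f1 w1 where s_eq: "s = (f1, w1)" by (cases s)
    have f1: "f1 i = j" "\<And>q. q \<notin> S \<Longrightarrow> f1 q = G j q" "w1 = w @ concat (map U [0..<j])"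
      using s unfolding good_def s_eq by auto
    obtain f2 where f2: "runs X x c (f1, w1) (f2, w1 @ U j)" "\<And>q. q \<notin> S - {i} \<Longrightarrow> f2 q = ((G (Suc j))(i := j)) q"
      using body[OF j f1(1,2), of w1] unfolding does_def by auto
    have "runs X x (Seq c (Inc i)) s (f2(i := Suc (f2 i)), w1 @ U j)"
      unfolding s_eq by (rule runs_Seq[OF f2(1) runs_Inc])
    moreover have "good (Suc j) (f2(i := Suc (f2 i)), w1 @ U j)"
      unfolding good_def using f2(2) i f1(3) by auto
    ultimately show ?thesis by blast
  qed
  \<comment> \<open>\<open>does\<close> gives no value for scratch registers; choice fixes the
    actual sequence of states that \<open>runs_While\<close> asks for.\<close>
  define sq where "sq = rec_nat (f(i := 0), w) (\<lambda>j s. SOME s'. runs X x (Seq c (Inc i)) s s' \<and> good (Suc j) s')"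
  have sq_Suc: "sq (Suc j) = (SOME s'. runs X x (Seq c (Inc i)) (sq j) s' \<and> good (Suc j) s')" for j
    unfolding sq_def by simp
  have good: "good j (sq j)" if "j \<le> m" for j
    using that
  proof (induction j)
    case 0
    then show ?case unfolding good_def sq_def using G0 i by auto
  next
    case (Suc j)
    then show ?case using someI_ex[OF step[of j "sq j"]] unfolding sq_Suc by auto
  qed
  have "runs X x (While i (NEq r) (Seq c (Inc i))) (sq 0) (sq m)"
  proof (rule runs_While[OF m(2)])
    fix j assume j: "j < m"
    have "fst (sq j) r = m" "fst (sq j) i = j" using good[of j] j i Gr[of j] unfolding good_def by auto
    moreover have "runs X x (Seq c (Inc i)) (sq j) (sq (Suc j))"
      using someI_ex[OF step[OF j good]] j unfolding sq_Suc by auto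
    ultimately show "holds x (fst (sq j)) i (NEq r) \<and> runs X x (Seq c (Inc i)) (sq j) (sq (Suc j))"
      using j by simp
  next
    show "\<not> holds x (fst (sq m)) i (NEq r)" using good[of m] i Gr[of m] unfolding good_def by simp
  qed
  moreover have "sq 0 = (f(i := 0), w)" unfolding sq_def by simp
  moreover have "sq m = (fst (sq m), w @ concat (map U [0..<m]))" "\<And>q. q \<notin> S \<Longrightarrow> fst (sq m) q = G m q"
    using good[of m] unfolding good_def by (auto simp: prod_eq_iff)
  ultimately have "runs X x (For i r c) (f, w) (fst (sq m), w @ concat (map U [0..<m]))"
    unfolding For_def by (metis runs_Seq runs_Clr)
  then show ?thesis unfolding does_def using \<open>\<And>q. q \<notin> S \<Longrightarrow> fst (sq m) q = G m q\<close> by blast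
qed

text \<open>The register is used as a pointer into the input. It stops at the first blank because
  \<open>bit_sym\<close> is never 0.\<close>

lemma does_While_length:
  assumes "length x \<le> X" "f r = 0"
  shows "does X x (While r NonBlank (Inc r)) {} f w (f(r := length x)) []"
proof -
  have "runs X x (While r NonBlank (Inc r)) ((\<lambda>j. (f(r := j), w)) 0) ((\<lambda>j. (f(r := j), w)) (length x))"
  proof (rule runs_While[OF assms(1)])
    show "holds x (fst (f(r := j), w)) r NonBlank \<and> runs X x (Inc r) (f(r := j), w) (f(r := Suc j), w)"
      if "j < length x" for j
      using that runs_Inc[of X x r "f(r := j)" w] by (simp add: insym_def bit_sym_def)
  qed (simp add: insym_def)
  moreover have "f(r := 0) = f" using assms(2) by auto
  ultimately show ?thesis unfolding does_def by auto
qed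

subsection \<open>Arithmetic and printing\<close>

text \<open>The command language has no empty command; this one touches only the scratch register
  15.\<close>

definition Skip :: cmd where "Skip = Seq (Inc 15) (Clr 15)"

lemma does_Skip: "does X x Skip {15} f w f []"
proof -
  have "does X x Skip {15} f w f ([] @ [])"
    unfolding Skip_def
  proof (rule does_Seq[OF does_mono[OF does_Inc]])
    fix f' assume f': "\<And>q. q \<notin> {15} \<Longrightarrow> f' q = (f(15 := Suc (f 15))) q"
    show "does X x (Clr 15) {15} f' (w @ []) f []"
      by (rule does_mono[OF does_Clr]) (use f' in auto)
  qed auto
  then show ?thesis by simp
qed

fun incs :: "nat \<Rightarrow> nat \<Rightarrow> cmd" where
  "incs r 0 = Skip"
| "incs r (Suc m) = Seq (Inc r) (incs r m)"

lemma does_incs: "r \<noteq> 15 \<Longrightarrow> does X x (incs r m) {15} f w (f(r := f r + m)) []"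
proof (induction m arbitrary: f w)
  case 0
  then show ?case using does_Skip by (simp add: does_mono)
next
  case (Suc m)
  have "does X x (Seq (Inc r) (incs r m)) {15} f w (f(r := f r + Suc m)) ([] @ [])"
  proof (rule does_Seq[OF does_mono[OF does_Inc]])
    fix f' assume f': "\<And>q. q \<notin> {15} \<Longrightarrow> f' q = (f(r := Suc (f r))) q"
    show "does X x (incs r m) {15} f' (w @ []) (f(r := f r + Suc m)) []"
      by (rule does_mono[OF Suc.IH]) (use Suc.prems f' in auto)
  qed auto
  then show ?case by (simp only: incs.simps append_Nil)
qed

definition add_to :: "nat \<Rightarrow> nat \<Rightarrow> nat \<Rightarrow> cmd" where
  "add_to i r d = For i r (Inc d)"

lemma does_add_to:
  assumes "distinct [i, r, d]" "f r \<le> X"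
  shows "does X x (add_to i r d) {i} f w (f(d := f d + f r)) []"
proof -
  have "does X x (For i r (Inc d)) {i} f w ((\<lambda>j. f(d := f d + j)) (f r)) (concat (map (\<lambda>_. []) [0..<f r]))"
    by (rule does_For) (use assms in \<open>auto intro!: does_mono[OF does_Inc]\<close>)
  then show ?thesis unfolding add_to_def by (simp add: concat_map_Nil)
qed

definition mult :: "nat \<Rightarrow> nat \<Rightarrow> cmd" where
  "mult r d = Seq (Clr 15) (Seq (For 13 d (add_to 14 r 15)) (Seq (Clr d) (add_to 13 15 d)))"

lemma does_mult:
  assumes r: "r < 13" "d < 13" "r \<noteq> d" and X: "f r \<le> X" "f d \<le> X" "f d * f r \<le> X"
  shows "does X x (mult r d) {13, 14, 15} f w (f(d := f d * f r)) []"
proof -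
  let ?S = "{13, 14, 15} :: nat set"
  \<comment> \<open>Register 15 holds the running product, so its value is tracked here and given up
    only at the very end.\<close>
  have "does X x (mult r d) {13, 14} f w (f(d := f d * f r, 15 := f d * f r)) ([] @ [] @ [] @ [])"
    unfolding mult_def
  proof (rule does_Seq[OF does_mono[OF does_Clr]])
    fix f1 assume f1: "\<And>q. q \<notin> {13, 14} \<Longrightarrow> f1 q = (f(15 := 0)) q"
    show "does X x (Seq (For 13 d (add_to 14 r 15)) (Seq (Clr d) (add_to 13 15 d))) {13, 14} f1 (w @ [])
      (f(d := f d * f r, 15 := f d * f r)) ([] @ [] @ [])"
    proof (rule does_Seq)
      have "does X x (For 13 d (add_to 14 r 15)) {13, 14} f1 (w @ [])
          ((\<lambda>j. f(15 := j * f r)) (f d)) (concat (map (\<lambda>_. []) [0..<f d]))"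
      proof (rule does_For)
        fix j f' w' assume j: "j < f d" "f' 13 = j" and f': "\<And>q. q \<notin> {13, 14} \<Longrightarrow> f' q = (f(15 := j * f r)) q"
        have fr: "f' r = f r" "f' 15 = j * f r" using f' r by auto
        show "does X x (add_to 14 r 15) ({13, 14} - {13}) f' w' ((f(15 := Suc j * f r))(13 := j)) []"
          by (rule does_mono[OF does_add_to]) (use r X j f' fr in auto)
      qed (use r X f1 in auto)
      then show "does X x (For 13 d (add_to 14 r 15)) {13, 14} f1 (w @ []) (f(15 := f d * f r)) []"
        by (simp add: concat_map_Nil)
    next
      fix f2 assume f2: "\<And>q. q \<notin> {13, 14} \<Longrightarrow> f2 q = (f(15 := f d * f r)) q"
      show "does X x (Seq (Clr d) (add_to 13 15 d)) {13, 14} f2 ((w @ []) @ []) (f(d := f d * f r, 15 := f d * f r)) ([] @ [])"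
      proof (rule does_Seq[OF does_mono[OF does_Clr]])
        fix f3 assume f3: "\<And>q. q \<notin> {13, 14} \<Longrightarrow> f3 q = (f2(d := 0)) q"
        have fr: "f3 15 = f d * f r" "f3 d = 0" using f2 f3 r by auto
        show "does X x (add_to 13 15 d) {13, 14} f3 (((w @ []) @ []) @ []) (f(d := f d * f r, 15 := f d * f r)) []"
          by (rule does_mono[OF does_add_to]) (use r X f2 f3 fr in auto)
      qed auto
    qed
  qed auto
  then have "does X x (mult r d) {13, 14} f w (f(d := f d * f r, 15 := f d * f r)) []" by simp
  then show ?thesis by (rule does_mono) (use r in auto)
qed

fun mults :: "nat \<Rightarrow> nat \<Rightarrow> nat \<Rightarrow> cmd" where
  "mults r d 0 = Skip"
| "mults r d (Suc k) = Seq (mult r d) (mults r d k)"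

lemma does_mults:
  assumes r: "r < 13" "d < 13" "r \<noteq> d" and X: "f r \<le> X" "\<And>j. j \<le> k \<Longrightarrow> f d * f r ^ j \<le> X"
  shows "does X x (mults r d k) {13, 14, 15} f w (f(d := f d * f r ^ k)) []"
  using X
proof (induction k arbitrary: f w)
  case 0
  show ?case using does_Skip[of X x f w] by (auto intro!: does_mono[OF does_Skip])
next
  case (Suc k)
  have "does X x (Seq (mult r d) (mults r d k)) {13, 14, 15} f w (f(d := f d * f r ^ Suc k)) ([] @ [])"
  proof (rule does_Seq[OF does_mult[OF r]])
    show "f r \<le> X" "f d \<le> X" "f d * f r \<le> X"
      using Suc.prems(1) Suc.prems(2)[of 0] Suc.prems(2)[of 1] by auto
    fix f' assume f': "\<And>q. q \<notin> {13, 14, 15} \<Longrightarrow> f' q = (f(d := f d * f r)) q"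
    then have fr: "f' r = f r" "f' d = f d * f r" using r by auto
    show "does X x (mults r d k) {13, 14, 15} f' (w @ []) (f(d := f d * f r ^ Suc k)) []"
    proof (rule does_mono[OF Suc.IH])
      show "f' d * f' r ^ j \<le> X" if "j \<le> k" for j
        using Suc.prems(2)[of "Suc j"] that fr by (simp add: mult_ac)
    qed (use Suc.prems f' fr in \<open>auto simp: mult_ac\<close>)
  qed
  then show ?case by (simp only: mults.simps append_Nil)
qed

definition poly_cmd :: "nat \<Rightarrow> nat \<Rightarrow> nat \<Rightarrow> nat \<Rightarrow> cmd" where
  "poly_cmd c k r d = Seq (incs d c) (Seq (mults r d k) (incs d c))"

lemma does_poly_cmd:
  assumes r: "r < 13" "d < 13" "r \<noteq> d" and d: "f d = 0" and X: "f r \<le> X" "c * f r ^ k + c \<le> X"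
  shows "does X x (poly_cmd c k r d) {13, 14, 15} f w (f(d := c * f r ^ k + c)) []"
proof -
  \<comment> \<open>For \<open>f r = 0\<close> the powers are not increasing, since
    \<open>0 ^ 0 = 1\<close>; the second summand \<open>c\<close> of the bound covers this
    case.\<close>
  have pow: "c * f r ^ j \<le> X" if "j \<le> k" for j
  proof (cases "f r = 0")
    case True
    then show ?thesis using X(2) by (cases j) auto
  next
    case False
    then have "f r ^ j \<le> f r ^ k" using that by (simp add: power_increasing)
    then show ?thesis using X(2) mult_le_mono2 by (metis add_leD1 le_trans)
  qed
  have "does X x (poly_cmd c k r d) {13, 14, 15} f w (f(d := c * f r ^ k + c)) ([] @ [] @ [])"
    unfolding poly_cmd_def
  proof (rule does_Seq[OF does_mono[OF does_incs]])
    fix f1 assume f1: "\<And>q. q \<notin> {13, 14, 15} \<Longrightarrow> f1 q = (f(d := c)) q"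
    have fr: "f1 r = f r" "f1 d = c" using f1 r by auto
    show "does X x (Seq (mults r d k) (incs d c)) {13, 14, 15} f1 (w @ []) (f(d := c * f r ^ k + c)) ([] @ [])"
    proof (rule does_Seq[OF does_mults[OF r]])
      show "f1 r \<le> X" "\<And>j. j \<le> k \<Longrightarrow> f1 d * f1 r ^ j \<le> X" using fr X pow by auto
      fix f2 assume f2: "\<And>q. q \<notin> {13, 14, 15} \<Longrightarrow> f2 q = (f1(d := f1 d * f1 r ^ k)) q"
      show "does X x (incs d c) {13, 14, 15} f2 ((w @ []) @ []) (f(d := c * f r ^ k + c)) []"
        by (rule does_mono[OF does_incs]) (use r f1 f2 fr in auto)
    qed
  qed (use r d in auto)
  then show ?thesis by simp
qed

fun outs :: "bool list \<Rightarrow> cmd" where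
  "outs [] = Skip"
| "outs (b # bs) = Seq (Out b) (outs bs)"

lemma does_outs: "does X x (outs bs) {1, 15} f w f bs"
proof (induction bs arbitrary: f w)
  case Nil
  show ?case by (auto intro: does_mono[OF does_Skip])
next
  case (Cons b bs)
  have "does X x (Seq (Out b) (outs bs)) {1, 15} f w f ([b] @ bs)"
  proof (rule does_Seq[OF does_mono[OF does_Out]])
    fix f' assume "\<And>q. q \<notin> {1, 15} \<Longrightarrow> f' q = f q"
    then show "does X x (outs bs) {1, 15} f' (w @ [b]) f bs"
      by (intro does_mono[OF Cons.IH]) auto
  qed auto
  then show ?case by simp
qed

definition rep_out :: "nat \<Rightarrow> bool list \<Rightarrow> cmd" where
  "rep_out r bs = For 3 r (outs bs)"

lemma does_rep_out:
  assumes "r \<notin> {1, 3, 15}" "f r \<le> X"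
  shows "does X x (rep_out r bs) {1, 3, 15} f w f (concat (replicate (f r) bs))"
proof -
  have "does X x (For 3 r (outs bs)) {1, 3, 15} f w ((\<lambda>_. f) (f r)) (concat (map (\<lambda>_. bs) [0..<f r]))"
  proof (rule does_For)
    fix j f' w' assume "f' 3 = j" "\<And>q. q \<notin> {1, 3, 15} \<Longrightarrow> f' q = f q"
    then show "does X x (outs bs) ({1, 3, 15} - {3}) f' w' (f(3 := j)) bs"
      by (intro does_mono[OF does_outs]) auto
  qed (use assms in auto)
  then show ?thesis unfolding rep_out_def by (simp add: map_replicate_const)
qed

lemma enc_unary_add: "enc_unary (a + b) = enc_unary a @ enc_unary b"
  unfolding enc_unary_def by (simp add: replicate_add)

lemma enc_unary_mult: "concat (replicate k (enc_unary a)) = enc_unary (a * k)"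
proof (induction k)
  case 0
  then show ?case by (simp add: enc_unary_def)
next
  case (Suc k)
  then show ?case by (simp add: enc_unary_add)
qed

text \<open>A symbolic vertex \<open>(a, u, v)\<close> stands for the vertex \<open>a\<close>, increased by \<open>K\<close> times the current
  cell number if \<open>u\<close> holds and by \<open>K\<close> times the row width if \<open>v\<close> holds.\<close>

type_synonym svertex = "nat \<times> bool \<times> bool"

fun vval :: "nat \<Rightarrow> nat \<Rightarrow> nat \<Rightarrow> svertex \<Rightarrow> nat" where
  "vval K k W (a, u, v) = (if u then K * k else 0) + ((if v then K * W else 0) + a)"

definition enc_vertices :: "nat list \<Rightarrow> bool list" where
  "enc_vertices vs = concat (map (\<lambda>v. enc_unary v @ tok_vend) vs) @ tok_eend"

definition enc_block :: "nat \<Rightarrow> nat \<Rightarrow> nat \<Rightarrow> svertex list list \<Rightarrow> bool list" where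
  "enc_block K k W es = concat (map (\<lambda>e. enc_vertices (map (vval K k W) e)) es)"

fun print_vertex :: "nat \<Rightarrow> svertex \<Rightarrow> cmd" where
  "print_vertex K (a, u, v) =
     Seq (if u then rep_out 2 (enc_unary K) else Skip)
      (Seq (if v then rep_out 7 (enc_unary K) else Skip) (outs (enc_unary a @ tok_vend)))"

fun print_edge :: "nat \<Rightarrow> svertex list \<Rightarrow> cmd" where
  "print_edge K [] = outs tok_eend"
| "print_edge K (v # e) = Seq (print_vertex K v) (print_edge K e)"

fun print_edges :: "nat \<Rightarrow> svertex list list \<Rightarrow> cmd" where
  "print_edges K [] = Skip"
| "print_edges K (e # es) = Seq (print_edge K e) (print_edges K es)"

lemma does_rep_out_if:
  assumes "r \<notin> {1, 3, 15}" "f r \<le> X"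
  shows "does X x (if u then rep_out r (enc_unary K) else Skip) {1, 3, 15} f w f
    (enc_unary (if u then K * f r else 0))"
  using does_rep_out[of r f X x "enc_unary K" w] does_mono[OF does_Skip[of X x f w], of "{1, 3, 15}"] assms
  by (auto simp: enc_unary_mult) (auto simp: enc_unary_def)

lemma does_print_vertex:
  assumes X: "f 2 \<le> X" "f 7 \<le> X"
  shows "does X x (print_vertex K v) {1, 3, 15} f w f (enc_unary (vval K (f 2) (f 7) v) @ tok_vend)"
proof -
  obtain a p q where v: "v = (a, p, q)" by (cases v) auto
  have "does X x (print_vertex K v) {1, 3, 15} f w f
    (enc_unary (if p then K * f 2 else 0) @ (enc_unary (if q then K * f 7 else 0) @ (enc_unary a @ tok_vend)))"
    unfolding v print_vertex.simps
  proof (rule does_Seq[OF does_rep_out_if])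
    fix f1 assume f1: "\<And>q. q \<notin> {1, 3, 15} \<Longrightarrow> f1 q = f q"
    let ?w = "w @ enc_unary (if p then K * f 2 else 0)"
    have f17: "f1 7 = f 7" using f1 by simp
    show "does X x (Seq (if q then rep_out 7 (enc_unary K) else Skip) (outs (enc_unary a @ tok_vend)))
        {1, 3, 15} f1 ?w f (enc_unary (if q then K * f 7 else 0) @ (enc_unary a @ tok_vend))"
    proof (rule does_Seq)
      show "does X x (if q then rep_out 7 (enc_unary K) else Skip) {1, 3, 15} f1 ?w f1
          (enc_unary (if q then K * f 7 else 0))"
        unfolding f17[symmetric] by (rule does_rep_out_if) (use X f17 in auto)
      fix f2 assume f2: "\<And>q. q \<notin> {1, 3, 15} \<Longrightarrow> f2 q = f1 q"
      show "does X x (outs (enc_unary a @ tok_vend)) {1, 3, 15} f2 (?w @ enc_unary (if q then K * f 7 else 0))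
          f (enc_unary a @ tok_vend)"
        by (rule does_mono[OF does_outs]) (use f1 f2 in auto)
    qed
  qed (use X in auto)
  then show ?thesis unfolding v vval.simps enc_unary_add by simp
qed

lemma does_print_edge:
  assumes X: "f 2 \<le> X" "f 7 \<le> X"
  shows "does X x (print_edge K e) {1, 3, 15} f w f (enc_vertices (map (vval K (f 2) (f 7)) e))"
  using X
proof (induction e arbitrary: f w)
  case Nil
  show ?case unfolding enc_vertices_def by (auto intro: does_mono[OF does_outs])
next
  case (Cons v e)
  have "does X x (Seq (print_vertex K v) (print_edge K e)) {1, 3, 15} f w f
    ((enc_unary (vval K (f 2) (f 7) v) @ tok_vend) @ enc_vertices (map (vval K (f 2) (f 7)) e))"
  proof (rule does_Seq[OF does_print_vertex[OF Cons.prems]])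
    fix f' assume f': "\<And>q. q \<notin> {1, 3, 15} \<Longrightarrow> f' q = f q"
    then have eq: "f' 2 = f 2" "f' 7 = f 7" by auto
    show "does X x (print_edge K e) {1, 3, 15} f' (w @ enc_unary (vval K (f 2) (f 7) v) @ tok_vend)
        f (enc_vertices (map (vval K (f 2) (f 7)) e))"
      using Cons.IH[of f'] Cons.prems f' unfolding eq by (auto intro: does_mono)
  qed
  then show ?case by (simp add: enc_vertices_def)
qed

lemma does_print_edges:
  assumes X: "f 2 \<le> X" "f 7 \<le> X"
  shows "does X x (print_edges K es) {1, 3, 15} f w f (enc_block K (f 2) (f 7) es)"
  using X
proof (induction es arbitrary: f w)
  case Nil
  show ?case unfolding enc_block_def by (auto intro: does_mono[OF does_Skip])
next
  case (Cons e es)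
  have "does X x (Seq (print_edge K e) (print_edges K es)) {1, 3, 15} f w f
    (enc_vertices (map (vval K (f 2) (f 7)) e) @ enc_block K (f 2) (f 7) es)"
  proof (rule does_Seq[OF does_print_edge[OF Cons.prems]])
    fix f' assume f': "\<And>q. q \<notin> {1, 3, 15} \<Longrightarrow> f' q = f q"
    then have eq: "f' 2 = f 2" "f' 7 = f 7" by auto
    show "does X x (print_edges K es) {1, 3, 15} f' (w @ enc_vertices (map (vval K (f 2) (f 7)) e))
        f (enc_block K (f 2) (f 7) es)"
      using Cons.IH[of f'] Cons.prems f' unfolding eq by (auto intro: does_mono)
  qed
  then show ?case by (simp add: enc_block_def)
qed

subsection \<open>The reduction program\<close>

fun enc_blocks :: "nat \<Rightarrow> nat \<Rightarrow> nat \<Rightarrow> svertex list list list \<Rightarrow> bool list" where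
  "enc_blocks K W k [] = []"
| "enc_blocks K W k (es # bs) = enc_block K k W es @ enc_blocks K W (Suc k) bs"

lemma enc_blocks_append: "enc_blocks K W k (bs @ bs') = enc_blocks K W k bs @ enc_blocks K W (k + length bs) bs'"
  by (induction bs arbitrary: k) auto

lemma enc_blocks_concat:
  "enc_blocks K W k (concat (map \<kappa> [0..<m]))
    = concat (map (\<lambda>j. enc_blocks K W (k + length (concat (map \<kappa> [0..<j]))) (\<kappa> j)) [0..<m])"
  by (induction m) (auto simp: enc_blocks_append)

text \<open>\<open>emits c S bs\<close>: the program prints the blocks \<open>bs\<close>, numbering them from the value of register 2
  and advancing that register. The registers in \<open>{4, 5, 6, 7, 9}\<close> hold fixed parameters.\<close>

definition env :: "(nat \<Rightarrow> nat) \<Rightarrow> (nat \<Rightarrow> nat) \<Rightarrow> bool" where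
  "env e f \<longleftrightarrow> (\<forall>q\<in>{4, 5, 6, 7, 9}. f q = e q)"

definition emits :: "nat \<Rightarrow> bool list \<Rightarrow> nat \<Rightarrow> (nat \<Rightarrow> nat) \<Rightarrow> ((nat \<Rightarrow> nat) \<Rightarrow> bool) \<Rightarrow> cmd \<Rightarrow> nat set \<Rightarrow> svertex list list list \<Rightarrow> bool" where
  "emits X x K e Pre c S bs \<longleftrightarrow> (\<forall>f w. env e f \<longrightarrow> Pre f \<longrightarrow> f 2 + length bs \<le> X \<longrightarrow>
     does X x c S f w (f(2 := f 2 + length bs)) (enc_blocks K (e 7) (f 2) bs))"

definition emit :: "nat \<Rightarrow> svertex list list \<Rightarrow> cmd" where
  "emit K es = Seq (print_edges K es) (Inc 2)"

lemma emits_mono: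
  "\<lbrakk>emits X x K e Pre c S bs; \<And>f. Pre' f \<Longrightarrow> Pre f; S \<subseteq> S'\<rbrakk> \<Longrightarrow> emits X x K e Pre' c S' bs"
  unfolding emits_def
proof (intro allI impI)
  fix f w
  assume *: "\<forall>f w. env e f \<longrightarrow> Pre f \<longrightarrow> f 2 + length bs \<le> X \<longrightarrow>
      does X x c S f w (f(2 := f 2 + length bs)) (enc_blocks K (e 7) (f 2) bs)"
    "\<And>f. Pre' f \<Longrightarrow> Pre f" "S \<subseteq> S'" "env e f" "Pre' f" "f 2 + length bs \<le> X"
  then have "does X x c S f w (f(2 := f 2 + length bs)) (enc_blocks K (e 7) (f 2) bs)" by blast
  then show "does X x c S' f w (f(2 := f 2 + length bs)) (enc_blocks K (e 7) (f 2) bs)"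
    by (rule does_mono) (use *(3) in simp_all)
qed

lemma emits_emit:
  assumes "e 7 \<le> X"
  shows "emits X x K e Pre (emit K es) {1, 3, 15} [es]"
  unfolding emits_def
proof (intro allI impI)
  fix f w assume f: "env e f" "Pre f" "f 2 + length [es] \<le> X"
  have f7: "f 7 = e 7" using f(1) unfolding env_def by simp
  have "does X x (emit K es) {1, 3, 15} f w (f(2 := f 2 + length [es])) (enc_block K (f 2) (f 7) es @ [])"
    unfolding emit_def
  proof (rule does_Seq[OF does_print_edges])
    fix f' assume f': "\<And>q. q \<notin> {1, 3, 15} \<Longrightarrow> f' q = f q"
    show "does X x (Inc 2) {1, 3, 15} f' (w @ enc_block K (f 2) (f 7) es) (f(2 := f 2 + length [es])) []"
      by (rule does_mono[OF does_Inc]) (use f' in auto)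
  qed (use f f7 assms in auto)
  then show "does X x (emit K es) {1, 3, 15} f w (f(2 := f 2 + length [es])) (enc_blocks K (e 7) (f 2) [es])"
    unfolding f7 by simp
qed

lemma emits_Seq:
  assumes c: "emits X x K e Pre c S bs" and d: "emits X x K e Pre d S bs'"
    and S: "S \<inter> {2, 4, 5, 6, 7, 9} = {}"
    and Pre: "\<And>f f'. \<lbrakk>Pre f; \<And>q. q \<notin> S \<Longrightarrow> q \<noteq> 2 \<Longrightarrow> f' q = f q\<rbrakk> \<Longrightarrow> Pre f'"
  shows "emits X x K e Pre (Seq c d) S (bs @ bs')"
  unfolding emits_def
proof (intro allI impI)
  fix f w assume f: "env e f" "Pre f" "f 2 + length (bs @ bs') \<le> X"
  show "does X x (Seq c d) S f w (f(2 := f 2 + length (bs @ bs'))) (enc_blocks K (e 7) (f 2) (bs @ bs'))"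
    unfolding enc_blocks_append
  proof (rule does_Seq)
    show "does X x c S f w (f(2 := f 2 + length bs)) (enc_blocks K (e 7) (f 2) bs)"
      using c f unfolding emits_def by simp
    fix f' assume f': "\<And>q. q \<notin> S \<Longrightarrow> f' q = (f(2 := f 2 + length bs)) q"
    have f2: "f' 2 = f 2 + length bs" using f' S by auto
    have "q \<notin> S" if "q \<in> {4, 5, 6, 7, 9}" for q using S that by blast
    then have "env e f'" using f' f(1) unfolding env_def by auto
    moreover have "Pre f'" by (rule Pre[OF f(2)]) (use f' in auto)
    moreover have "f' 2 + length bs' \<le> X" using f(3) f2 by simp
    ultimately have "does X x d S f' (w @ enc_blocks K (e 7) (f 2) bs) (f'(2 := f' 2 + length bs'))
        (enc_blocks K (e 7) (f' 2) bs')"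
      using d unfolding emits_def by blast
    then show "does X x d S f' (w @ enc_blocks K (e 7) (f 2) bs) (f(2 := f 2 + length (bs @ bs')))
        (enc_blocks K (e 7) (f 2 + length bs) bs')"
      unfolding f2 by (rule does_mono) (use f' in auto)
  qed
qed

text \<open>The condition \<open>f i = j\<close> is passed to the body because the blocks printed
  for input bit \<open>j\<close> depend on that bit.\<close>

lemma emits_For:
  assumes body: "\<And>j. j < m \<Longrightarrow> emits X x K e (\<lambda>f. Pre f \<and> f i = j) c (S - {i}) (\<kappa> j)"
    and r: "e r = m" "m \<le> X" "r \<in> {4, 5, 6, 7, 9}"
    and S: "S \<inter> {2, 4, 5, 6, 7, 9} = {}" "i \<in> S"
    and Pre: "\<And>f f'. \<lbrakk>Pre f; \<And>q. q \<notin> S \<Longrightarrow> q \<noteq> 2 \<Longrightarrow> f' q = f q\<rbrakk> \<Longrightarrow> Pre f'"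
  shows "emits X x K e Pre (For i r c) S (concat (map \<kappa> [0..<m]))"
  unfolding emits_def
proof (intro allI impI)
  fix f w assume f: "env e f" "Pre f" "f 2 + length (concat (map \<kappa> [0..<m])) \<le> X"
  let ?l = "\<lambda>j. length (concat (map \<kappa> [0..<j]))"
  have nS: "q \<notin> S" if "q \<in> {4, 5, 6, 7, 9}" for q using S that by blast
  have len: "?l (Suc j) \<le> ?l m" if "j < m" for j
    using that by (induction m) (auto simp: less_Suc_eq)
  have "does X x (For i r c) S f w ((\<lambda>j. f(2 := f 2 + ?l j)) m)
    (concat (map (\<lambda>j. enc_blocks K (e 7) (f 2 + ?l j) (\<kappa> j)) [0..<m]))"
  proof (rule does_For)
    show "f r = m" using f(1) r unfolding env_def by blast
    show "(f(2 := f 2 + ?l j)) r = m" for j using f(1) r unfolding env_def by auto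
    fix j f' w' assume j: "j < m" "f' i = j" and f': "\<And>q. q \<notin> S \<Longrightarrow> f' q = (f(2 := f 2 + ?l j)) q"
    have f2: "f' 2 = f 2 + ?l j" using f' S by auto
    have "env e f'" using f' f(1) nS unfolding env_def by auto
    moreover have "Pre f'" by (rule Pre[OF f(2)]) (use f' in auto)
    moreover have "f' 2 + length (\<kappa> j) \<le> X" using len[OF j(1)] f(3) f2 by simp
    ultimately have "does X x c (S - {i}) f' w' (f'(2 := f' 2 + length (\<kappa> j))) (enc_blocks K (e 7) (f' 2) (\<kappa> j))"
      using body[OF j(1)] j(2) unfolding emits_def by blast
    then show "does X x c (S - {i}) f' w' ((f(2 := f 2 + ?l (Suc j)))(i := j)) (enc_blocks K (e 7) (f 2 + ?l j) (\<kappa> j))"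
      unfolding f2
    proof (rule does_mono)
      fix q assume q: "q \<notin> S - {i}"
      show "(f'(2 := f 2 + ?l j + length (\<kappa> j))) q = ((f(2 := f 2 + ?l (Suc j)))(i := j)) q"
      proof (cases "q = i")
        case True
        then show ?thesis using S j(2) by auto
      next
        case False
        then have "f' q = (f(2 := f 2 + ?l j)) q" using f' q by blast
        then show ?thesis using False by simp
      qed
    qed simp
  qed (use S r nS in auto)
  then show "does X x (For i r c) S f w (f(2 := f 2 + ?l m)) (enc_blocks K (e 7) (f 2) (concat (map \<kappa> [0..<m])))"
    unfolding enc_blocks_concat .
qed

lemma emits_If:
  assumes "\<And>f. Pre f \<Longrightarrow> holds x f r t \<longleftrightarrow> b" and "b \<Longrightarrow> emits X x K e Pre c S bs" "\<not> b \<Longrightarrow> emits X x K e Pre d S bs"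
  shows "emits X x K e Pre (If r t c d) S bs"
  using assms unfolding emits_def by (intro allI impI does_If) blast+

section \<open>Specifications between fixed register contents\<close>

definition spec :: "nat \<Rightarrow> bool list \<Rightarrow> nat set \<Rightarrow> cmd \<Rightarrow> (nat \<Rightarrow> nat) \<Rightarrow> (nat \<Rightarrow> nat) \<Rightarrow> bool list \<Rightarrow> bool" where
  "spec X x S c g g' u \<longleftrightarrow> (\<forall>f w. (\<forall>r. r \<notin> S \<longrightarrow> f r = g r) \<longrightarrow> does X x c S f w g' u)"

lemma spec_Seq: "\<lbrakk>spec X x S c g g' u; spec X x S d g' g'' u'\<rbrakk> \<Longrightarrow> spec X x S (Seq c d) g g'' (u @ u')"
  unfolding spec_def by (intro allI impI does_Seq) blast+

lemma spec_mono:
  assumes "\<And>f w. (\<And>r. r \<notin> S \<Longrightarrow> f r = g r) \<Longrightarrow> does X x c S0 f w (F f) u" and "S0 \<subseteq> S"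
    and "\<And>f r. \<lbrakk>\<And>r. r \<notin> S \<Longrightarrow> f r = g r; r \<notin> S\<rbrakk> \<Longrightarrow> F f r = g' r"
  shows "spec X x S c g g' u"
  unfolding spec_def
proof (intro allI impI)
  fix f w assume *: "\<forall>r. r \<notin> S \<longrightarrow> f r = g r"
  then have "does X x c S0 f w (F f) u" using assms(1) by simp
  then show "does X x c S f w g' u" by (rule does_mono) (use assms(2,3) * in simp_all)
qed

lemma spec_eqI: "\<lbrakk>spec X x S c g g' u; g' = g''\<rbrakk> \<Longrightarrow> spec X x S c g g'' u"
  by simp

text \<open>Register 2 is absent since it carries the cell number from one command to the next.
  Register 1 is present, so that specifications need not mention the length of the output.\<close>

abbreviation scratch :: "nat set" where "scratch \<equiv> {1, 3, 10, 11, 13, 14, 15}"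

lemma spec_add_to:
  assumes "r \<notin> scratch" "d \<notin> scratch" "r \<noteq> d" "g r \<le> X"
  shows "spec X x scratch (add_to 13 r d) g (g(d := g d + g r)) []"
proof (rule spec_mono)
  fix f w assume "\<And>q. q \<notin> scratch \<Longrightarrow> f q = g q"
  then show "does X x (add_to 13 r d) {13} f w (f(d := f d + f r)) []"
    using assms by (intro does_add_to) auto
qed (use assms in auto)

lemma spec_incs:
  assumes "r \<notin> scratch"
  shows "spec X x scratch (incs r m) g (g(r := g r + m)) []"
proof (rule spec_mono)
  show "does X x (incs r m) {15} f w (f(r := f r + m)) []" for f w
    using assms by (intro does_incs) auto
qed (use assms in auto)

lemma spec_poly_cmd:
  assumes "r < 13" "d < 13" "r \<notin> scratch" "d \<notin> scratch" "r \<noteq> d" "g d = 0" "g r \<le> X" "c * g r ^ k + c \<le> X"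
  shows "spec X x scratch (poly_cmd c k r d) g (g(d := c * g r ^ k + c)) []"
proof (rule spec_mono)
  fix f w assume f: "\<And>q. q \<notin> scratch \<Longrightarrow> f q = g q"
  then have "f r = g r" "f d = g d" using assms by auto
  then show "does X x (poly_cmd c k r d) {13, 14, 15} f w (f(d := c * f r ^ k + c)) []"
    using assms by (intro does_poly_cmd) auto
qed (use assms in auto)

lemma spec_outs: "spec X x scratch (outs bs) g g bs"
  by (rule spec_mono[where F = "\<lambda>f. f" and ?S0.0 = "{1, 15}"], rule does_outs) auto

lemma spec_length:
  assumes "length x \<le> X" "g 4 = 0"
  shows "spec X x scratch (While 4 NonBlank (Inc 4)) g (g(4 := length x)) []"
  by (rule spec_mono[where F = "\<lambda>f. f(4 := length x)" and ?S0.0 = "{}"])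
    (use assms in \<open>auto intro!: does_While_length\<close>)

lemma spec_rep_out:
  assumes "r \<notin> scratch" "g r = m" "m \<le> X"
  shows "spec X x scratch (rep_out r bs) g g (concat (replicate m bs))"
proof (rule spec_mono[where F = "\<lambda>f. f" and ?S0.0 = "{1, 3, 15}"])
  fix f w assume "\<And>q. q \<notin> scratch \<Longrightarrow> f q = g q"
  then have "f r = m" using assms by simp
  then show "does X x (rep_out r bs) {1, 3, 15} f w f (concat (replicate m bs))"
    using does_rep_out[of r f X x bs w] assms by auto
qed auto

lemma spec_print_edges:
  assumes "g 2 \<le> X" "g 7 \<le> X"
  shows "spec X x scratch (print_edges K es) g g (enc_block K (g 2) (g 7) es)"
proof (rule spec_mono[where F = "\<lambda>f. f" and ?S0.0 = "{1, 3, 15}"])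
  fix f w assume "\<And>q. q \<notin> scratch \<Longrightarrow> f q = g q"
  then have "f 2 = g 2" "f 7 = g 7" by auto
  then show "does X x (print_edges K es) {1, 3, 15} f w f (enc_block K (g 2) (g 7) es)"
    using does_print_edges[of f X x K es w] assms by auto
qed auto

lemma spec_emits:
  assumes "emits X x K e (\<lambda>_. True) c S bs" "S \<subseteq> scratch" "env e g" "g 2 + length bs \<le> X"
  shows "spec X x scratch c g (g(2 := g 2 + length bs)) (enc_blocks K (e 7) (g 2) bs)"
proof (rule spec_mono[where F = "\<lambda>f. f(2 := f 2 + length bs)" and ?S0.0 = S])
  fix f w assume f: "\<And>q. q \<notin> scratch \<Longrightarrow> f q = g q"
  have "env e f" using assms(3) f unfolding env_def by auto
  moreover have "f 2 = g 2" using f by simp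
  ultimately show "does X x c S f w (f(2 := f 2 + length bs)) (enc_blocks K (e 7) (g 2) bs)"
    using assms(1,4) unfolding emits_def by metis
qed (use assms in auto)

section \<open>The printed string and the program that prints it\<close>

locale reduction_params =
  fixes c1 k1 c2 k2 :: nat
    and K a0 :: nat and kd :: "nat \<Rightarrow> svertex list list" and blue0 red0 red :: "svertex list list"
begin

text \<open>The parameters depend on the length of the input: the maximal length of a witness, the length of the
  simulated input, the number of simulated steps, the number of blank cells to the left of
  the input, the width of a row, and the number of cells.\<close>

definition wit_len :: "nat \<Rightarrow> nat" where "wit_len n = c1 * n ^ k1 + c1"
definition inp_len :: "nat \<Rightarrow> nat" where "inp_len n = 2 * n + 2 + wit_len n"
definition steps :: "nat \<Rightarrow> nat" where "steps n = c2 * inp_len n ^ k2 + c2"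
definition margin :: "nat \<Rightarrow> nat" where "margin n = 2 * steps n + 4"
definition width :: "nat \<Rightarrow> nat" where "width n = margin n + inp_len n + 2"
definition cells :: "nat \<Rightarrow> nat" where "cells n = (steps n + 2) * width n"

text \<open>The first row consists of blank cells, the initial head, the image of \<open>x\<close>
  under \<open>pair_enc\<close> (a \<open>False\<close> before each bit and
  \<open>True, True\<close> at the end), the free witness cells and one blank. Inner rows only
  propagate, and the last row only tests the state.\<close>

definition blocks :: "bool list \<Rightarrow> svertex list list list" where
  "blocks x = concat (map (\<lambda>_. [kd 0]) [0..<margin (length x)]) @ [kd 1] @
     concat (map (\<lambda>j. [kd 2] @ (if x ! j then [kd 3] else [kd 2])) [0..<length x]) @ [kd 3] @ [kd 3] @
     concat (map (\<lambda>_. [kd 4]) [0..<wit_len (length x)]) @ [kd 0] @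
     concat (map (\<lambda>_. concat (map (\<lambda>_. [kd 5]) [0..<width (length x)])) [0..<steps (length x)]) @
     concat (map (\<lambda>_. [kd 6]) [0..<width (length x)])"

text \<open>\<open>red0\<close> is taken at cell number \<open>N\<close> because this is the content
  of register 2 once all blue blocks have been printed.\<close>

definition reduction_string :: "bool list \<Rightarrow> bool list" where
  "reduction_string x = (let N = cells (length x); W = width (length x) in
     (enc_unary a0 @ enc_unary (K * N) @ tok_eend) @ enc_block K 0 W blue0 @ enc_blocks K W 0 (blocks x) @
     tok_sep @ enc_block K N W red0 @ concat (map (\<lambda>k. enc_block K k W red) [0..<N]))"

definition setup_prog :: cmd where
  "setup_prog = Seq (While 4 NonBlank (Inc 4)) (Seq (poly_cmd c1 k1 4 5)
     (Seq (add_to 13 4 12) (Seq (add_to 13 4 12) (Seq (add_to 13 5 12) (Seq (incs 12 2)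
     (Seq (poly_cmd c2 k2 12 6) (Seq (add_to 13 6 9) (Seq (add_to 13 6 9) (Seq (incs 9 4)
     (Seq (add_to 13 9 7) (Seq (add_to 13 12 7) (Seq (incs 7 2)
     (Seq (add_to 13 7 8) (Seq (add_to 13 7 8) (For 14 6 (add_to 13 7 8))))))))))))))))"

definition blue_prog :: cmd where
  "blue_prog = Seq (For 10 9 (emit K (kd 0))) (Seq (emit K (kd 1))
     (Seq (For 10 4 (Seq (emit K (kd 2)) (If 10 IsTrue (emit K (kd 3)) (emit K (kd 2)))))
     (Seq (emit K (kd 3)) (Seq (emit K (kd 3)) (Seq (For 10 5 (emit K (kd 4))) (Seq (emit K (kd 0))
     (Seq (For 10 6 (For 11 7 (emit K (kd 5)))) (For 10 7 (emit K (kd 6))))))))))"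

text \<open>The encoding lists all blue edges before the red ones, so the cells are traversed twice.
  The second traversal resets register 2 and counts with it.\<close>

definition main_prog :: cmd where
  "main_prog = Seq (Seq setup_prog (Seq (Seq (outs (enc_unary a0)) (Seq (rep_out 8 (enc_unary K)) (outs tok_eend)))
     (Seq (print_edges K blue0) (Seq blue_prog (Seq (outs tok_sep) (print_edges K red0))))))
     (For 2 8 (print_edges K red))"

definition params :: "nat \<Rightarrow> nat \<Rightarrow> nat" where
  "params n = (\<lambda>_. 0)(4 := n, 5 := wit_len n, 12 := inp_len n, 6 := steps n, 9 := margin n, 7 := width n, 8 := cells n)"

text \<open>\<open>cells n\<close> dominates all other parameters and can therefore serve as the
  single bound \<open>X\<close> for every loop.\<close>

lemma param_bounds:
  "n \<le> cells n" "wit_len n \<le> cells n" "inp_len n \<le> cells n" "steps n \<le> cells n"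
  "margin n \<le> cells n" "width n \<le> cells n"
proof -
  have "width n \<le> cells n" unfolding cells_def by simp
  moreover have "n \<le> width n" "wit_len n \<le> width n" "inp_len n \<le> width n" "steps n \<le> width n" "margin n \<le> width n"
    unfolding width_def margin_def inp_len_def by auto
  ultimately show "n \<le> cells n" "wit_len n \<le> cells n" "inp_len n \<le> cells n" "steps n \<le> cells n"
    "margin n \<le> cells n" "width n \<le> cells n" by linarith+
qed

lemma length_const_blocks: "length (concat (map (\<lambda>_. bs) [0..<m])) = m * length bs"
  by (induction m) auto

lemma length_blocks: "length (blocks x) = cells (length x)"
proof -
  have "length (concat (map (\<lambda>j. [kd 2] @ (if x ! j then [kd 3] else [kd 2])) [0..<m])) = 2 * m" for m
    by (induction m) auto
  then show ?thesis
    unfolding blocks_def length_append length_const_blocks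
    by (simp add: cells_def width_def inp_len_def algebra_simps)
qed

lemma spec_setup:
  assumes "length x = n" "X = cells n"
  shows "spec X x scratch setup_prog (\<lambda>_. 0) (params n) []"
proof -
  note b = param_bounds[of n]
  have loop: "spec X x scratch (For 14 6 (add_to 13 7 8)) g (g(8 := g 8 + g 6 * g 7)) []"
    if "g 6 \<le> X" "g 7 \<le> X" for g
  proof (rule spec_mono[where F = "\<lambda>f. f(8 := f 8 + f 6 * f 7)" and ?S0.0 = "{13, 14}"])
    fix f w assume f: "\<And>q. q \<notin> scratch \<Longrightarrow> f q = g q"
    have "does X x (For 14 6 (add_to 13 7 8)) {13, 14} f w ((\<lambda>j. f(8 := f 8 + j * f 7)) (f 6))
        (concat (map (\<lambda>_. []) [0..<f 6]))"
    proof (rule does_For)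
      show "f 6 \<le> X" using f that by simp
      fix j f' w' assume "j < f 6" "f' 14 = j" and f': "\<And>q. q \<notin> {13, 14} \<Longrightarrow> f' q = (f(8 := f 8 + j * f 7)) q"
      have "f' 7 = f 7" "f 7 = g 7" using f f' by auto
      then show "does X x (add_to 13 7 8) ({13, 14} - {14}) f' w' ((f(8 := f 8 + Suc j * f 7))(14 := j)) []"
        using f' that \<open>f' 14 = j\<close> by (intro does_mono[OF does_add_to]) auto
    qed auto
    then show "does X x (For 14 6 (add_to 13 7 8)) {13, 14} f w (f(8 := f 8 + f 6 * f 7)) []"
      by (simp add: concat_map_Nil)
  qed auto
  \<comment> \<open>With the computed registers as arguments, each command changes one argument, and
    the whole chain reduces to arithmetic.\<close>
  define st where "st n p q t h v m = (\<lambda>_ :: nat. 0)(4 := n, 5 := p, 12 := q, 6 := t, 9 := h, 7 := v, 8 := m)"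
    for n p q t h v m :: nat
  define p q t h v where "p = wit_len n" "q = inp_len n" "t = steps n" "h = margin n" "v = width n"
  note eqs = p_q_t_h_v_def(1) wit_len_def inp_len_def steps_def margin_def width_def
  have le: "n \<le> X" "p \<le> X" "q \<le> X" "t \<le> X" "h \<le> X" "v \<le> X"
    using b assms unfolding p_q_t_h_v_def by auto
  have val: "c1 * n ^ k1 + c1 = p" "n + n + p + 2 = q" "c2 * q ^ k2 + c2 = t" "t + t + 4 = h" "h + q + 2 = v"
    "v + v + t * v = cells n"
    unfolding p_q_t_h_v_def wit_len_def inp_len_def steps_def margin_def width_def cells_def
    by (simp_all add: algebra_simps)
  have s1: "spec X x scratch (While 4 NonBlank (Inc 4)) (st 0 0 0 0 0 0 0) (st n 0 0 0 0 0 0) []"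
    by (rule spec_eqI[OF spec_length]) (use le val assms(1) in \<open>auto simp: st_def fun_eq_iff\<close>)
  have s2: "spec X x scratch (poly_cmd c1 k1 4 5) (st n 0 0 0 0 0 0) (st n p 0 0 0 0 0) []"
    by (rule spec_eqI[OF spec_poly_cmd]) (use le val assms(1) in \<open>auto simp: st_def fun_eq_iff\<close>)
  have s3: "spec X x scratch (add_to 13 4 12) (st n p 0 0 0 0 0) (st n p n 0 0 0 0) []"
    by (rule spec_eqI[OF spec_add_to]) (use le val assms(1) in \<open>auto simp: st_def fun_eq_iff\<close>)
  have s4: "spec X x scratch (add_to 13 4 12) (st n p n 0 0 0 0) (st n p (n + n) 0 0 0 0) []"
    by (rule spec_eqI[OF spec_add_to]) (use le val assms(1) in \<open>auto simp: st_def fun_eq_iff\<close>)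
  have s5: "spec X x scratch (add_to 13 5 12) (st n p (n + n) 0 0 0 0) (st n p (n + n + p) 0 0 0 0) []"
    by (rule spec_eqI[OF spec_add_to]) (use le val assms(1) in \<open>auto simp: st_def fun_eq_iff\<close>)
  have s6: "spec X x scratch (incs 12 2) (st n p (n + n + p) 0 0 0 0) (st n p q 0 0 0 0) []"
    by (rule spec_eqI[OF spec_incs]) (use le val assms(1) in \<open>auto simp: st_def fun_eq_iff\<close>)
  have s7: "spec X x scratch (poly_cmd c2 k2 12 6) (st n p q 0 0 0 0) (st n p q t 0 0 0) []"
    by (rule spec_eqI[OF spec_poly_cmd]) (use le val assms(1) in \<open>auto simp: st_def fun_eq_iff\<close>)
  have s8: "spec X x scratch (add_to 13 6 9) (st n p q t 0 0 0) (st n p q t t 0 0) []"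
    by (rule spec_eqI[OF spec_add_to]) (use le val assms(1) in \<open>auto simp: st_def fun_eq_iff\<close>)
  have s9: "spec X x scratch (add_to 13 6 9) (st n p q t t 0 0) (st n p q t (t + t) 0 0) []"
    by (rule spec_eqI[OF spec_add_to]) (use le val assms(1) in \<open>auto simp: st_def fun_eq_iff\<close>)
  have s10: "spec X x scratch (incs 9 4) (st n p q t (t + t) 0 0) (st n p q t h 0 0) []"
    by (rule spec_eqI[OF spec_incs]) (use le val assms(1) in \<open>auto simp: st_def fun_eq_iff\<close>)
  have s11: "spec X x scratch (add_to 13 9 7) (st n p q t h 0 0) (st n p q t h h 0) []"
    by (rule spec_eqI[OF spec_add_to]) (use le val assms(1) in \<open>auto simp: st_def fun_eq_iff\<close>)
  have s12: "spec X x scratch (add_to 13 12 7) (st n p q t h h 0) (st n p q t h (h + q) 0) []"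
    by (rule spec_eqI[OF spec_add_to]) (use le val assms(1) in \<open>auto simp: st_def fun_eq_iff\<close>)
  have s13: "spec X x scratch (incs 7 2) (st n p q t h (h + q) 0) (st n p q t h v 0) []"
    by (rule spec_eqI[OF spec_incs]) (use le val assms(1) in \<open>auto simp: st_def fun_eq_iff\<close>)
  have s14: "spec X x scratch (add_to 13 7 8) (st n p q t h v 0) (st n p q t h v v) []"
    by (rule spec_eqI[OF spec_add_to]) (use le val assms(1) in \<open>auto simp: st_def fun_eq_iff\<close>)
  have s15: "spec X x scratch (add_to 13 7 8) (st n p q t h v v) (st n p q t h v (v + v)) []"
    by (rule spec_eqI[OF spec_add_to]) (use le val assms(1) in \<open>auto simp: st_def fun_eq_iff\<close>)
  have s16: "spec X x scratch (For 14 6 (add_to 13 7 8)) (st n p q t h v (v + v)) (st n p q t h v (cells n)) []"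
    by (rule spec_eqI[OF loop]) (use le val assms(1) in \<open>auto simp: st_def fun_eq_iff\<close>)
  have "st 0 0 0 0 0 0 0 = (\<lambda>_. 0)" "st n p q t h v (cells n) = params n"
    unfolding st_def params_def p_q_t_h_v_def by auto
  with spec_Seq[OF s1 spec_Seq[OF s2 spec_Seq[OF s3 spec_Seq[OF s4 spec_Seq[OF s5 spec_Seq[OF s6 spec_Seq[OF s7 spec_Seq[OF s8 spec_Seq[OF s9 spec_Seq[OF s10 spec_Seq[OF s11 spec_Seq[OF s12 spec_Seq[OF s13 spec_Seq[OF s14 spec_Seq[OF s15 s16]]]]]]]]]]]]]]]
  show ?thesis unfolding setup_prog_def by simp
qed

lemma emits_blue_prog:
  assumes "length x = n" "X = cells n"
  shows "emits X x K (params n) (\<lambda>_. True) blue_prog {1, 3, 10, 11, 15} (blocks x)"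
proof -
  let ?e = "params n" and ?S = "{1, 3, 10, 11, 15} :: nat set" and ?T = "\<lambda>_. True"
  note b = param_bounds[of n]
  have e: "?e 4 = n" "?e 5 = wit_len n" "?e 6 = steps n" "?e 7 = width n" "?e 9 = margin n"
    unfolding params_def by simp_all
  have e7: "?e 7 \<le> X" using b e assms by simp
  have em: "emits X x K ?e Pre (emit K (kd i)) S [kd i]" if "{1, 3, 15} \<subseteq> S" for Pre S i
    by (rule emits_mono[OF emits_emit[where Pre = Pre and e = "params n" and X = X, OF e7]]) (use that in simp_all)
  have loop: "emits X x K ?e ?T (For 10 r (emit K (kd i))) ?S (concat (map (\<lambda>_. [kd i]) [0..<m]))"
    if "?e r = m" "m \<le> X" "r \<in> {4, 5, 6, 7, 9}" for r m i
    by (rule emits_For) (use that in \<open>auto intro!: em\<close>)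
  have bit: "emits X x K ?e (\<lambda>f. True \<and> f 10 = j) (Seq (emit K (kd 2)) (If 10 IsTrue (emit K (kd 3)) (emit K (kd 2))))
      (?S - {10}) ([kd 2] @ (if x ! j then [kd 3] else [kd 2]))" if "j < n" for j
  proof (rule emits_Seq)
    show "emits X x K ?e (\<lambda>f. True \<and> f 10 = j) (emit K (kd 2)) (?S - {10}) [kd 2]"
      by (rule em) auto
    show "emits X x K ?e (\<lambda>f. True \<and> f 10 = j) (If 10 IsTrue (emit K (kd 3)) (emit K (kd 2)))
        (?S - {10}) (if x ! j then [kd 3] else [kd 2])"
    proof (rule emits_If)
      show "holds x f 10 IsTrue \<longleftrightarrow> x ! j" if "True \<and> f 10 = j" for f
        using that \<open>j < n\<close> assms by (auto simp: insym_def bit_sym_def)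
    qed (auto intro!: em)
  qed auto
  have bits: "emits X x K ?e ?T (For 10 4 (Seq (emit K (kd 2)) (If 10 IsTrue (emit K (kd 3)) (emit K (kd 2))))) ?S
      (concat (map (\<lambda>j. [kd 2] @ (if x ! j then [kd 3] else [kd 2])) [0..<n]))"
    by (rule emits_For) (use bit e b assms in simp_all)
  have rows: "emits X x K ?e ?T (For 10 6 (For 11 7 (emit K (kd 5)))) ?S
      (concat (map (\<lambda>_. concat (map (\<lambda>_. [kd 5]) [0..<width n])) [0..<steps n]))"
  proof (rule emits_For)
    show "emits X x K ?e (\<lambda>f. True \<and> f 10 = j) (For 11 7 (emit K (kd 5))) (?S - {10})
        (concat (map (\<lambda>_. [kd 5]) [0..<width n]))" for j
    proof (rule emits_mono)
      show "emits X x K ?e ?T (For 11 7 (emit K (kd 5))) {1, 3, 11, 15} (concat (map (\<lambda>_. [kd 5]) [0..<width n]))"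
      proof (rule emits_For)
        show "emits X x K ?e (\<lambda>f. True \<and> f 11 = j) (emit K (kd 5)) ({1, 3, 11, 15} - {11}) [kd 5]" for j
          by (rule em) auto
      qed (use e b assms in simp_all)
    qed auto
  qed (use e b assms in simp_all)
  have S: "?S \<inter> {2, 4, 5, 6, 7, 9} = {}" by simp
  show ?thesis
    unfolding blue_prog_def blocks_def assms(1)
    by (intro emits_Seq[OF _ _ S TrueI] loop bits rows em) (use e b assms in auto)
qed

lemma spec_blue_prog:
  assumes "length x = n" "X = cells n"
  shows "spec X x scratch blue_prog (params n) ((params n)(2 := cells n)) (enc_blocks K (width n) 0 (blocks x))"
proof -
  have p2: "params n 2 = 0" "params n 7 = width n" unfolding params_def by simp_all
  have "spec X x scratch blue_prog (params n) ((params n)(2 := params n 2 + length (blocks x)))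
      (enc_blocks K (params n 7) (params n 2) (blocks x))"
    by (rule spec_emits[OF emits_blue_prog[OF assms]]) (use assms p2 length_blocks[of x] in \<open>auto simp: env_def\<close>)
  then show ?thesis using p2 length_blocks[of x] assms by simp
qed

text \<open>In the last loop register 2 is a counter and no longer a tracked register, so this loop
  is composed by hand with the part covered by \<open>spec\<close>.\<close>

lemma does_main_prog:
  "\<exists>g. does (cells (length x)) x main_prog (insert 2 scratch) (\<lambda>_. 0) [] g (reduction_string x)"
proof -
  define n where "n = length x"
  define X where "X = cells n"
  let ?g = "params n" and ?g' = "(params n)(2 := cells n)"
  have len: "length x = n" by (simp add: n_def)
  note b = param_bounds[of n]
  have p: "?g 2 = 0" "?g 7 = width n" "?g 8 = cells n" unfolding params_def by simp_all
  have s1: "spec X x scratch (Seq (outs (enc_unary a0)) (Seq (rep_out 8 (enc_unary K)) (outs tok_eend))) ?g ?g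
      (enc_unary a0 @ concat (replicate (cells n) (enc_unary K)) @ tok_eend)"
    by (rule spec_Seq[OF spec_outs spec_Seq[OF spec_rep_out spec_outs]]) (use p X_def in simp_all)
  have s2: "spec X x scratch (print_edges K blue0) ?g ?g (enc_block K (?g 2) (?g 7) blue0)"
    by (rule spec_print_edges) (use p X_def b in auto)
  have s3: "spec X x scratch (Seq (outs tok_sep) (print_edges K red0)) ?g' ?g'
      (tok_sep @ enc_block K (?g' 2) (?g' 7) red0)"
    by (rule spec_Seq[OF spec_outs spec_print_edges]) (use p X_def b in simp_all)
  let ?pre = "Seq setup_prog (Seq (Seq (outs (enc_unary a0)) (Seq (rep_out 8 (enc_unary K)) (outs tok_eend)))
     (Seq (print_edges K blue0) (Seq blue_prog (Seq (outs tok_sep) (print_edges K red0)))))"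
  let ?u = "[] @ (enc_unary a0 @ concat (replicate (cells n) (enc_unary K)) @ tok_eend) @
      enc_block K (?g 2) (?g 7) blue0 @ enc_blocks K (width n) 0 (blocks x) @ (tok_sep @ enc_block K (?g' 2) (?g' 7) red0)"
  have "spec X x scratch ?pre (\<lambda>_. 0) ?g' ?u"
    by (rule spec_Seq[OF spec_setup[OF len X_def]
          spec_Seq[OF s1 spec_Seq[OF s2 spec_Seq[OF spec_blue_prog[OF len X_def] s3]]]])
  then have "does X x ?pre scratch (\<lambda>_. 0) [] ?g' ?u" unfolding spec_def by simp
  then obtain f where f: "runs X x ?pre (\<lambda>_. 0, []) (f, ?u)" "\<And>r. r \<notin> scratch \<Longrightarrow> f r = ?g' r"
    unfolding does_def by auto
  have f78: "f 7 = width n" "f 8 = cells n" using f(2) p by simp_all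
  have "does X x (For 2 8 (print_edges K red)) (insert 2 scratch) f ?u ((\<lambda>_. f) (f 8))
      (concat (map (\<lambda>k. enc_block K k (width n) red) [0..<f 8]))"
  proof (rule does_For)
    fix j f' w' assume j: "j < f 8" "f' 2 = j" and f': "\<And>q. q \<notin> insert 2 scratch \<Longrightarrow> f' q = f q"
    have "f' 7 = width n" using f' f78 by simp
    then have "does X x (print_edges K red) {1, 3, 15} f' w' f' (enc_block K j (width n) red)"
      using does_print_edges[of f' X x K red w'] j f78 b X_def by simp
    then show "does X x (print_edges K red) (insert 2 scratch - {2}) f' w' (f(2 := j)) (enc_block K j (width n) red)"
      by (rule does_mono) (use f' j in auto)
  qed (use f78 X_def in auto)
  then obtain f' where "runs X x (For 2 8 (print_edges K red)) (f, ?u)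
      (f', ?u @ concat (map (\<lambda>k. enc_block K k (width n) red) [0..<f 8]))"
    unfolding does_def by blast
  from runs_Seq[OF f(1) this] have "runs X x main_prog (\<lambda>_. 0, []) (f', reduction_string x)"
    unfolding main_prog_def reduction_string_def Let_def n_def[symmetric] f78 p fun_upd_apply
    by (simp add: p enc_unary_mult)
  then show ?thesis unfolding does_def X_def n_def by (intro exI[of _ f'] exI[of _ f']) simp
qed

end

section \<open>Polynomial running time of the reduction\<close>

definition polyb :: "(nat \<Rightarrow> nat) \<Rightarrow> bool" where
  "polyb f \<longleftrightarrow> (\<exists>c k. \<forall>n. f n \<le> c * n ^ k + c)"

lemma polyb_const: "polyb (\<lambda>_. a)"
  unfolding polyb_def by (rule exI[of _ a]) simp

lemma polyb_id: "polyb (\<lambda>n. n)"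
  unfolding polyb_def by (rule exI[of _ 1], rule exI[of _ 1]) simp

text \<open>The summand 1 accounts for \<open>n = 0\<close> and \<open>k = 0\<close>, where the left
  side is 1 and the power on the right may vanish.\<close>

lemma power_le_power_add: "(n :: nat) ^ k \<le> n ^ (k + l) + 1"
  by (cases "n = 0") (simp_all add: power_0_left power_increasing le_SucI)

lemma polyb_add:
  assumes "polyb f" "polyb g"
  shows "polyb (\<lambda>n. f n + g n)"
proof -
  obtain c k d l where f: "\<And>n. f n \<le> c * n ^ k + c" and g: "\<And>n. g n \<le> d * n ^ l + d"
    using assms unfolding polyb_def by blast
  have "f n + g n \<le> (2 * c + 2 * d) * n ^ (k + l) + (2 * c + 2 * d)" for n
  proof -
    have "n ^ k \<le> n ^ (k + l) + 1" "n ^ l \<le> n ^ (k + l) + 1"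
      using power_le_power_add[of n k l] power_le_power_add[of n l k] by (simp_all only: add.commute)
    from this[THEN mult_le_mono2] have "c * n ^ k \<le> c * (n ^ (k + l) + 1)" "d * n ^ l \<le> d * (n ^ (k + l) + 1)"
      by blast+
    then have "f n + g n \<le> c * (n ^ (k + l) + 1) + c + (d * (n ^ (k + l) + 1) + d)"
      using f[of n] g[of n] by linarith
    also have "\<dots> \<le> (2 * c + 2 * d) * n ^ (k + l) + (2 * c + 2 * d)" by (simp add: algebra_simps)
    finally show ?thesis .
  qed
  then show ?thesis unfolding polyb_def by blast
qed

lemma polyb_mult:
  assumes "polyb f" "polyb g"
  shows "polyb (\<lambda>n. f n * g n)"
proof -
  obtain c k d l where f: "\<And>n. f n \<le> c * n ^ k + c" and g: "\<And>n. g n \<le> d * n ^ l + d"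
    using assms unfolding polyb_def by blast
  have "f n * g n \<le> (4 * c * d) * n ^ (k + l) + 4 * c * d" for n
  proof -
    have "f n * g n \<le> (c * n ^ k + c) * (d * n ^ l + d)"
      by (rule mult_le_mono[OF f g])
    also have "\<dots> = c * d * (n ^ (k + l) + n ^ k + n ^ l + 1)"
      by (simp add: algebra_simps power_add)
    also have "\<dots> \<le> c * d * (4 * n ^ (k + l) + 4)"
      using power_le_power_add[of n k l] power_le_power_add[of n l k]
      by (intro mult_le_mono2) (simp add: add.commute)
    finally show ?thesis by (simp add: algebra_simps)
  qed
  then show ?thesis unfolding polyb_def by blast
qed

lemma polyb_power: "polyb f \<Longrightarrow> polyb (\<lambda>n. f n ^ k)"
  by (induction k) (simp_all add: polyb_const polyb_mult)

lemma polyb_Suc: "polyb f \<Longrightarrow> polyb (\<lambda>n. Suc (f n))"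
  using polyb_add[OF _ polyb_const[of 1]] by simp

lemmas polyb_intros = polyb_const polyb_id polyb_add polyb_mult polyb_power polyb_Suc

text \<open>For a fixed program, \<open>tb\<close> is a polynomial in the loop bound whose degree is
  at most the nesting depth of the loops.\<close>

lemma polyb_tb: "polyb g \<Longrightarrow> polyb (\<lambda>n. tb (g n) c)"
  by (induction c) (auto intro!: polyb_intros)

lemma cmd_ok_Skip: "cmd_ok 16 Skip"
  unfolding Skip_def by simp

lemma cmd_ok_incs: "\<lbrakk>2 \<le> r; r < 16\<rbrakk> \<Longrightarrow> cmd_ok 16 (incs r m)"
  by (induction m) (auto simp: cmd_ok_Skip)

lemma cmd_ok_outs: "cmd_ok 16 (outs bs)"
  by (induction bs) (auto simp: cmd_ok_Skip)

lemma cmd_ok_mults: "\<lbrakk>2 \<le> r; r < 16; 2 \<le> d; d < 16\<rbrakk> \<Longrightarrow> cmd_ok 16 (mults r d k)"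
  by (induction k) (auto simp: cmd_ok_Skip mult_def For_def add_to_def)

lemma cmd_ok_print_edge: "cmd_ok 16 (print_edge K e)"
  by (induction e) (auto simp: cmd_ok_outs cmd_ok_Skip rep_out_def For_def)

lemma cmd_ok_print_edges: "cmd_ok 16 (print_edges K es)"
  by (induction es) (auto simp: cmd_ok_print_edge cmd_ok_Skip)

lemma halted_stays:
  assumes "halted (tm_run M t x)" "t \<le> t'"
  shows "tm_run M t' x = tm_run M t x"
proof -
  have "tm_run M (t + d) x = tm_run M t x" for d
  proof (induction d)
    case (Suc d)
    have "tm_run M (t + Suc d) x = tm_step M (tm_run M (t + d) x)" by (simp add: tm_run_def)
    also have "\<dots> = tm_run M t x"
      unfolding Suc using assms(1) by (cases M; cases "tm_run M t x") (auto simp: tm_step_def halted_def)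
    finally show ?case .
  qed simp
  from this[of "t' - t"] show ?thesis using assms(2) by simp
qed

context reduction_params
begin

lemma polyb_cells: "polyb cells"
proof -
  have wit: "polyb wit_len" unfolding wit_len_def[abs_def] by (intro polyb_intros)
  have inp: "polyb inp_len" unfolding inp_len_def[abs_def] by (intro polyb_intros wit)
  have steps: "polyb steps" unfolding steps_def[abs_def] by (intro polyb_intros inp)
  have margin: "polyb margin" unfolding margin_def[abs_def] by (intro polyb_intros steps)
  have width: "polyb width" unfolding width_def[abs_def] by (intro polyb_intros margin inp)
  show ?thesis unfolding cells_def[abs_def] by (intro polyb_intros steps width)
qed

theorem reduction_machine:
  "\<exists>M c k. wf_tm M \<and> (\<forall>x. halted (tm_run M (c * length x ^ k + c) x) \<and>
     tape_output (tm_run M (c * length x ^ k + c) x) (reduction_string x))"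
proof -
  have ok: "cmd_ok 16 main_prog"
    unfolding main_prog_def setup_prog_def blue_prog_def emit_def poly_cmd_def For_def add_to_def rep_out_def
    by (simp add: cmd_ok_incs cmd_ok_mults cmd_ok_outs cmd_ok_print_edges)
  obtain M where M: "wf_tm M" and sim: "\<And>x n f w. (rstep x ^^ n) ([main_prog], \<lambda>_. 0, []) = ([], f, w) \<Longrightarrow>
      \<exists>t \<le> 2 * n * n + 5 * n + 2. halted (tm_run M t x) \<and> tape_output (tm_run M t x) w"
    by (rule tm_of_program[OF _ ok]) (simp, blast)
  let ?T = "\<lambda>n. tb (cells n) main_prog"
  have "polyb (\<lambda>n. 2 * ?T n * ?T n + 5 * ?T n + 2)"
    by (intro polyb_intros polyb_tb polyb_cells)
  then obtain c k where ck: "\<And>n. 2 * ?T n * ?T n + 5 * ?T n + 2 \<le> c * n ^ k + c"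
    unfolding polyb_def by blast
  have "halted (tm_run M (c * length x ^ k + c) x) \<and>
     tape_output (tm_run M (c * length x ^ k + c) x) (reduction_string x)" for x
  proof -
    obtain g where "does (cells (length x)) x main_prog (insert 2 scratch) (\<lambda>_. 0) [] g (reduction_string x)"
      using does_main_prog by blast
    then obtain f n where n: "n \<le> ?T (length x)"
      "(rstep x ^^ n) ([main_prog], \<lambda>_. 0, []) = ([], f, reduction_string x)"
      unfolding does_def runs_def by auto
    obtain t where t: "t \<le> 2 * n * n + 5 * n + 2" "halted (tm_run M t x)" "tape_output (tm_run M t x) (reduction_string x)"
      using sim[OF n(2)] by blast
    have "2 * n * n + 5 * n + 2 \<le> 2 * ?T (length x) * ?T (length x) + 5 * ?T (length x) + 2"
      using n(1) by (intro add_mono mult_mono) auto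
    then have "t \<le> c * length x ^ k + c" using ck[of "length x"] t(1) by linarith
    then have eq: "tm_run M (c * length x ^ k + c) x = tm_run M t x" by (rule halted_stays[OF t(2)])
    show ?thesis unfolding eq using t(2,3) by simp
  qed
  then show ?thesis using M by blast
qed

end

subsection \<open>The computation tableau\<close>

type_synonym slit = "nat \<times> bool \<times> nat \<times> bool"

locale verifier =
  fixes Q G :: nat and \<delta> :: "nat \<Rightarrow> nat \<Rightarrow> nat \<times> nat \<times> int" and c1 k1 c2 k2 :: nat
  assumes wf: "wf_tm (Q, G, \<delta>)"
begin

abbreviation "M \<equiv> (Q, G, \<delta>)"

lemma QG: "3 \<le> Q" "3 \<le> G"
  using wf unfolding wf_tm_def by auto

text \<open>The additional state \<open>Q\<close> moves the head from cell \<open>-1\<close> onto the input, so that the first row of the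
  tableau does not depend on the first input symbol. A tableau entry \<open>a + G * h\<close> stands for the tape symbol \<open>a\<close>,
  scanned in state \<open>h - 1\<close> unless \<open>h = 0\<close>.\<close>

definition \<delta>' :: "nat \<Rightarrow> nat \<Rightarrow> nat \<times> nat \<times> int" where
  "\<delta>' q a = (if q = 1 \<or> q = 2 then (q, a, 0) else if q = Q then (0, a, 1) else \<delta> q a)"

definition step' :: "config \<Rightarrow> config" where
  "step' c = (case c of (q, tp, h) \<Rightarrow> case \<delta>' q (tp h) of (q', a', d) \<Rightarrow> (q', tp(h := a'), h + d))"

definition cfg :: "bool list \<Rightarrow> nat \<Rightarrow> config" where
  "cfg y t = (step' ^^ t) (Q, fst (snd (init_config y)), -1)"

definition entry :: "config \<Rightarrow> int \<Rightarrow> nat" where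
  "entry c u = (case c of (q, tp, h) \<Rightarrow> tp u + G * (if u = h then Suc q else 0))"

definition act :: "nat \<Rightarrow> nat \<times> nat \<times> int" where
  "act s = \<delta>' (s div G - 1) (s mod G)"

text \<open>This is the local rule for the middle of three cells: the head arrives from the left,
  stays, or arrives from the right. Triples with several heads do not occur in a run; for them the
  order of the tests decides, and the value stays below \<open>S\<close>.\<close>

definition nxt :: "nat \<Rightarrow> nat \<Rightarrow> nat \<Rightarrow> nat" where
  "nxt s1 s2 s3 = (if s2 div G = 0 then s2 mod G else fst (snd (act s2))) +
     G * (if s1 div G \<noteq> 0 \<and> snd (snd (act s1)) = 1 then Suc (fst (act s1))
          else if s2 div G \<noteq> 0 \<and> snd (snd (act s2)) = 0 then Suc (fst (act s2))
          else if s3 div G \<noteq> 0 \<and> snd (snd (act s3)) = -1 then Suc (fst (act s3)) else 0)"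

text \<open>The head component is 0 or \<open>Suc q\<close> with \<open>q \<le> Q\<close>, which
  makes \<open>Q + 2\<close> possibilities.\<close>

definition S :: nat where "S = G * (Q + 2)"

lemma \<delta>'_range:
  assumes "q \<le> Q" "a < G" "\<delta>' q a = (q', a', d)"
  shows "q' < Q" "a' < G" "d \<in> {-1, 0, 1}"
proof -
  have "q' < Q \<and> a' < G \<and> d \<in> {-1, 0, 1}"
  proof (cases "q = 1 \<or> q = 2 \<or> q = Q")
    case True
    then show ?thesis using assms QG unfolding \<delta>'_def by (auto split: if_splits)
  next
    case False
    then have "\<delta> q a = (q', a', d)" "q < Q" using assms unfolding \<delta>'_def by (auto split: if_splits)
    then show ?thesis using wf assms(2) unfolding wf_tm_def by fastforce
  qed
  then show "q' < Q" "a' < G" "d \<in> {-1, 0, 1}" by auto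
qed

lemma entry_less:
  assumes "a < G" "h \<le> Q + 1"
  shows "a + G * h < S"
proof -
  have "a + G * h < G * Suc h" using assms(1) by simp
  also have "\<dots> \<le> G * (Q + 2)" using assms(2) by (intro mult_le_mono2) simp
  finally show ?thesis unfolding S_def .
qed

lemma nxt_less:
  assumes "s1 < S" "s2 < S" "s3 < S"
  shows "nxt s1 s2 s3 < S"
proof -
  have G: "0 < G" using QG by simp
  have act: "fst (act s) < Q" "fst (snd (act s)) < G" if "s < S" for s
  proof -
    have "s div G < Q + 2" using that G unfolding S_def by (simp add: less_mult_imp_div_less mult.commute)
    then have "s div G - 1 \<le> Q" by simp
    then show "fst (act s) < Q" "fst (snd (act s)) < G"
      using \<delta>'_range[of "s div G - 1" "s mod G" "fst (act s)" "fst (snd (act s))" "snd (snd (act s))"] G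
      unfolding act_def by auto
  qed
  show ?thesis
    unfolding nxt_def using act[OF assms(1)] act[OF assms(2)] act[OF assms(3)] G
    by (intro entry_less) auto
qed

lemma init_tape: "fst (snd (init_config y)) i = (if 0 \<le> i then insym y (nat i) else 0)"
  unfolding init_config_def insym_def by (auto simp: nat_less_iff)

lemma cfg_Suc: "cfg y (Suc t) = step' (cfg y t)"
  unfolding cfg_def by simp

text \<open>The head starts at -1 and moves by at most one cell per step, so cells beyond its reach
  and beyond the input are still blank.\<close>

lemma cfg_inv:
  "case cfg y t of (q, tp, h) \<Rightarrow> q \<le> Q \<and> (t > 0 \<longrightarrow> q < Q) \<and> (\<forall>i. tp i < G) \<and> - 1 - int t \<le> h \<and> h \<le> int t - 1 \<and>
     (\<forall>u. u < - 1 - int t \<or> int (length y) \<le> u \<and> int t \<le> u \<longrightarrow> tp u = 0)"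
proof (induction t)
  case 0
  then show ?case using QG init_tape[of y] unfolding cfg_def
    by (auto simp: insym_def bit_sym_def)
next
  case (Suc t)
  obtain q tp h where c: "cfg y t = (q, tp, h)" by (cases "cfg y t") auto
  obtain q' a' d where s: "\<delta>' q (tp h) = (q', a', d)" by (cases "\<delta>' q (tp h)") auto
  have "q \<le> Q" "tp h < G" using Suc c by auto
  then have "q' < Q" "a' < G" "d \<in> {-1, 0, 1}" using \<delta>'_range[OF _ _ s] by auto
  then show ?case using Suc c s unfolding cfg_Suc step'_def by auto
qed

text \<open>The additional first step leaves the blank at -1 and enters cell 0 in state 0. Time is
  thereby shifted by one, and \<open>T0\<close> steps of the verifier take \<open>T0 + 2\<close>
  rows.\<close>

lemma cfg_run: "cfg y (Suc t) = tm_run M t y"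
proof (induction t)
  case 0
  obtain q tp h where i: "init_config y = (q, tp, h)" by (cases "init_config y") auto
  have "q = 0" "h = 0" "tp (-1) = 0" using i init_tape[of y "-1"] unfolding init_config_def by auto
  then show ?case using i QG unfolding cfg_def tm_run_def step'_def \<delta>'_def by (auto simp: fun_eq_iff)
next
  case (Suc t)
  obtain q tp h where c: "cfg y (Suc t) = (q, tp, h)" by (cases "cfg y (Suc t)") auto
  have "q < Q" using cfg_inv[where y = y and t = "Suc t"] c by auto
  then have "step' (q, tp, h) = tm_step M (q, tp, h)"
    unfolding step'_def tm_step_def \<delta>'_def by (auto split: prod.split)
  then show ?case using Suc c unfolding cfg_Suc[of y "Suc t"] tm_run_def by simp
qed

lemma entry_div_mod:
  assumes "tp u < G"
  shows "entry (q, tp, h) u div G = (if u = h then Suc q else 0)" "entry (q, tp, h) u mod G = tp u"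
  using assms unfolding entry_def prod.case by (simp_all del: mult_Suc_right)

lemma entry_step:
  assumes "q \<le> Q" "\<And>i. tp i < G"
  shows "entry (step' (q, tp, h)) u = nxt (entry (q, tp, h) (u - 1)) (entry (q, tp, h) u) (entry (q, tp, h) (u + 1))"
proof -
  have dm: "entry (q, tp, h) v div G = (if v = h then Suc q else 0)" "entry (q, tp, h) v mod G = tp v" for v
    using entry_div_mod[OF assms(2)] by simp_all
  obtain q' a' d where s: "\<delta>' q (tp h) = (q', a', d)" by (cases "\<delta>' q (tp h)") auto
  have d: "d \<in> {-1, 0, 1}" using \<delta>'_range[OF assms s] by auto
  have act: "act (entry (q, tp, h) h) = (q', a', d)" unfolding act_def dm using s by simp
  have st: "step' (q, tp, h) = (q', tp(h := a'), h + d)" unfolding step'_def using s by simp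
  consider "u = h" | "u - 1 = h" | "u + 1 = h" | "u \<noteq> h" "u - 1 \<noteq> h" "u + 1 \<noteq> h" by blast
  then show ?thesis
  proof cases
    case 1
    then show ?thesis unfolding nxt_def dm st using act d by (auto simp: entry_def)
  next
    case 2
    then show ?thesis unfolding nxt_def dm st using act d by (auto simp: entry_def)
  next
    case 3
    then show ?thesis unfolding nxt_def dm st using act d by (auto simp: entry_def)
  next
    case 4
    then show ?thesis unfolding nxt_def dm st using d by (auto simp: entry_def)
  qed
qed

lemma entry_blank:
  assumes "u < - 1 - int t \<or> int (length y) \<le> u \<and> int t \<le> u"
  shows "entry (cfg y t) u = 0"
  using cfg_inv[where y = y and t = t] assms unfolding entry_def by (cases "cfg y t") auto

lemma entry_cfg_less: "entry (cfg y t) u < S"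
proof -
  obtain q tp h where c: "cfg y t = (q, tp, h)" by (cases "cfg y t") auto
  then have "tp u < G" "q \<le> Q" using cfg_inv[where y = y and t = t] by auto
  then show ?thesis unfolding c entry_def prod.case by (intro entry_less) auto
qed

text \<open>Clauses are lists of literals \<open>(d, v, s, g)\<close>: entry \<open>s\<close> stands (\<open>g\<close>) or does not stand (\<open>\<not> g\<close>)
  in the cell \<open>d\<close> places after the current one, or \<open>d\<close> plus the width of a row if \<open>v\<close> holds.\<close>

definition prop_clauses :: "slit list list" where
  "prop_clauses = [[(0, False, s1, False), (1, False, s2, False), (2, False, s3, False), (0, True, nxt s1 s2 s3, True)].
     s1 \<leftarrow> [0..<S], s2 \<leftarrow> [0..<S], s3 \<leftarrow> [0..<S]]"

text \<open>Kind 0 is a blank, 1 the initial head on a blank, 2 and 3 are the two bits, 4 is a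
  witness cell, 5 an inner row and 6 the last row. The second clause of kind 4 makes the blanks
  among the witness cells a suffix. Kind 6 forbids every head except one in state 1, whose head
  component is 2.\<close>

definition raw_clauses :: "nat \<Rightarrow> slit list list" where
  "raw_clauses i =
    (if i = 0 then [(0, False, 0, True)] # prop_clauses
     else if i = 1 then [(0, False, G * Suc Q, True)] # prop_clauses
     else if i = 2 then [(0, False, 1, True)] # prop_clauses
     else if i = 3 then [(0, False, 2, True)] # prop_clauses
     else if i = 4 then [(0, False, 0, True), (0, False, 1, True), (0, False, 2, True)] #
       [(0, False, 0, False), (1, False, 0, True)] # prop_clauses
     else if i = 5 then prop_clauses
     else [[(0, False, s, False)]. s \<leftarrow> [0..<S], s div G \<noteq> 0 \<and> s div G \<noteq> 2])"

text \<open>The largest number of clauses of a cell, reached by kind 4. The other kinds are filled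
  up with tautologies, so that clause numbers can be computed from cell numbers.\<close>

definition C :: nat where "C = S * S * S + 2"

definition clauses :: "nat \<Rightarrow> slit list list" where
  "clauses i = raw_clauses i @ replicate (C - length (raw_clauses i)) [(0, False, 0, True), (0, False, 0, False)]"

fun lit_holds :: "(nat \<Rightarrow> nat \<Rightarrow> bool) \<Rightarrow> nat \<Rightarrow> nat \<Rightarrow> slit \<Rightarrow> bool" where
  "lit_holds X W k (d, v, s, g) \<longleftrightarrow> X (k + d + (if v then W else 0)) s = g"

definition clauses_hold :: "(nat \<Rightarrow> nat \<Rightarrow> bool) \<Rightarrow> nat \<Rightarrow> nat \<Rightarrow> nat \<Rightarrow> bool" where
  "clauses_hold X W k i \<longleftrightarrow> (\<forall>cl\<in>set (clauses i). \<exists>l\<in>set cl. lit_holds X W k l)"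

lemma clauses_hold_raw: "clauses_hold X W k i \<longleftrightarrow> (\<forall>cl\<in>set (raw_clauses i). \<exists>l\<in>set cl. lit_holds X W k l)"
  unfolding clauses_hold_def clauses_def by auto

lemma length_prop_clauses: "length prop_clauses = S * S * S"
  unfolding prop_clauses_def by (simp add: length_concat comp_def sum_list_triv)

lemma length_clauses: "length (clauses i) = C"
proof -
  have "S \<le> S * S * S" by (cases S) auto
  moreover have "length [[(0 :: nat, False, s, False)]. s \<leftarrow> [0..<S], s div G \<noteq> 0 \<and> s div G \<noteq> 2] \<le> S"
  proof -
    have "length (concat (map (\<lambda>s. if P s then [f s] else []) xs)) \<le> length xs"
      for P and f :: "nat \<Rightarrow> slit list" and xs by (induction xs) auto
    from this[of "\<lambda>s. s div G \<noteq> 0 \<and> s div G \<noteq> 2" "\<lambda>s. [(0, False, s, False)]" "[0..<S]"] show ?thesis by simp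
  qed
  ultimately have "length [[(0 :: nat, False, s, False)]. s \<leftarrow> [0..<S], s div G \<noteq> 0 \<and> s div G \<noteq> 2] \<le> S * S * S"
    by linarith
  then have "length (raw_clauses i) \<le> C"
    unfolding raw_clauses_def C_def using length_prop_clauses by auto
  then show ?thesis unfolding clauses_def by simp
qed

definition prop_holds :: "(nat \<Rightarrow> nat \<Rightarrow> bool) \<Rightarrow> nat \<Rightarrow> nat \<Rightarrow> bool" where
  "prop_holds X W k \<longleftrightarrow> (\<forall>s1<S. \<forall>s2<S. \<forall>s3<S. X k s1 \<longrightarrow> X (Suc k) s2 \<longrightarrow> X (k + 2) s3 \<longrightarrow> X (k + W) (nxt s1 s2 s3))"

lemma prop_clauses_hold: "(\<forall>cl\<in>set prop_clauses. \<exists>l\<in>set cl. lit_holds X W k l) \<longleftrightarrow> prop_holds X W k"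
  unfolding prop_clauses_def prop_holds_def by auto

lemma clauses_hold_iff:
  "clauses_hold X W k 0 \<longleftrightarrow> X k 0 \<and> prop_holds X W k"
  "clauses_hold X W k 1 \<longleftrightarrow> X k (G * Suc Q) \<and> prop_holds X W k"
  "clauses_hold X W k 2 \<longleftrightarrow> X k 1 \<and> prop_holds X W k"
  "clauses_hold X W k 3 \<longleftrightarrow> X k 2 \<and> prop_holds X W k"
  "clauses_hold X W k 4 \<longleftrightarrow> (X k 0 \<or> X k 1 \<or> X k 2) \<and> (X k 0 \<longrightarrow> X (Suc k) 0) \<and> prop_holds X W k"
  "clauses_hold X W k 5 \<longleftrightarrow> prop_holds X W k"
  "clauses_hold X W k 6 \<longleftrightarrow> (\<forall>s<S. s div G \<noteq> 0 \<longrightarrow> s div G \<noteq> 2 \<longrightarrow> \<not> X k s)"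
  unfolding clauses_hold_raw raw_clauses_def prop_clauses_hold[symmetric]
  by (auto simp: raw_clauses_def)

end

section \<open>The tableau of a fixed input\<close>

locale verifier_input = verifier +
  fixes x :: "bool list" and n p q T0 H W N :: nat
  assumes n: "n = length x" and q: "q = 2 * n + 2 + p" and H: "H = 2 * T0 + 4" and W: "W = H + q + 2"
    and N: "N = (T0 + 2) * W"
begin

definition kindf :: "nat \<Rightarrow> nat" where
  "kindf k = (if k < H then 0 else if k = H then 1
     else if k < H + 1 + 2 * n then (if even (k - (H + 1)) then 2 else if x ! ((k - (H + 1)) div 2) then 3 else 2)
     else if k < H + 1 + 2 * n + 2 then 3 else if k < H + 1 + q then 4 else if k < W then 0
     else if k < (T0 + 1) * W then 5 else 6)"

definition sat :: "(nat \<Rightarrow> nat \<Rightarrow> bool) \<Rightarrow> bool" where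
  "sat X \<longleftrightarrow> (\<forall>k<N. clauses_hold X W k (kindf k))"

text \<open>Each row is shifted by one cell with respect to the previous one, so that the clauses only look forward;
  the neighbours of the last cells of a row are in the next row, where they are blank.\<close>

definition val :: "bool list \<Rightarrow> nat \<Rightarrow> nat" where
  "val y k = entry (cfg y (k div W)) (int (k mod W) + int (k div W) - int H - 1)"

lemma val_less: "val y k < S"
  unfolding val_def by (rule entry_cfg_less)

lemma val_row: "j < W \<Longrightarrow> val y (t * W + j) = entry (cfg y t) (int j + int t - int H - 1)"
  unfolding val_def by simp

lemma val_rowI: "\<lbrakk>j < W; u = int j + int t - int H - 1\<rbrakk> \<Longrightarrow> val y (t * W + j) = entry (cfg y t) u"
  using val_row by simp

lemma val_row0: "k < W \<Longrightarrow> val y k = entry (cfg y 0) (int k - int H - 1)"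
  using val_row[of k y 0] by simp

text \<open>Because of the shift, the cell \<open>W\<close> places further on lies below the middle
  one of \<open>k\<close>, \<open>Suc k\<close>, \<open>k + 2\<close>. At the end of a row the
  latter two may belong to the next row; there both the cell read and the cell meant are
  blank.\<close>

lemma val_next:
  assumes y: "length y \<le> q" and k: "k + W < N"
  shows "val y (k + W) = nxt (val y k) (val y (Suc k)) (val y (k + 2))"
proof -
  define t j where "t = k div W" and "j = k mod W"
  have W0: "2 < W" using W H by simp
  have jW: "j < W" unfolding j_def using W0 by simp
  have k_eq: "k = t * W + j" unfolding t_def j_def by simp
  have "Suc t * W < (T0 + 2) * W" using k N unfolding k_eq by simp
  then have "Suc t < T0 + 2" by (simp only: mult_less_cancel2)
  then have t: "t \<le> T0" by simp
  define u where "u = int j + int t - int H"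
  have v0: "val y k = entry (cfg y t) (u - 1)" unfolding k_eq by (rule val_rowI[OF jW]) (simp add: u_def)
  have kW: "k + W = Suc t * W + j" unfolding k_eq by simp
  have vW: "val y (k + W) = entry (cfg y (Suc t)) u" unfolding kW by (rule val_rowI[OF jW]) (simp add: u_def)
  have right: "entry (cfg y t) v = 0" if "int W + int t - int H - 1 \<le> v" for v
    by (rule entry_blank) (use that y W in auto)
  \<comment> \<open>The constant in \<open>H = 2 * T0 + 4\<close> comes from here: the first two
    cells of row \<open>Suc t\<close> end at position \<open>t + 1 - H\<close>, which for
    \<open>t \<le> T0\<close> is to the left of \<open>- t - 2\<close>, the leftmost cell touched by
    then.\<close>
  have left: "entry (cfg y (Suc t)) v = 0" if "v \<le> int t + 1 - int H" for v
    by (rule entry_blank) (use that t H in auto)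
  have v1: "val y (Suc k) = entry (cfg y t) u"
  proof (cases "Suc j < W")
    case True
    then have "val y (t * W + Suc j) = entry (cfg y t) u" by (intro val_rowI) (simp_all add: u_def)
    then show ?thesis unfolding k_eq by simp
  next
    case False
    then have "Suc k = Suc t * W + 0" using jW unfolding k_eq by simp
    then have "val y (Suc k) = entry (cfg y (Suc t)) (int t - int H)" using val_row[of 0 y "Suc t"] W0 by simp
    then show ?thesis using left right[of u] False jW unfolding u_def by simp
  qed
  have v2: "val y (k + 2) = entry (cfg y t) (u + 1)"
  proof (cases "j + 2 < W")
    case True
    then have "val y (t * W + (j + 2)) = entry (cfg y t) (u + 1)"
      by (intro val_rowI) (simp_all add: u_def)
    then show ?thesis unfolding k_eq by simp
  next
    case False
    then have *: "k + 2 = Suc t * W + (j + 2 - W)" "j + 2 - W \<le> 1" using jW unfolding k_eq by simp_all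
    then have "val y (k + 2) = entry (cfg y (Suc t)) (int (j + 2 - W) + int (Suc t) - int H - 1)"
      using val_row[of "j + 2 - W" y "Suc t"] W0 by simp
    moreover have "entry (cfg y (Suc t)) (int (j + 2 - W) + int (Suc t) - int H - 1) = 0"
      by (rule left) (use *(2) in linarith)
    ultimately show ?thesis using right[of "u + 1"] False unfolding u_def by simp
  qed
  obtain q' tp h where c: "cfg y t = (q', tp, h)" by (cases "cfg y t") auto
  have "q' \<le> Q" "\<And>i. tp i < G" using cfg_inv[where y = y and t = t] c by auto
  from entry_step[OF this, where h = h and u = u] show ?thesis unfolding vW v0 v1 v2 cfg_Suc c .
qed

lemma val_init:
  assumes "k < W"
  shows "val y k = (if k < H then 0 else if k = H then G * Suc Q else insym y (k - (H + 1)))"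
proof -
  have c: "cfg y 0 = (Q, fst (snd (init_config y)), -1)" unfolding cfg_def by simp
  show ?thesis
  proof (cases k H rule: linorder_cases)
    case greater
    then have "nat (int k - int H - 1) = k - (H + 1)" by simp
    then show ?thesis
      unfolding val_row0[OF assms] c entry_def prod.case init_tape by (simp only:) (use greater in simp)
  next
    case equal
    then show ?thesis unfolding val_row0[OF assms] c entry_def prod.case init_tape by simp
  next
    case less
    then show ?thesis unfolding val_row0[OF assms] c entry_def prod.case init_tape by simp
  qed
qed

lemma prop_iff:
  assumes "k + W < N" "sat X"
  shows "prop_holds X W k"
proof -
  have "k < (T0 + 1) * W" using assms(1) N by simp
  then have "kindf k \<in> {0, 1, 2, 3, 4, 5}" unfolding kindf_def by auto
  moreover have "clauses_hold X W k (kindf k)" using assms unfolding sat_def by auto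
  ultimately show ?thesis using clauses_hold_iff by auto
qed

lemma length_pair_enc: "length (pair_enc x w) = 2 * n + 2 + length w"
proof -
  have "length (concat (map (\<lambda>b. [False, b]) x)) = 2 * length x" by (induction x) auto
  then show ?thesis unfolding pair_enc_def n by simp
qed

lemma pair_enc_nth:
  assumes "i < 2 * n + 2 + length w"
  shows "pair_enc x w ! i = (if i < 2 * n then odd i \<and> x ! (i div 2) else if i < 2 * n + 2 then True else w ! (i - (2 * n + 2)))"
proof -
  have len: "length (concat (map (\<lambda>b. [False, b]) x)) = 2 * length x" for x by (induction x) auto
  have "i < 2 * length x \<Longrightarrow> concat (map (\<lambda>b. [False, b]) x) ! i = (odd i \<and> x ! (i div 2))" for i
  proof (induction x arbitrary: i)
    case (Cons b x)
    show ?case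
    proof (cases "i < 2")
      case True
      then show ?thesis by (cases i) auto
    next
      case False
      then obtain j where "i = Suc (Suc j)" by (metis Suc_diff_Suc add_2_eq_Suc le_add_diff_inverse linorder_not_less)
      then show ?thesis using Cons.IH[of j] Cons.prems by auto
    qed
  qed simp
  moreover have "([True, True] @ w) ! i' = (if i' < 2 then True else w ! (i' - 2))" for i'
    by (cases i'; cases "i' - 1") auto
  ultimately show ?thesis unfolding pair_enc_def nth_append[of "concat (map (\<lambda>b. [False, b]) x)"] len n
    by (auto simp del: append_Cons)
qed

lemma insym_pair_enc:
  assumes "length w \<le> p" "i \<le> q"
  shows "insym (pair_enc x w) i = (if i < 2 * n then (if odd i \<and> x ! (i div 2) then 2 else 1)
    else if i < 2 * n + 2 then 2 else insym w (i - (2 * n + 2)))"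
  using assms unfolding insym_def length_pair_enc by (auto simp: pair_enc_nth bit_sym_def)

lemma first_row:
  assumes w: "length w \<le> p" and kW: "k < W"
  obtains "kindf k = 0" "val (pair_enc x w) k = 0" | "kindf k = 1" "val (pair_enc x w) k = G * Suc Q"
    | "kindf k = 2" "val (pair_enc x w) k = 1" | "kindf k = 3" "val (pair_enc x w) k = 2"
    | i where "kindf k = 4" "i < p" "k = H + 1 + (2 * n + 2) + i" "val (pair_enc x w) k = insym w i"
proof -
  note v = val_init[OF kW] insym_pair_enc[OF w, of "k - (H + 1)"]
  consider "k < H" | "k = H" | "H < k" "k < H + 1 + 2 * n" | "H + 1 + 2 * n \<le> k" "k < H + 1 + 2 * n + 2"
    | "H + 1 + 2 * n + 2 \<le> k" "k < H + 1 + q" | "k = H + 1 + q" using kW W by linarith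
  then show thesis
  proof cases
    case 3
    define e where "e \<longleftrightarrow> odd (k - (H + 1)) \<and> x ! ((k - (H + 1)) div 2)"
    have "val (pair_enc x w) k = (if e then 2 else 1)" "kindf k = (if e then 3 else 2)"
      using 3 v q unfolding e_def kindf_def by auto
    then show thesis using that(3,4) by (cases e) simp_all
  next
    case 4
    have "val (pair_enc x w) k = 2" using 4 v q by auto
    moreover have "kindf k = 3" using 4 unfolding kindf_def by auto
    ultimately show thesis by (rule that(4)[rotated])
  next
    case 5
    have "kindf k = 4" "k - (H + 1 + (2 * n + 2)) < p" "k = H + 1 + (2 * n + 2) + (k - (H + 1 + (2 * n + 2)))"
      using 5 q unfolding kindf_def by auto
    moreover have "val (pair_enc x w) k = insym w (k - (H + 1 + (2 * n + 2)))" using 5 v by auto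
    ultimately show thesis by (rule that(5))
  next
    case 6
    have "val (pair_enc x w) k = 0" using 6 v w q by (auto simp: insym_def)
    moreover have "kindf k = 0" using 6 q W unfolding kindf_def by auto
    ultimately show thesis by (rule that(1)[rotated])
  qed (use that(1,2) v(1) in \<open>simp_all add: kindf_def\<close>)
qed

text \<open>The tableau of an accepting run, with exactly one true symbol per cell, satisfies all
  clauses.\<close>

lemma sat_val:
  assumes w: "length w \<le> p" and acc: "accepting (tm_run M T0 (pair_enc x w))"
  shows "sat (\<lambda>k s. val (pair_enc x w) k = s)"
  unfolding sat_def
proof (intro allI impI)
  fix k assume k: "k < N"
  let ?y = "pair_enc x w" and ?X = "\<lambda>k s. val (pair_enc x w) k = s"
  have y: "length ?y \<le> q" unfolding length_pair_enc q using w by simp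
  show "clauses_hold ?X W k (kindf k)"
  proof (cases "k < (T0 + 1) * W")
    case True
    then have "k + W < N" unfolding N by simp
    then have prp: "prop_holds ?X W k" unfolding prop_holds_def using val_next[OF y] by auto
    show ?thesis
    proof (cases "k < W")
      case False
      then have "kindf k = 5" using True W q unfolding kindf_def by auto
      then show ?thesis using prp clauses_hold_iff by simp
    next
      case kW: True
      show ?thesis
      proof (rule first_row[OF w kW])
        fix i assume i: "kindf k = 4" "i < p" "k = H + 1 + (2 * n + 2) + i" "val ?y k = insym w i"
        \<comment> \<open>The row has one more column after the last witness cell, so the successor
          of a witness cell is in the same row.\<close>
        have "Suc k < W" using i W q by simp
        then have "val ?y (Suc k) = insym w (Suc i)"
          using val_init[of "Suc k"] insym_pair_enc[OF w, of "Suc k - (H + 1)"] i W q by auto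
        moreover have "insym w i = 0 \<or> insym w i = 1 \<or> insym w i = 2" unfolding insym_def bit_sym_def by auto
        moreover have "insym w (Suc i) = 0" if "insym w i = 0"
          using that unfolding insym_def bit_sym_def by (auto split: if_splits)
        ultimately show ?thesis using prp i(1,4) by (simp add: clauses_hold_iff)
      qed (use prp in \<open>simp_all only: clauses_hold_iff simp_thms\<close>)
    qed
  next
    case False
    have "W > 0" using W by simp
    define j where "j = k - (T0 + 1) * W"
    have j: "k = Suc T0 * W + j" "j < W" using False k N unfolding j_def by simp_all
    have "\<not> k < W" using False by (simp add: algebra_simps)
    then have kf: "kindf k = 6" using False W q unfolding kindf_def by auto
    obtain q' tp h where c: "cfg ?y (Suc T0) = (q', tp, h)" by (cases "cfg ?y (Suc T0)") auto
    have "q' = 1" using acc c unfolding cfg_run[symmetric] accepting_def by simp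
    moreover have "\<And>i. tp i < G" using cfg_inv[where y = ?y and t = "Suc T0"] c by auto
    moreover have "val ?y k = entry (cfg ?y (Suc T0)) (int j + int (Suc T0) - int H - 1)"
      unfolding j(1) val_row[OF j(2)] ..
    \<comment> \<open>A cell of the last row carries either no head or the head in state 1.\<close>
    ultimately have "val ?y k div G \<in> {0, 2}" unfolding c using entry_div_mod(1)[where tp = tp] by simp
    then show ?thesis using kf by (auto simp: clauses_hold_iff)
  qed
qed

text \<open>\<open>X\<close> may make several symbols of a cell true. The witness is cut off at the
  first cell where blank is true, and its bits are read from symbol 2. On this input all entries of
  the actual run are true in \<open>X\<close>: in the first row by construction, later by
  propagation. Hence the head in the last row is not in a forbidden state.\<close>

lemma witness_of_sat:
  assumes sat: "sat X"
  obtains w where "length w \<le> p" "accepting (tm_run M T0 (pair_enc x w))"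
proof -
  define I where "I i = H + 1 + (2 * n + 2) + i" for i
  define j where "j = (LEAST i. i = p \<or> X (I i) 0)"
  define w where "w = map (\<lambda>i. X (I i) 2) [0..<j]"
  have NW: "W + W \<le> N" unfolding N by simp
  have jp: "j \<le> p" unfolding j_def by (rule Least_le) simp
  have j: "j = p \<or> X (I j) 0" unfolding j_def by (rule LeastI[of _ p]) simp
  have lt: "\<not> X (I i) 0" if "i < j" for i using not_less_Least[of i "\<lambda>i. i = p \<or> X (I i) 0"] that unfolding j_def by auto
  have w: "length w \<le> p" unfolding w_def using jp by simp
  let ?y = "pair_enc x w"
  have y: "length ?y \<le> q" unfolding length_pair_enc q using w by simp
  have hold: "clauses_hold X W k (kindf k)" if "k < W" for k using sat that NW unfolding sat_def by simp
  have choice: "X (I i) 0 \<or> X (I i) 1 \<or> X (I i) 2" "X (I i) 0 \<Longrightarrow> X (I (Suc i)) 0" if "i < p" for i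
  proof -
    have "kindf (I i) = 4" "I i < W" using that q W unfolding kindf_def I_def by auto
    then show "X (I i) 0 \<or> X (I i) 1 \<or> X (I i) 2" "X (I i) 0 \<Longrightarrow> X (I (Suc i)) 0"
      using hold[of "I i"] by (auto simp: clauses_hold_iff I_def)
  qed
  \<comment> \<open>From the cut on, blank is true in all witness cells, as required of the padding
    behind a shorter witness.\<close>
  have ge: "X (I i) 0" if "j \<le> i" "i < p" for i
    using that
  proof (induction i rule: dec_induct)
    case base
    then show ?case using j by auto
  next
    case (step i)
    then show ?case using choice(2)[of i] by simp
  qed
  have first: "X k (val ?y k)" if kW: "k < W" for k
  proof -
    show ?thesis
    proof (rule first_row[OF w kW])
      fix i assume i: "kindf k = 4" "i < p" "k = H + 1 + (2 * n + 2) + i" "val ?y k = insym w i"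
      have "k = I i" unfolding i(3) I_def ..
      moreover have "insym w i = (if i < j then if X (I i) 2 then 2 else 1 else 0)"
        unfolding insym_def w_def bit_sym_def by simp
      ultimately show ?thesis using i(4) choice(1)[OF i(2)] ge[OF _ i(2)] lt[of i] by auto
    qed (use hold[OF kW] in \<open>simp_all only: clauses_hold_iff simp_thms\<close>)
  qed
  have all: "X k (val ?y k)" if "k < N" for k
    using that
  proof (induction k rule: less_induct)
    case (less k)
    show ?case
    proof (cases "k < W")
      case True
      then show ?thesis by (rule first)
    next
      case False
      define i where "i = k - W"
      have k: "k = i + W" "2 < W" using False W H unfolding i_def by simp_all
      have "X i (val ?y i)" "X (Suc i) (val ?y (Suc i))" "X (i + 2) (val ?y (i + 2))"
        using less.IH less.prems k by simp_all
      then have "X (i + W) (nxt (val ?y i) (val ?y (Suc i)) (val ?y (i + 2)))"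
        using prop_iff[OF _ sat, of i] less.prems k val_less unfolding prop_holds_def by simp
      then show ?thesis using val_next[OF y, of i] less.prems k by simp
    qed
  qed
  obtain q' tp h where c: "cfg ?y (Suc T0) = (q', tp, h)" by (cases "cfg ?y (Suc T0)") auto
  have h: "- 1 - int (Suc T0) \<le> h" "h \<le> int (Suc T0) - 1" and tp: "\<And>i. tp i < G"
    using cfg_inv[where y = ?y and t = "Suc T0"] c by auto
  \<comment> \<open>This is the column of the head in the last row; the left margin makes it
    nonnegative.\<close>
  define j where "j = nat (h - int (Suc T0) + int H + 1)"
  have j: "int j = h - int (Suc T0) + int H + 1" using h H unfolding j_def by simp
  then have jW: "j < W" using h W by linarith
  let ?k = "Suc T0 * W + j"
  have kN: "?k < N" using jW unfolding N by simp
  have "val ?y ?k = entry (cfg ?y (Suc T0)) h" unfolding val_row[OF jW] using j by (simp add: algebra_simps)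
  also have "\<dots> div G = Suc q'" unfolding c using entry_div_mod(1)[where tp = tp and u = h, OF tp] by simp
  finally have v: "val ?y ?k div G = Suc q'" .
  have "\<not> ?k < W" "\<not> ?k < (T0 + 1) * W" by (simp_all add: algebra_simps)
  then have "kindf ?k = 6" using W q unfolding kindf_def by auto
  then have "val ?y ?k div G \<noteq> 0 \<longrightarrow> val ?y ?k div G \<noteq> 2 \<longrightarrow> \<not> X ?k (val ?y ?k)"
    using sat kN val_less[of ?y ?k] unfolding sat_def by (auto simp: clauses_hold_iff)
  then have "q' = 1" using all[OF kN] v by auto
  then have "accepting (tm_run M T0 ?y)" using c unfolding cfg_run[symmetric] accepting_def by simp
  then show thesis by (rule that[OF w])
qed

theorem sat_iff: "(\<exists>X. sat X) \<longleftrightarrow> (\<exists>w. length w \<le> p \<and> accepting (tm_run M T0 (pair_enc x w)))"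
  using sat_val witness_of_sat by metis

end

subsection \<open>Decoding instances\<close>

lemma enc_unary_Suc: "enc_unary (Suc m) = True # True # enc_unary m"
  by (simp add: enc_unary_def tok_one_def)

lemma enc_unary_0: "enc_unary 0 = []"
  by (simp add: enc_unary_def)

text \<open>The closing token differs from the unary digit, so the first token that is not a digit
  marks the end of the number.\<close>

lemma enc_unary_eqD:
  assumes "enc_unary m @ tok @ X = enc_unary m' @ tok @ X'" "tok = tok_vend \<or> tok = tok_eend"
  shows "m = m' \<and> X = X'"
  using assms(1)
proof (induction m arbitrary: m')
  case 0
  then show ?case using assms(2)
    by (cases m') (auto simp: enc_unary_Suc enc_unary_0 tok_vend_def tok_eend_def)
next
  case (Suc m)
  then show ?case using assms(2)
    by (cases m') (auto simp: enc_unary_Suc enc_unary_0 tok_vend_def tok_eend_def)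
qed

lemma enc_vertices_Cons: "enc_vertices (v # vs) = enc_unary v @ tok_vend @ enc_vertices vs"
  unfolding enc_vertices_def by simp

lemma enc_vertices_Nil: "enc_vertices [] = tok_eend"
  unfolding enc_vertices_def by simp

lemma enc_unary_vend_neq_eend: "enc_unary v @ tok_vend @ X \<noteq> tok_eend @ X'"
  by (cases v) (auto simp: enc_unary_Suc enc_unary_0 tok_vend_def tok_eend_def)

lemma enc_vertices_eqD: "enc_vertices vs @ X = enc_vertices vs' @ X' \<Longrightarrow> vs = vs' \<and> X = X'"
proof (induction vs arbitrary: vs')
  case Nil
  then show ?case
    by (cases vs') (auto simp: enc_vertices_Nil enc_vertices_Cons dest: enc_unary_vend_neq_eend[THEN notE, OF sym])
next
  case (Cons v vs)
  show ?case
  proof (cases vs')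
    case Nil
    then show ?thesis using Cons.prems enc_unary_vend_neq_eend
      by (simp add: enc_vertices_Nil enc_vertices_Cons)
  next
    case (Cons v' us)
    then have "enc_unary v @ tok_vend @ (enc_vertices vs @ X) = enc_unary v' @ tok_vend @ (enc_vertices us @ X')"
      using Cons.prems by (simp add: enc_vertices_Cons)
    then have "v = v' \<and> enc_vertices vs @ X = enc_vertices us @ X'"
      by (rule enc_unary_eqD) simp
    then show ?thesis using Cons.IH Cons by simp
  qed
qed

lemma enc_vertices_neq_sep: "enc_vertices vs @ X \<noteq> tok_sep @ X'"
proof (cases vs)
  case (Cons v us)
  then show ?thesis by (cases v) (auto simp: enc_vertices_Cons enc_unary_Suc enc_unary_0 tok_sep_def tok_vend_def)
qed (auto simp: enc_vertices_Nil tok_sep_def tok_eend_def)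

lemma enc_edges_sep_eqD:
  "concat (map enc_vertices ls) @ tok_sep @ X = concat (map enc_vertices ls') @ tok_sep @ X' \<Longrightarrow> ls = ls' \<and> X = X'"
proof (induction ls arbitrary: ls')
  case Nil
  then show ?case
    using enc_vertices_neq_sep[of _ _ X] by (cases ls') (simp_all, metis)
next
  case (Cons vs ls)
  show ?case
  proof (cases ls')
    case Nil
    then show ?thesis using Cons.prems enc_vertices_neq_sep[of vs _ X'] by simp
  next
    case (Cons vs' us)
    then have "enc_vertices vs @ (concat (map enc_vertices ls) @ tok_sep @ X)
        = enc_vertices vs' @ (concat (map enc_vertices us) @ tok_sep @ X')"
      using Cons.prems by simp
    then have "vs = vs' \<and> concat (map enc_vertices ls) @ tok_sep @ X = concat (map enc_vertices us) @ tok_sep @ X'"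
      by (rule enc_vertices_eqD)
    then show ?thesis using Cons.IH Cons by simp
  qed
qed

lemma enc_edges_eqD:
  "concat (map enc_vertices ls) = concat (map enc_vertices ls') \<Longrightarrow> ls = ls'"
  using enc_edges_sep_eqD[of ls "[]" ls' "[]"] by simp

lemma enc_edge_eq: "enc_edge e = enc_vertices (sorted_list_of_set e)"
  unfolding enc_edge_def enc_vertices_def ..

text \<open>Membership in the language asserts that some instance encoded by the string is won.
  Unique decoding identifies it with the intended one. Finiteness matters because an edge is
  recovered from its sorted list.\<close>

lemma encodes_instance_unique:
  assumes "encodes_instance s n EL ER" "encodes_instance s n' EL' ER'"
    and fin: "\<And>e. e \<in> EL \<union> ER \<union> EL' \<union> ER' \<Longrightarrow> finite e"
  shows "n = n' \<and> EL = EL' \<and> ER = ER'"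
proof -
  have map_enc: "map enc_edge es = map enc_vertices (map sorted_list_of_set es)" for es
    by (simp add: enc_edge_eq)
  obtain ls rs where l: "set ls = EL" "set rs = ER"
    "s = enc_unary n @ tok_eend @ concat (map enc_edge ls) @ tok_sep @ concat (map enc_edge rs)"
    using assms(1) unfolding encodes_instance_def by blast
  obtain ls' rs' where l': "set ls' = EL'" "set rs' = ER'"
    "s = enc_unary n' @ tok_eend @ concat (map enc_edge ls') @ tok_sep @ concat (map enc_edge rs')"
    using assms(2) unfolding encodes_instance_def by blast
  have "n = n' \<and> concat (map enc_edge ls) @ tok_sep @ concat (map enc_edge rs)
      = concat (map enc_edge ls') @ tok_sep @ concat (map enc_edge rs')"
    by (rule enc_unary_eqD[where tok = tok_eend]) (use l(3) l'(3) in simp_all)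
  moreover from this have ls: "map sorted_list_of_set ls = map sorted_list_of_set ls'"
    and "concat (map enc_edge rs) = concat (map enc_edge rs')"
    using enc_edges_sep_eqD unfolding map_enc by blast+
  moreover from this have rs: "map sorted_list_of_set rs = map sorted_list_of_set rs'"
    using enc_edges_eqD unfolding map_enc by blast
  moreover have "set ` set (map sorted_list_of_set es) = set es" if "\<And>e. e \<in> set es \<Longrightarrow> finite e" for es :: "nat set list"
    using that by (force simp: image_image)
  ultimately show ?thesis using fin l(1,2) l'(1,2) by (metis UnCI)
qed

text \<open>A key that recovers the outer index from an element makes the concatenated lists
  disjoint.\<close>

lemma distinct_concat_keyed:
  assumes "distinct xs" "\<And>a. a \<in> set xs \<Longrightarrow> distinct (f a)"
    and "\<And>a y. \<lbrakk>a \<in> set xs; y \<in> set (f a)\<rbrakk> \<Longrightarrow> key y = a"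
  shows "distinct (concat (map f xs))"
  using assms
proof (induction xs)
  case (Cons a xs)
  have "set (f a) \<inter> (\<Union>b\<in>set xs. set (f b)) = {}"
  proof (rule equals0I)
    fix y assume "y \<in> set (f a) \<inter> (\<Union>b\<in>set xs. set (f b))"
    then obtain b where "y \<in> set (f a)" "b \<in> set xs" "y \<in> set (f b)" by blast
    then have "key y = a" "key y = b" using Cons.prems(3) by simp_all
    then show False using Cons.prems(1) \<open>b \<in> set xs\<close> by simp
  qed
  then show ?case using Cons by simp
qed simp

lemma encodes_lists:
  assumes "distinct BL" "distinct RL" "\<And>vs. vs \<in> set BL \<union> set RL \<Longrightarrow> sorted_wrt (<) vs"
  shows "encodes_instance (enc_unary n @ tok_eend @ concat (map enc_vertices BL) @ tok_sep @ concat (map enc_vertices RL))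
    n (set ` set BL) (set ` set RL)"
proof -
  have sl: "sorted_list_of_set (set vs) = vs" if "sorted_wrt (<) vs" for vs :: "nat list"
    using that by (simp add: sorted_list_of_set_sort_remdups strict_sorted_iff sorted_sort_id)
  have inj: "distinct (map set es)" and enc: "map enc_edge (map set es) = map enc_vertices es"
    if "distinct es" "\<And>vs. vs \<in> set es \<Longrightarrow> sorted_wrt (<) vs" for es :: "nat list list"
  proof -
    have "inj_on set (set es)" by (rule inj_on_inverseI[of _ sorted_list_of_set]) (use that sl in auto)
    then show "distinct (map set es)" using that(1) by (simp add: distinct_map)
    show "map enc_edge (map set es) = map enc_vertices es"
      using that(2) sl by (simp add: enc_edge_eq)
  qed
  have e: "map enc_edge (map set BL) = map enc_vertices BL" "map enc_edge (map set RL) = map enc_vertices RL"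
    using enc[of BL] enc[of RL] assms by blast+
  have d: "distinct (map set BL)" "distinct (map set RL)"
    using inj[of BL] inj[of RL] assms by blast+
  show ?thesis
    unfolding encodes_instance_def
    by (rule exI[of _ "map set BL"], rule exI[of _ "map set RL"]) (simp only: e d set_map simp_thms)
qed

context clause_game
begin

lemma card_3: "card {u, v, w :: nat} \<le> 3" "card {u, v :: nat} \<le> 2"
  by (simp_all add: card_insert_if)

lemma valid_game: "valid_instance 3 2 (7 + 2 * h) EL ER"
proof -
  have blue: "e \<noteq> {} \<and> e \<subseteq> V \<and> card e \<le> 3" if "e \<in> EL" for e
    using that
  proof (cases rule: blue_edge_cases)
    case (1 i)
    then show ?thesis using card_3(2)[of "7 + 2 * i" "8 + 2 * i"] unfolding Vars_def by auto
  next
    case 2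
    then show ?thesis using card_3(2)[of 7 8] zero_lt_h by auto
  next
    case (3 j)
    then show ?thesis using card_3(1)[of 0 j 7] zero_lt_h by auto
  next
    case (4 c l i)
    have "l < 7 + 2 * h" using 4(3,5) unfolding Vars_def by auto
    then show ?thesis using card_3(1)[of "b c" "d c" l] 4 bd_less[of c] by auto
  qed
  have red: "e \<noteq> {} \<and> e \<subseteq> V \<and> card e \<le> 2" if "e \<in> ER" for e
  proof -
    have "\<exists>u v. e = {u, v} \<and> u < 7 + 2 * h \<and> v < 7 + 2 * h"
      using that unfolding ER_def Un_iff mem_Collect_eq
    proof
      assume "\<exists>c. e = {d c, b (Suc c)} \<and> c < m"
      then show ?thesis using bd_less by (metis Suc_leI less_imp_le)
    next
      assume "e \<in> {{3, 4}, {4, 5}, {5, 6}, {3, 6}}"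
      then have "e = {3, 4} \<or> e = {4, 5} \<or> e = {5, 6} \<or> e = {3, 6}" by blast
      then show ?thesis by (elim disjE) (rule exI, rule exI, rule conjI, assumption, simp)+
    qed
    then show ?thesis using card_3(2) by auto
  qed
  show ?thesis unfolding valid_instance_def hypergraph_on_def using blue red by blast
qed

end

section \<open>Numbering of the vertices\<close>

context verifier
begin

text \<open>The pairs of a cell are its \<open>S\<close> variables followed by its \<open>C\<close>
  clauses. As the opening pair is 7, 8, cell \<open>k\<close> starts at vertex
  \<open>9 + K * k\<close>.\<close>

definition Kp :: nat where "Kp = S + C"
abbreviation K :: nat where "K \<equiv> 2 * Kp"

fun lit_vertex :: "slit \<Rightarrow> svertex" where
  "lit_vertex (d, v, s, g) = (9 + K * d + 2 * s + (if g then 0 else 1), True, v)"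

fun local_lit :: "slit \<Rightarrow> bool" where
  "local_lit (d, v, s, g) \<longleftrightarrow> d = 0 \<and> \<not> v"

text \<open>A literal of the same cell has smaller vertices than the clause pair, a literal of a
  later cell has larger ones; this fixes the printing order.\<close>

definition clause_edge :: "nat \<Rightarrow> slit \<Rightarrow> svertex list" where
  "clause_edge c l = (let b = (9 + 2 * (S + c), True, False); d = (10 + 2 * (S + c), True, False) in
     if local_lit l then [lit_vertex l, b, d] else [b, d, lit_vertex l])"

definition kd :: "nat \<Rightarrow> svertex list list" where
  "kd i = map (\<lambda>s. [(9 + 2 * s, True, False), (10 + 2 * s, True, False)]) [0..<S] @
     concat (map (\<lambda>c. map (clause_edge c) (clauses i ! c)) [0..<C])"

definition blue0 :: "svertex list list" where
  "blue0 = map (map (\<lambda>a. (a, False, False))) [[7, 8], [0, 1, 7], [0, 2, 7]]"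

definition red0 :: "svertex list list" where
  "red0 = map (map (\<lambda>a. (a, False, False))) [[3, 4], [4, 5], [5, 6], [3, 6]]"

text \<open>The first vertex is the \<open>d\<close> of the preceding clause. For
  \<open>c = 0\<close> that clause is the last one of the preceding cell, and
  \<open>8 + K * k\<close> is its \<open>d\<close>; for cell 0 the formula gives vertex 8 of the
  opening pair.\<close>

definition red :: "svertex list list" where
  "red = map (\<lambda>c. [(if c = 0 then 8 else 8 + 2 * (S + c), True, False), (9 + 2 * (S + c), True, False)]) [0..<C]"

sublocale reduction_params c1 k1 c2 k2 K 9 kd blue0 red0 red .

lemma small_symbols: "0 < S" "1 < S" "2 < S" "G * Suc Q < S"
proof -
  have "3 * 5 \<le> S" unfolding S_def using QG by (intro mult_le_mono) auto
  then show "0 < S" "1 < S" "2 < S" by auto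
  show "G * Suc Q < S" unfolding S_def using QG by simp
qed

text \<open>The last condition keeps the clauses of the last row inside their own cells, since no
  row follows. That a row offset excludes a cell offset makes distinct literals of a clause point to
  distinct places.\<close>

lemma clause_ok:
  assumes "cl \<in> set (clauses i)"
  shows "distinct cl \<and> (\<forall>l\<in>set cl. case l of (d, v, s, g) \<Rightarrow> s < S \<and> d \<le> 2 \<and> (v \<longrightarrow> d = 0) \<and> (6 \<le> i \<longrightarrow> d = 0 \<and> \<not> v))"
proof -
  have prp: "distinct cl \<and> (\<forall>l\<in>set cl. case l of (d, v, s, g) \<Rightarrow> s < S \<and> d \<le> 2 \<and> (v \<longrightarrow> d = 0))"
    if "cl \<in> set prop_clauses" for cl
    using that nxt_less unfolding prop_clauses_def by auto
  consider "cl = [(0, False, 0, True), (0, False, 0, False)]" | "cl \<in> set (raw_clauses i)"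
    using assms unfolding clauses_def by (auto simp: in_set_replicate)
  then show ?thesis
  proof cases
    case 1
    then show ?thesis using small_symbols by simp
  next
    case 2
    then show ?thesis using small_symbols prp[of cl] unfolding raw_clauses_def
      by (auto split: if_splits)
  qed
qed

end

section \<open>The clause game of a fixed input\<close>

context verifier_input
begin

lemma W2: "2 < W" using W H by simp

lemma C0: "0 < C" unfolding C_def by simp

definition var :: "nat \<Rightarrow> nat \<Rightarrow> nat" where "var k s = 1 + Kp * k + s"

text \<open>Clause \<open>Suc i\<close> is clause \<open>i mod C\<close> of cell
  \<open>i div C\<close>, and its pair comes after the \<open>S\<close> variables of that
  cell.\<close>

fun \<beta> :: "nat \<Rightarrow> nat" where
  "\<beta> 0 = 0"
| "\<beta> (Suc i) = 1 + Kp * (i div C) + S + i mod C"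

definition target :: "nat \<Rightarrow> slit \<Rightarrow> nat" where
  "target k l = (case l of (d, v, s, g) \<Rightarrow> k + d + (if v then W else 0))"

definition lv :: "nat \<Rightarrow> slit \<Rightarrow> nat" where
  "lv k l = (case l of (d, v, s, g) \<Rightarrow> (if g then 7 else 8) + 2 * var (target k l) s)"

definition cls :: "nat \<Rightarrow> nat \<Rightarrow> slit list" where
  "cls k c = clauses (kindf k) ! c"

definition Cl :: "nat \<Rightarrow> nat set" where
  "Cl c = lv ((c - 1) div C) ` set (cls ((c - 1) div C) ((c - 1) mod C))"

lemma vval_lit: "vval K k W (lit_vertex l) = lv k l"
  by (cases l) (auto simp: lv_def target_def var_def algebra_simps)

lemma cls_ok:
  assumes "k < N" "c < C"
  shows "distinct (cls k c)" "(d, v, s, g) \<in> set (cls k c) \<Longrightarrow> s < S \<and> d \<le> 2 \<and> (v \<longrightarrow> d = 0) \<and> target k (d, v, s, g) < N"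
proof -
  have in_cl: "cls k c \<in> set (clauses (kindf k))"
    unfolding cls_def using assms(2) length_clauses by (intro nth_mem) simp
  show "distinct (cls k c)" using clause_ok[OF in_cl] by simp
  assume l: "(d, v, s, g) \<in> set (cls k c)"
  have ok: "s < S" "d \<le> 2" "v \<longrightarrow> d = 0" "6 \<le> kindf k \<longrightarrow> d = 0 \<and> \<not> v"
    using clause_ok[OF in_cl] l by auto
  have "target k (d, v, s, g) < N"
  proof (cases "k < (T0 + 1) * W")
    case True
    then have "k + W < N" unfolding N by simp
    then show ?thesis using ok W2 unfolding target_def by auto
  next
    case False
    then have "\<not> k < W" by (simp add: algebra_simps)
    then have "kindf k = 6" using False W q unfolding kindf_def by auto
    then show ?thesis using ok assms(1) unfolding target_def by simp
  qed
  then show "s < S \<and> d \<le> 2 \<and> (v \<longrightarrow> d = 0) \<and> target k (d, v, s, g) < N" using ok by simp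
qed

lemma block_less: "\<lbrakk>k < N; j < Kp\<rbrakk> \<Longrightarrow> Kp * k + j < Kp * N"
  using mult_le_mono2[of "Suc k" N Kp] by simp

lemma index_less: "i < C * N \<Longrightarrow> i div C < N \<and> i mod C < C"
  using C0 by (simp add: less_mult_imp_div_less mult.commute)

lemma div_mod_block: "j < m \<Longrightarrow> (m * k + j) div m = k \<and> (m * k + j) mod m = j" for j k m :: nat
  by simp

lemma \<beta>_div: "i < C * N \<Longrightarrow> (\<beta> (Suc i) - 1) div Kp = i div C \<and> (\<beta> (Suc i) - 1) mod Kp = S + i mod C"
  using index_less[of i] div_mod_block[of "S + i mod C" Kp "i div C"] by (simp add: Kp_def add.assoc)

lemma var_div: "s < S \<Longrightarrow> (var k s - 1) div Kp = k \<and> (var k s - 1) mod Kp = s"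
  using div_mod_block[of s Kp k] unfolding var_def by (simp add: Kp_def)

text \<open>Apart from pair 0, the residue of the pair number minus 1 modulo \<open>Kp\<close>
  separates variables, below \<open>S\<close>, from clauses.\<close>

lemma vars_eq: "{..<1 + Kp * N} - \<beta> ` {..C * N} = {var k s | k s. k < N \<and> s < S}"
proof (intro equalityI subsetI)
  fix i assume i: "i \<in> {..<1 + Kp * N} - \<beta> ` {..C * N}"
  define k s where "k = (i - 1) div Kp" and "s = (i - 1) mod Kp"
  have "i \<noteq> \<beta> 0" using i by blast
  then have i1: "i = 1 + Kp * k + s" unfolding k_def s_def by simp
  have s: "s < Kp" unfolding s_def Kp_def using C0 by simp
  have "i - 1 < N * Kp" using i \<open>i \<noteq> \<beta> 0\<close> by (auto simp: mult.commute)
  then have k: "k < N" unfolding k_def by (rule less_mult_imp_div_less)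
  have "s < S"
  proof (rule ccontr)
    assume ns: "\<not> s < S"
    have lt: "s - S < C" using s ns unfolding Kp_def by simp
    have "\<beta> (Suc (C * k + (s - S))) = i" using div_mod_block[OF lt, of k] ns i1 by simp
    moreover have "C * k + (s - S) < C * N" using mult_le_mono2[of "Suc k" N C] k lt by simp
    ultimately have "i \<in> \<beta> ` {..C * N}" by (intro image_eqI[of _ _ "Suc (C * k + (s - S))"]) simp_all
    then show False using i by blast
  qed
  then show "i \<in> {var k s | k s. k < N \<and> s < S}" using i1 k unfolding var_def by blast
next
  fix i assume "i \<in> {var k s | k s. k < N \<and> s < S}"
  then obtain k s where i: "i = var k s" "k < N" "s < S" by auto
  have "i < 1 + Kp * N" unfolding i(1) var_def using block_less[of k s] i by (simp add: Kp_def)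
  moreover have "i \<noteq> \<beta> c" if "c \<le> C * N" for c
  proof (cases c)
    case 0
    then show ?thesis unfolding i(1) var_def by simp
  next
    case (Suc j)
    then have "(\<beta> c - 1) mod Kp = S + j mod C" using \<beta>_div[of j] that by simp
    then show ?thesis using var_div[OF i(3), of k] i by auto
  qed
  ultimately show "i \<in> {..<1 + Kp * N} - \<beta> ` {..C * N}" by blast
qed

sublocale game: clause_game "1 + Kp * N" "C * N" \<beta> Cl
proof
  show "\<beta> 0 = 0" by simp
  show "inj_on \<beta> {..C * N}"
  proof (rule inj_onI)
    fix a b assume ab: "a \<in> {..C * N}" "b \<in> {..C * N}" "\<beta> a = \<beta> b"
    show "a = b"
    proof (cases "a = 0 \<or> b = 0")
      case True
      then show ?thesis using ab(3) by (cases a; cases b) auto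
    next
      case False
      then obtain i j where ij: "a = Suc i" "b = Suc j" by (metis not0_implies_Suc)
      have "i < C * N" "j < C * N" using ab ij by simp_all
      then have "i div C = j div C" "S + i mod C = S + j mod C"
        using \<beta>_div[of i] \<beta>_div[of j] ab(3) unfolding ij by metis+
      then show ?thesis unfolding ij by (metis add_left_cancel mult_div_mod_eq)
    qed
  qed
  show "\<beta> c < 1 + Kp * N" if "c \<le> C * N" for c
  proof (cases c)
    case (Suc i)
    then show ?thesis using index_less[of i] block_less[of "i div C" "S + i mod C"] that by (simp add: Kp_def)
  qed simp
  fix c l assume c: "1 \<le> c" "c \<le> C * N" "l \<in> Cl c"
  then have "c - 1 < C * N" by linarith
  then have lt: "(c - 1) div C < N" "(c - 1) mod C < C" using index_less[of "c - 1"] by simp_all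
  obtain d v s g where e: "(d, v, s, g) \<in> set (cls ((c - 1) div C) ((c - 1) mod C))" "l = lv ((c - 1) div C) (d, v, s, g)"
    using c(3) unfolding Cl_def by auto
  have "s < S" "target ((c - 1) div C) (d, v, s, g) < N" using cls_ok(2)[OF lt e(1)] by auto
  moreover have "l = 7 + 2 * var (target ((c - 1) div C) (d, v, s, g)) s
      \<or> l = 8 + 2 * var (target ((c - 1) div C) (d, v, s, g)) s"
    unfolding e(2) lv_def by auto
  ultimately show "\<exists>i\<in>{..<1 + Kp * N} - \<beta> ` {..C * N}. l = 7 + 2 * i \<or> l = 8 + 2 * i"
    unfolding vars_eq by blast
qed

end

lemma enc_blocks_map: "enc_blocks K W 0 (map f [0..<N]) = concat (map (\<lambda>k. enc_block K k W (f k)) [0..<N])"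
  by (induction N) (simp_all add: enc_blocks_append)

lemma enc_block_vertices:
  "concat (map enc_vertices (concat (map (\<lambda>k. map (map (vval K k W)) (f k)) ks))) = concat (map (\<lambda>k. enc_block K k W (f k)) ks)"
  by (induction ks) (simp_all add: enc_block_def comp_def)

lemma map_upt_const:
  assumes "\<And>k. \<lbrakk>s \<le> k; k < s + m\<rbrakk> \<Longrightarrow> g k = a"
  shows "map g [s..<s + m] = concat (map (\<lambda>_. [a]) [0..<m])"
  using assms by (induction m) simp_all

lemma concat_const_rows:
  "concat (map (\<lambda>_. concat (map (\<lambda>_. [a]) [0..<W])) [0..<T]) = concat (map (\<lambda>_. [a]) [0..<T * W])"
proof -
  have r: "concat (map (\<lambda>_. [a]) [0..<m]) = replicate m a" for m
    by (induction m) (simp_all add: replicate_append_same)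
  show ?thesis unfolding r by (induction T) (simp_all add: replicate_add[symmetric] add.commute)
qed

lemma accepting_iff_halted:
  assumes "halted (tm_run M t0 y)"
  shows "(\<exists>t. accepting (tm_run M t y)) \<longleftrightarrow> accepting (tm_run M t0 y)"
proof
  assume "\<exists>t. accepting (tm_run M t y)"
  then obtain t where t: "accepting (tm_run M t y)" by blast
  then have "halted (tm_run M t y)" unfolding accepting_def halted_def by simp
  then have "tm_run M t0 y = tm_run M t y"
    using halted_stays[OF assms, of t] halted_stays[of M t y t0] by (metis nat_le_linear)
  then show "accepting (tm_run M t0 y)" using t by simp
qed blast

section \<open>The printed lists and the edges of the game\<close>

context verifier_input
begin

text \<open>The program lists the cells segment by segment, whereas \<open>kindf\<close> determines
  the kind from the position; both give the same sequence.\<close>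

lemma blocks_kindf:
  "concat (map (\<lambda>_. [f 0]) [0..<H]) @ [f 1] @
     concat (map (\<lambda>j. [f 2] @ (if x ! j then [f 3] else [f 2])) [0..<n]) @ [f 3] @ [f 3] @
     concat (map (\<lambda>_. [f 4]) [0..<p]) @ [f 0] @
     concat (map (\<lambda>_. concat (map (\<lambda>_. [f 5]) [0..<W])) [0..<T0]) @
     concat (map (\<lambda>_. [f 6]) [0..<W]) = map (\<lambda>k. f (kindf k)) [0..<N]"
proof -
  let ?g = "\<lambda>k. f (kindf k)"
  \<comment> \<open>The interval below \<open>N\<close> is cut into one subinterval per printed
    segment.\<close>
  have N_eq: "N = (((((H + 1 + 2 * n) + 1) + 1 + p) + 1) + T0 * W) + W"
    unfolding N W q by (simp add: algebra_simps)
  have split: "map ?g [0..<a + m] = map ?g [0..<a] @ map ?g [a..<a + m]" for a m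
    by (simp only: upt_add_eq_append[OF le0] map_append)
  have Wq: "W = H + 1 + 2 * n + 2 + p + 1" unfolding W q by simp
  have s0: "map ?g [0..<H] = concat (map (\<lambda>_. [f 0]) [0..<H])"
    using map_upt_const[of 0 H ?g "f 0"] by (simp add: kindf_def)
  have s1: "map ?g [H..<H + 1] = [f 1]" by (simp add: kindf_def)
  have "map ?g [H + 1..<H + 1 + 2 * m] = concat (map (\<lambda>j. [f 2] @ (if x ! j then [f 3] else [f 2])) [0..<m])"
    if "m \<le> n" for m
    using that
  proof (induction m)
    case (Suc m)
    have k: "kindf (H + 1 + 2 * m) = 2" "kindf (Suc (H + 1 + 2 * m)) = (if x ! m then 3 else 2)"
      using Suc.prems unfolding kindf_def by simp_all
    have "[H + 1..<H + 1 + 2 * Suc m] = [H + 1..<H + 1 + 2 * m] @ [H + 1 + 2 * m, Suc (H + 1 + 2 * m)]" by simp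
    then have "map ?g [H + 1..<H + 1 + 2 * Suc m] = map ?g [H + 1..<H + 1 + 2 * m] @ [f 2, f (if x ! m then 3 else 2)]"
      using k by (simp only: map_append list.map)
    then show ?case using Suc by simp
  qed simp
  then have s2: "map ?g [H + 1..<H + 1 + 2 * n] = concat (map (\<lambda>j. [f 2] @ (if x ! j then [f 3] else [f 2])) [0..<n])"
    by simp
  have s3: "map ?g [H + 1 + 2 * n..<H + 1 + 2 * n + 1] = [f 3]" by (simp add: kindf_def)
  have s4: "map ?g [H + 1 + 2 * n + 1..<H + 1 + 2 * n + 1 + 1] = [f 3]" by (simp add: kindf_def)
  have s5: "map ?g [H + 1 + 2 * n + 1 + 1..<H + 1 + 2 * n + 1 + 1 + p] = concat (map (\<lambda>_. [f 4]) [0..<p])"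
  proof (rule map_upt_const)
    fix k assume "H + 1 + 2 * n + 1 + 1 \<le> k" "k < H + 1 + 2 * n + 1 + 1 + p"
    then show "f (kindf k) = f 4" unfolding kindf_def using q by auto
  qed
  have s6: "map ?g [H + 1 + 2 * n + 1 + 1 + p..<H + 1 + 2 * n + 1 + 1 + p + 1] = [f 0]"
  proof -
    have "kindf (H + 1 + 2 * n + 1 + 1 + p) = 0" unfolding kindf_def using q Wq by auto
    then show ?thesis by simp
  qed
  have s7: "map ?g [H + 1 + 2 * n + 1 + 1 + p + 1..<H + 1 + 2 * n + 1 + 1 + p + 1 + T0 * W]
      = concat (map (\<lambda>_. [f 5]) [0..<T0 * W])"
  proof (rule map_upt_const)
    fix k assume k: "H + 1 + 2 * n + 1 + 1 + p + 1 \<le> k" "k < H + 1 + 2 * n + 1 + 1 + p + 1 + T0 * W"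
    then have "W \<le> k" "k < (T0 + 1) * W" using Wq by simp_all
    then show "f (kindf k) = f 5" unfolding kindf_def using W q by auto
  qed
  have s8: "map ?g [H + 1 + 2 * n + 1 + 1 + p + 1 + T0 * W..<H + 1 + 2 * n + 1 + 1 + p + 1 + T0 * W + W]
      = concat (map (\<lambda>_. [f 6]) [0..<W])"
  proof (rule map_upt_const)
    fix k assume k: "H + 1 + 2 * n + 1 + 1 + p + 1 + T0 * W \<le> k"
    then have "W \<le> k" "\<not> k < (T0 + 1) * W" using Wq by simp_all
    then show "f (kindf k) = f 6" unfolding kindf_def using W q by auto
  qed
  show ?thesis
    unfolding N_eq split s8 s7 s6 s5 s4 s3 s2 s1 s0 concat_const_rows by (simp only: append_assoc)
qed

lemma lit_eq_lv:
  "game.lit \<tau> i = lv k (d, v, s, g) \<longleftrightarrow> \<tau> i = g \<and> i = var (target k (d, v, s, g)) s"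
  unfolding game.lit_def lv_def by (auto; presburger)

lemma clause_index:
  assumes "k < N" "c < C"
  shows "C * k + c < C * N" "(C * k + c) div C = k" "(C * k + c) mod C = c"
  using assms mult_le_mono2[of "Suc k" N C] div_mod_block[of c C k] by simp_all

lemma Cl_index: "\<lbrakk>k < N; c < C\<rbrakk> \<Longrightarrow> Cl (Suc (C * k + c)) = lv k ` set (cls k c)"
  unfolding Cl_def using clause_index by simp

lemma game_sat_iff: "game.sat \<longleftrightarrow> (\<exists>X. sat X)"
proof
  assume game.sat
  then obtain \<tau> where \<tau>: "\<And>c. \<lbrakk>1 \<le> c; c \<le> C * N\<rbrakk> \<Longrightarrow> \<exists>i\<in>game.Vars. game.lit \<tau> i \<in> Cl c"
    unfolding game.sat_def by blast
  have "clauses_hold (\<lambda>k s. \<tau> (var k s)) W k (kindf k)" if k: "k < N" for k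
    unfolding clauses_hold_def
  proof
    fix cl assume "cl \<in> set (clauses (kindf k))"
    then obtain c where c: "c < C" "cl = cls k c"
      unfolding cls_def in_set_conv_nth length_clauses by auto
    obtain i where "game.lit \<tau> i \<in> lv k ` set (cls k c)"
      using \<tau>[of "Suc (C * k + c)"] clause_index[OF k c(1)] Cl_index[OF k c(1)] by auto
    then obtain d v s g where l: "(d, v, s, g) \<in> set (cls k c)" "game.lit \<tau> i = lv k (d, v, s, g)" by auto
    then have "lit_holds (\<lambda>k s. \<tau> (var k s)) W k (d, v, s, g)"
      unfolding lit_eq_lv target_def by auto
    then show "\<exists>l\<in>set cl. lit_holds (\<lambda>k s. \<tau> (var k s)) W k l" using l(1) c(2) by blast
  qed
  then show "\<exists>X. sat X" unfolding sat_def by blast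
next
  assume "\<exists>X. sat X"
  then obtain X where X: "\<And>k. k < N \<Longrightarrow> clauses_hold X W k (kindf k)" unfolding sat_def by blast
  define \<tau> where "\<tau> i = X ((i - 1) div Kp) ((i - 1) mod Kp)" for i
  have "\<exists>i\<in>game.Vars. game.lit \<tau> i \<in> Cl c" if c: "1 \<le> c" "c \<le> C * N" for c
  proof -
    define k j where "k = (c - 1) div C" and "j = (c - 1) mod C"
    have "c - 1 < C * N" using c by linarith
    then have kj: "k < N" "j < C" using index_less unfolding k_def j_def by simp_all
    have "cls k j \<in> set (clauses (kindf k))"
      unfolding cls_def using kj(2) length_clauses by (intro nth_mem) simp
    then obtain d v s g where l: "(d, v, s, g) \<in> set (cls k j)" "lit_holds X W k (d, v, s, g)"
      using X[OF kj(1)] unfolding clauses_hold_def by fastforce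
    have ok: "s < S" "target k (d, v, s, g) < N" using cls_ok(2)[OF kj l(1)] by simp_all
    let ?i = "var (target k (d, v, s, g)) s"
    have "\<tau> ?i = g" using l(2) var_div[OF ok(1)] unfolding \<tau>_def target_def by simp
    then have "game.lit \<tau> ?i = lv k (d, v, s, g)" unfolding lit_eq_lv by simp
    then have "game.lit \<tau> ?i \<in> Cl c" unfolding Cl_def k_def[symmetric] j_def[symmetric] using l(1) by simp
    moreover have "?i \<in> game.Vars" unfolding game.Vars_def vars_eq using ok by blast
    ultimately show ?thesis by blast
  qed
  then show game.sat unfolding game.sat_def by blast
qed

definition b\<^sub>c :: "nat \<Rightarrow> nat \<Rightarrow> nat" where "b\<^sub>c k c = 9 + 2 * (Kp * k + (S + c))"

definition edge :: "nat \<Rightarrow> nat \<Rightarrow> slit \<Rightarrow> nat list" where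
  "edge k c l = (if local_lit l then [lv k l, b\<^sub>c k c, Suc (b\<^sub>c k c)] else [b\<^sub>c k c, Suc (b\<^sub>c k c), lv k l])"

definition pair_edges :: "nat \<Rightarrow> nat list list" where
  "pair_edges k = map (\<lambda>s. [7 + 2 * var k s, 8 + 2 * var k s]) [0..<S]"

definition clause_edges :: "nat \<Rightarrow> nat list list" where
  "clause_edges k = concat (map (\<lambda>c. map (edge k c) (cls k c)) [0..<C])"

definition blue_lists :: "nat list list" where
  "blue_lists = [[7, 8], [0, 1, 7], [0, 2, 7]] @ concat (map (\<lambda>k. pair_edges k @ clause_edges k) [0..<N])"

definition red_lists :: "nat list list" where
  "red_lists = [[3, 4], [4, 5], [5, 6], [3, 6]] @
     concat (map (\<lambda>k. map (\<lambda>c. [if c = 0 then 8 + K * k else b\<^sub>c k c - 1, b\<^sub>c k c]) [0..<C]) [0..<N])"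

lemma kd_lists: "map (map (vval K k W)) (kd (kindf k)) = pair_edges k @ clause_edges k"
proof -
  have "map (vval K k W) (clause_edge c l) = edge k c l" for c l
    unfolding clause_edge_def edge_def Let_def using vval_lit[of k l] by (simp add: b\<^sub>c_def del: lit_vertex.simps)
  then show ?thesis
    unfolding kd_def pair_edges_def clause_edges_def cls_def
    by (simp add: map_concat comp_def var_def)
qed

lemma red_block: "map (map (vval K k W)) red = map (\<lambda>c. [if c = 0 then 8 + K * k else b\<^sub>c k c - 1, b\<^sub>c k c]) [0..<C]"
  unfolding red_def by (simp add: b\<^sub>c_def)

lemma b_index:
  assumes "k < N" "c < C"
  shows "game.b (Suc (C * k + c)) = b\<^sub>c k c" "game.d (Suc (C * k + c)) = Suc (b\<^sub>c k c)"
    "game.d (C * k + c) = (if c = 0 then 8 + K * k else b\<^sub>c k c - 1)"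
proof -
  show "game.b (Suc (C * k + c)) = b\<^sub>c k c" "game.d (Suc (C * k + c)) = Suc (b\<^sub>c k c)"
    unfolding game.b_def game.d_def b\<^sub>c_def using clause_index[OF assms] by simp_all
  show "game.d (C * k + c) = (if c = 0 then 8 + K * k else b\<^sub>c k c - 1)"
  proof (cases c)
    case 0
    show ?thesis
    proof (cases k)
      case (Suc j)
      \<comment> \<open>The predecessor of the first clause of a cell is the last clause of the cell
        before.\<close>
      have eq: "C * k + c = Suc (C * j + (C - 1))" using 0 Suc C0 by simp
      have j: "(C * j + (C - 1)) div C = j" "(C * j + (C - 1)) mod C = C - 1"
        using clause_index(2,3)[of j "C - 1"] C0 assms(1) Suc by simp_all
      have "game.d (C * k + c) = 8 + 2 * (1 + Kp * j + S + (C - 1))"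
        unfolding game.d_def eq \<beta>.simps j ..
      also have "\<dots> = 8 + K * k" using C0 unfolding Suc by (simp add: Kp_def)
      finally show ?thesis using 0 by simp
    qed (use 0 in \<open>simp add: game.d_def\<close>)
  next
    case (Suc j)
    then show ?thesis unfolding game.d_def b\<^sub>c_def using clause_index(2,3)[of k j] assms by simp
  qed
qed

lemma set_edge: "set (edge k c l) = {b\<^sub>c k c, Suc (b\<^sub>c k c), lv k l}"
  unfolding edge_def by auto

lemma index_cases:
  assumes "i < C * N"
  obtains k c where "k < N" "c < C" "i = C * k + c"
  using index_less[OF assms] that[of "i div C" "i mod C"] by simp

lemma set_blue_lists: "set ` set blue_lists = game.EL"
proof -
  have A: "{{7 + 2 * i, 8 + 2 * i} | i. i \<in> game.Vars} = (\<Union>k<N. set ` set (pair_edges k))"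
    unfolding game.Vars_def vars_eq pair_edges_def by (fastforce simp: image_image)
  have B: "{{game.b c, game.d c, l} | c l. 1 \<le> c \<and> c \<le> C * N \<and> l \<in> Cl c} = (\<Union>k<N. set ` set (clause_edges k))"
  proof (intro equalityI subsetI)
    fix e assume "e \<in> {{game.b c, game.d c, l} | c l. 1 \<le> c \<and> c \<le> C * N \<and> l \<in> Cl c}"
    then obtain c l where c: "1 \<le> c" "c \<le> C * N" "l \<in> Cl c" "e = {game.b c, game.d c, l}" by blast
    then obtain i where i: "c = Suc i" "i < C * N" by (cases c) auto
    obtain k j where kj: "k < N" "j < C" "i = C * k + j" by (rule index_cases[OF i(2)])
    obtain l' where l': "l' \<in> set (cls k j)" "l = lv k l'" using c(3) Cl_index[OF kj(1,2)] i kj(3) by auto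
    have "e = set (edge k j l')" using c(4) b_index[OF kj(1,2)] i(1) kj(3) l'(2) set_edge by simp
    moreover have "edge k j l' \<in> set (clause_edges k)" unfolding clause_edges_def using kj l' by auto
    ultimately show "e \<in> (\<Union>k<N. set ` set (clause_edges k))" using kj(1) by blast
  next
    fix e assume "e \<in> (\<Union>k<N. set ` set (clause_edges k))"
    then obtain k j l where kj: "k < N" "j < C" "l \<in> set (cls k j)" "e = set (edge k j l)"
      unfolding clause_edges_def by auto
    have "e = {game.b (Suc (C * k + j)), game.d (Suc (C * k + j)), lv k l}"
      using kj(4) b_index[OF kj(1,2)] set_edge by simp
    moreover have "lv k l \<in> Cl (Suc (C * k + j))" using Cl_index[OF kj(1,2)] kj(3) by simp
    moreover have "Suc (C * k + j) \<le> C * N" using clause_index(1)[OF kj(1,2)] by simp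
    ultimately show "e \<in> {{game.b c, game.d c, l} | c l. 1 \<le> c \<and> c \<le> C * N \<and> l \<in> Cl c}" by fastforce
  qed
  have "set ` set blue_lists = {{7, 8}, {0, 1, 7}, {0, 2, 7}} \<union> (\<Union>k<N. set ` set (pair_edges k)) \<union> (\<Union>k<N. set ` set (clause_edges k))"
    unfolding blue_lists_def by (simp add: image_Un image_UN UN_Un_distrib lessThan_atLeast0 Un_assoc)
  then show ?thesis unfolding game.EL_def A B by (simp only: Un_ac)
qed

lemma set_red_lists: "set ` set red_lists = game.ER"
proof -
  have "{{game.d c, game.b (Suc c)} | c. c < C * N}
    = (\<Union>k<N. (\<lambda>c. {if c = 0 then 8 + K * k else b\<^sub>c k c - 1, b\<^sub>c k c}) ` {..<C})"
  proof (intro equalityI subsetI)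
    fix e assume "e \<in> {{game.d c, game.b (Suc c)} | c. c < C * N}"
    then obtain i where i: "i < C * N" "e = {game.d i, game.b (Suc i)}" by blast
    obtain k j where kj: "k < N" "j < C" "i = C * k + j" by (rule index_cases[OF i(1)])
    then have "e = {if j = 0 then 8 + K * k else b\<^sub>c k j - 1, b\<^sub>c k j}" using i(2) b_index[OF kj(1,2)] by simp
    then show "e \<in> (\<Union>k<N. (\<lambda>c. {if c = 0 then 8 + K * k else b\<^sub>c k c - 1, b\<^sub>c k c}) ` {..<C})" using kj by blast
  next
    fix e assume "e \<in> (\<Union>k<N. (\<lambda>c. {if c = 0 then 8 + K * k else b\<^sub>c k c - 1, b\<^sub>c k c}) ` {..<C})"
    then obtain k j where kj: "k < N" "j < C" "e = {if j = 0 then 8 + K * k else b\<^sub>c k j - 1, b\<^sub>c k j}" by blast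
    then have "e = {game.d (C * k + j), game.b (Suc (C * k + j))}" using b_index[OF kj(1,2)] by simp
    then show "e \<in> {{game.d c, game.b (Suc c)} | c. c < C * N}" using clause_index(1)[OF kj(1,2)] by blast
  qed
  then show ?thesis
    unfolding red_lists_def game.ER_def
    by (simp add: image_Un image_UN image_image lessThan_atLeast0 Un_ac)
qed

end

section \<open>No repeated edges, and increasing vertices in each edge\<close>

context verifier_input
begin

text \<open>The pair to which a vertex belongs; clause pairs are recognized by their residue modulo \<open>Kp\<close>.\<close>

definition code :: "nat \<Rightarrow> nat" where "code v = (v - 9) div 2"

lemma code_lv: "code (lv k (d, v, s, g)) = Kp * target k (d, v, s, g) + s"
  unfolding code_def lv_def var_def by simp

lemma code_b: "code (b\<^sub>c k c) = Kp * k + (S + c)" "code (b\<^sub>c k c - 1) = Kp * k + (S + c) - 1"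
  unfolding code_def b\<^sub>c_def by simp_all

lemma code_b_div:
  assumes "c < C"
  shows "code (b\<^sub>c k c) div Kp = k" "code (b\<^sub>c k c) mod Kp = S + c"
  unfolding code_b using div_mod_block[of "S + c" Kp k] assms by (simp_all add: Kp_def)

lemma code_lv_div:
  assumes "k < N" "c < C" "(d, v, s, g) \<in> set (cls k c)"
  shows "code (lv k (d, v, s, g)) div Kp = target k (d, v, s, g)" "code (lv k (d, v, s, g)) mod Kp = s" "s < S"
proof -
  show "s < S" using cls_ok(2)[OF assms] by simp
  then show "code (lv k (d, v, s, g)) div Kp = target k (d, v, s, g)" "code (lv k (d, v, s, g)) mod Kp = s"
    unfolding code_lv using div_mod_block[of s Kp] by (simp_all add: Kp_def)
qed

text \<open>The literal is the first or the last entry of a clause edge, and the residue of the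
  first entry tells which; this finds \<open>b\<^sub>c\<close> and with it the cell and the
  clause.\<close>

definition clause_vertex :: "nat list \<Rightarrow> nat" where
  "clause_vertex e = (if code (e ! 0) mod Kp < S then e ! 1 else e ! 0)"

lemma clause_vertex_edge:
  assumes "k < N" "c < C" "l \<in> set (cls k c)"
  shows "clause_vertex (edge k c l) = b\<^sub>c k c"
proof -
  obtain d v s g where l: "l = (d, v, s, g)" by (cases l)
  show ?thesis
    using code_lv_div[OF assms(1,2)] assms(3) code_b_div[OF assms(2), of k] unfolding l clause_vertex_def edge_def by auto
qed

text \<open>The offset is 0, 1 or 2 inside the row, or exactly \<open>W\<close>, which exceeds 2. So
  the target cell determines both offsets, the residue the symbol, and the parity the sign.\<close>

lemma lv_inj:
  assumes k: "k < N" "c < C" and l: "l \<in> set (cls k c)" "l' \<in> set (cls k c)" and eq: "lv k l = lv k l'"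
  shows "l = l'"
proof -
  obtain d v s g d' v' s' g' where e: "l = (d, v, s, g)" "l' = (d', v', s', g')" by (cases l; cases l')
  note c = code_lv_div[OF k l(1)[unfolded e]] code_lv_div[OF k l(2)[unfolded e]]
  have "s = s'" "target k (d, v, s, g) = target k (d', v', s', g')" using c eq unfolding e by metis+
  moreover have "g = g'" using eq unfolding e lv_def by (auto split: if_splits; presburger)
  moreover have "d \<le> 2" "v \<longrightarrow> d = 0" "d' \<le> 2" "v' \<longrightarrow> d' = 0"
    using cls_ok(2)[OF k l(1)[unfolded e]] cls_ok(2)[OF k l(2)[unfolded e]] by simp_all
  ultimately show ?thesis unfolding e target_def using W2 by (cases v; cases v') auto
qed

lemma edge_inj:
  assumes k: "k < N" "c < C" and l: "l \<in> set (cls k c)" "l' \<in> set (cls k c)" and eq: "edge k c l = edge k c l'"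
  shows "l = l'"
proof -
  have "lv k l \<noteq> b\<^sub>c k c" if "l \<in> set (cls k c)" for l
  proof
    assume eq: "lv k l = b\<^sub>c k c"
    obtain d v s g where l: "l = (d, v, s, g)" by (cases l)
    note * = code_lv_div(2,3)[OF k that[unfolded l]]
    show False using * code_b_div(2)[OF k(2), of k] eq unfolding l by simp
  qed
  then have "lv k l = lv k l'" using eq l unfolding edge_def by (auto split: if_splits)
  then show ?thesis by (rule lv_inj[OF k l])
qed

lemma distinct_clause_edges: "k < N \<Longrightarrow> distinct (clause_edges k)"
  unfolding clause_edges_def
proof (rule distinct_concat_keyed[where key = "\<lambda>e. code (clause_vertex e) mod Kp - S"])
  fix c assume c: "k < N" "c \<in> set [0..<C]"
  then have c': "c < C" by simp
  show "distinct (map (edge k c) (cls k c))"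
    using cls_ok(1)[OF c(1) c'] edge_inj[OF c(1) c'] by (simp add: distinct_map inj_on_def)
  fix e assume "e \<in> set (map (edge k c) (cls k c))"
  then show "code (clause_vertex e) mod Kp - S = c"
    using clause_vertex_edge[OF c(1) c'] code_b_div(2)[OF c', of k] by auto
qed simp

lemma length_edge: "length (edge k c l) = 3"
  unfolding edge_def by simp

lemma clause_edgesE:
  assumes "e \<in> set (clause_edges k)"
  obtains c l where "c < C" "l \<in> set (cls k c)" "e = edge k c l"
  using assms unfolding clause_edges_def by auto

lemma edge_ge:
  assumes "v \<in> set (edge k c l)" shows "9 \<le> v"
  using assms unfolding edge_def lv_def var_def b\<^sub>c_def by (cases l) (auto split: if_splits)

lemma distinct_blue_lists: "distinct blue_lists"
proof -
  \<comment> \<open>The key reads the cell from the variable pair in edges of length 2 and from the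
    clause pair in the others, since the literal of a clause may lie in another cell.\<close>
  have "distinct (concat (map (\<lambda>k. pair_edges k @ clause_edges k) [0..<N]))"
  proof (rule distinct_concat_keyed[where key = "\<lambda>e. code (if length e = 2 then e ! 0 else clause_vertex e) div Kp"])
    fix k assume "k \<in> set [0..<N]"
    then have k: "k < N" by simp
    have "distinct (pair_edges k)" unfolding pair_edges_def by (simp add: distinct_map inj_on_def var_def)
    moreover have "set (pair_edges k) \<inter> set (clause_edges k) = {}"
    proof -
      have "length e = 2" if "e \<in> set (pair_edges k)" for e using that unfolding pair_edges_def by auto
      moreover have "length e = 3" if "e \<in> set (clause_edges k)" for e using that length_edge by (metis clause_edgesE)
      ultimately show ?thesis by fastforce
    qed
    ultimately show "distinct (pair_edges k @ clause_edges k)" using distinct_clause_edges[OF k] by simp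
    fix e assume "e \<in> set (pair_edges k @ clause_edges k)"
    then consider "e \<in> set (pair_edges k)" | "e \<in> set (clause_edges k)" by auto
    then show "code (if length e = 2 then e ! 0 else clause_vertex e) div Kp = k"
    proof cases
      case 1
      then obtain s where s: "s < S" "e = [7 + 2 * var k s, 8 + 2 * var k s]" unfolding pair_edges_def by auto
      have "code (e ! 0) = Kp * k + s" unfolding s(2) code_def var_def by simp
      then show ?thesis using s div_mod_block[of s Kp k] by (simp add: Kp_def)
    next
      case 2
      then obtain c l where e: "c < C" "l \<in> set (cls k c)" "e = edge k c l" by (rule clause_edgesE)
      then show ?thesis using clause_vertex_edge[OF k e(1,2)] code_b_div(1)[OF e(1), of k] length_edge by simp
    qed
  qed simp
  moreover have "9 \<le> e ! 0" if "e \<in> set (concat (map (\<lambda>k. pair_edges k @ clause_edges k) [0..<N]))" for e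
  proof -
    from that obtain k where "e \<in> set (pair_edges k) \<or> e \<in> set (clause_edges k)" by auto
    then show ?thesis
    proof
      assume "e \<in> set (pair_edges k)"
      then show ?thesis unfolding pair_edges_def var_def by auto
    next
      assume "e \<in> set (clause_edges k)"
      then obtain c l where "e = edge k c l" by (rule clause_edgesE)
      then show ?thesis using edge_ge[of "e ! 0" k c l] length_edge[of k c l] by simp
    qed
  qed
  ultimately show ?thesis unfolding blue_lists_def by fastforce
qed

lemma distinct_red_lists: "distinct red_lists"
proof -
  let ?R = "\<lambda>k c. [if c = 0 then 8 + K * k else b\<^sub>c k c - 1, b\<^sub>c k c]"
  have "distinct (concat (map (\<lambda>k. map (?R k) [0..<C]) [0..<N]))"
  proof (rule distinct_concat_keyed[where key = "\<lambda>e. code (e ! 1) div Kp"])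
    fix k
    show "distinct (map (?R k) [0..<C])" by (auto simp: distinct_map inj_on_def b\<^sub>c_def)
    show "code (e ! 1) div Kp = k" if "e \<in> set (map (?R k) [0..<C])" for e
      using that code_b_div(1) by auto
  qed simp
  moreover have "9 \<le> e ! 1" if "e \<in> set (concat (map (\<lambda>k. map (?R k) [0..<C]) [0..<N]))" for e
    using that unfolding b\<^sub>c_def by auto
  ultimately show ?thesis unfolding red_lists_def by fastforce
qed

lemma sorted_lists:
  assumes "vs \<in> set blue_lists \<union> set red_lists"
  shows "sorted_wrt (<) vs"
proof -
  have edge: "sorted_wrt (<) (edge k c l)" if k: "k < N" "c < C" "l \<in> set (cls k c)" for k c l
  proof -
    obtain d v s g where l: "l = (d, v, s, g)" by (cases l)
    have s: "s < S" using cls_ok(2)[OF k(1,2)] k(3) l by simp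
    show ?thesis
    proof (cases "local_lit l")
      case True
      then have "lv k l \<le> 8 + 2 * var k s" unfolding l lv_def target_def by simp
      also have "\<dots> < b\<^sub>c k c" using s unfolding var_def b\<^sub>c_def by simp
      finally show ?thesis using True unfolding edge_def by simp
    next
      case False
      \<comment> \<open>A literal outside the own cell is at least one cell further on, hence beyond
        all pairs of cell \<open>k\<close>.\<close>
      then have "k + 1 \<le> target k l" using W2 unfolding l target_def by auto
      then have "Kp * (k + 1) \<le> Kp * target k l" by (rule mult_le_mono2)
      then have "Kp * k + (S + C) \<le> Kp * target k l" unfolding Kp_def by (simp add: algebra_simps)
      moreover have "9 + 2 * (Kp * target k l) \<le> lv k l" unfolding l lv_def var_def by simp
      moreover have "Suc (9 + 2 * (u + (a + c))) < z" if "u + (a + c') \<le> v" "9 + 2 * v \<le> z" "c < c'"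
        for u v z a c' :: nat
      proof -
        have "u + (a + c) + 1 \<le> v" using that(1,3) by simp
        then show ?thesis using that(2) by simp
      qed
      ultimately have "Suc (b\<^sub>c k c) < lv k l" unfolding b\<^sub>c_def using k(2) by blast
      then show ?thesis using False unfolding edge_def by simp
    qed
  qed
  have "sorted_wrt (<) vs" if "vs \<in> set blue_lists"
  proof -
    have "vs \<in> set [[7, 8], [0, 1, 7], [0, 2, 7]] \<or> (\<exists>k<N. vs \<in> set (pair_edges k) \<or> vs \<in> set (clause_edges k))"
      using that unfolding blue_lists_def by auto
    then show ?thesis
      using edge by (auto simp: pair_edges_def elim!: clause_edgesE)
  qed
  moreover have "sorted_wrt (<) vs" if "vs \<in> set red_lists"
    using that unfolding red_lists_def by (auto simp: b\<^sub>c_def split: if_splits)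
  ultimately show ?thesis using assms by blast
qed

definition string :: "bool list" where
  "string = enc_unary (9 + K * N) @ tok_eend @ concat (map enc_vertices blue_lists) @
     tok_sep @ concat (map enc_vertices red_lists)"

theorem string_in_lang_iff:
  "string \<in> achievement_pos_lang 3 2 \<longleftrightarrow> (\<exists>w. length w \<le> p \<and> accepting (tm_run M T0 (pair_enc x w)))"
proof -
  have n: "9 + K * N = 7 + 2 * (1 + Kp * N)" by simp
  have enc: "encodes_instance string (9 + K * N) game.EL game.ER"
    using encodes_lists[OF distinct_blue_lists distinct_red_lists sorted_lists, of "9 + K * N"]
    unfolding string_def set_blue_lists set_red_lists by simp
  have valid: "valid_instance 3 2 (9 + K * N) game.EL game.ER" unfolding n by (rule game.valid_game)
  have fin: "finite e" if "valid_instance 3 2 m EL ER" "e \<in> EL \<union> ER" for m EL ER e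
    using that unfolding valid_instance_def hypergraph_on_def by (meson UnE finite_lessThan finite_subset)
  have "string \<in> achievement_pos_lang 3 2 \<longleftrightarrow> left_wins_first (9 + K * N) game.EL game.ER"
  proof
    assume "string \<in> achievement_pos_lang 3 2"
    then obtain m EL ER where 1: "valid_instance 3 2 m EL ER" "encodes_instance string m EL ER" "left_wins_first m EL ER"
      unfolding achievement_pos_lang_def by blast
    then have "m = 9 + K * N \<and> EL = game.EL \<and> ER = game.ER"
      by (intro encodes_instance_unique[OF 1(2) enc]) (use fin[OF valid] fin[OF 1(1)] in blast)
    then show "left_wins_first (9 + K * N) game.EL game.ER" using 1(3) by simp
  next
    assume "left_wins_first (9 + K * N) game.EL game.ER"
    then show "string \<in> achievement_pos_lang 3 2"
      unfolding achievement_pos_lang_def using valid enc by blast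
  qed
  also have "\<dots> \<longleftrightarrow> game.sat" unfolding n by (rule game.left_wins_first_iff_sat)
  finally show ?thesis using game_sat_iff sat_iff by simp
qed

end

section \<open>Correctness of the printed string\<close>

context verifier
begin

lemma reduction_correct:
  "reduction_string x \<in> achievement_pos_lang 3 2 \<longleftrightarrow>
     (\<exists>w. length w \<le> wit_len (length x) \<and> accepting (tm_run M (steps (length x)) (pair_enc x w)))"
proof -
  let ?n = "length x"
  interpret verifier_input Q G \<delta> c1 k1 c2 k2 x ?n "wit_len ?n" "inp_len ?n" "steps ?n" "margin ?n" "width ?n" "cells ?n"
    by unfold_locales (simp_all add: inp_len_def margin_def width_def cells_def)
  have blue0: "concat (map enc_vertices [[7, 8], [0, 1, 7], [0, 2, 7]]) = enc_block K 0 (width ?n) blue0"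
    unfolding enc_block_def blue0_def by (simp add: numeral_2_eq_2)
  have red0: "concat (map enc_vertices [[3, 4], [4, 5], [5, 6], [3, 6]]) = enc_block K (cells ?n) (width ?n) red0"
    unfolding enc_block_def red0_def by simp
  have "concat (map enc_vertices blue_lists) = enc_block K 0 (width ?n) blue0 @ enc_blocks K (width ?n) 0 (blocks x)"
    unfolding blue_lists_def blocks_def blocks_kindf enc_blocks_map enc_block_vertices[symmetric] kd_lists
    by (simp only: map_append concat_append blue0)
  moreover have "concat (map enc_vertices red_lists) = enc_block K (cells ?n) (width ?n) red0 @
      concat (map (\<lambda>k. enc_block K k (width ?n) red) [0..<cells ?n])"
    unfolding red_lists_def enc_block_vertices[symmetric] red_block
    by (simp only: map_append concat_append red0)
  ultimately have "reduction_string x = string"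
    unfolding reduction_string_def string_def Let_def by (simp add: enc_unary_add)
  then show ?thesis using string_in_lang_iff by simp
qed

end

theorem theorem14:
  shows "NP_hard (achievement_pos_lang 3 2)"
  unfolding NP_hard_def
proof (intro allI impI)
  fix L assume "in_NP L"
  then obtain M c1 k1 where M: "poly_time_tm M"
    and L: "\<And>x. x \<in> L \<longleftrightarrow> (\<exists>w. length w \<le> c1 * length x ^ k1 + c1 \<and> (\<exists>t. accepting (tm_run M t (pair_enc x w))))"
    unfolding in_NP_def by blast
  obtain Q G \<delta> where M_eq: "M = (Q, G, \<delta>)" by (cases M)
  obtain c2 k2 where wf: "wf_tm M" and halt: "\<And>y. halted (tm_run M (c2 * length y ^ k2 + c2) y)"
    using M unfolding poly_time_tm_def by blast
  interpret verifier Q G \<delta> c1 k1 c2 k2 using wf unfolding M_eq by unfold_locales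
  have "x \<in> L \<longleftrightarrow> reduction_string x \<in> achievement_pos_lang 3 2" for x
  proof -
    \<comment> \<open>The number of simulated steps may depend on the length of \<open>x\<close>
      only. It bounds the running time for all admissible witnesses because \<open>inp_len\<close>
      is the largest length of a paired input.\<close>
    have "(\<exists>t. accepting (tm_run M t (pair_enc x w))) \<longleftrightarrow> accepting (tm_run M (steps (length x)) (pair_enc x w))"
      if w: "length w \<le> wit_len (length x)" for w
    proof (rule accepting_iff_halted)
      have "length (concat (map (\<lambda>b. [False, b]) x)) = 2 * length x" by (induction x) auto
      then have "length (pair_enc x w) \<le> inp_len (length x)"
        using w unfolding pair_enc_def inp_len_def by simp
      then have "c2 * length (pair_enc x w) ^ k2 + c2 \<le> steps (length x)"
        unfolding steps_def by (intro add_right_mono mult_le_mono2 power_mono) simp_all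
      from halted_stays[OF halt this] show "halted (tm_run M (steps (length x)) (pair_enc x w))"
        using halt by simp
    qed
    then show ?thesis unfolding L reduction_correct M_eq[symmetric] wit_len_def by blast
  qed
  moreover obtain M' c k where "wf_tm M'" "\<And>x. halted (tm_run M' (c * length x ^ k + c) x) \<and>
     tape_output (tm_run M' (c * length x ^ k + c) x) (reduction_string x)"
    using reduction_machine by blast
  ultimately show "poly_reducible L (achievement_pos_lang 3 2)"
    unfolding poly_reducible_def by blast
qed

end
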